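(* Let $\mathcal{H}$ and $\mathcal{L}$ be separable Hilbert spaces. Let $A$ be the infinitesimal generator of a strongly continuous semigroup $S(t)$, $t\ge 0$, on $\mathcal{H}$, let $B:\mathcal{L}\to\mathcal{H}$ be a continuous linear map, and assume that for $t>0$ the operator $$Q_t\mathbf{x}=\int_0^t S(s)BB^{*}S^{*}(s)\mathbf{x}\,ds,\qquad \mathbf{x}\in\mathcal{H},$$ is of trace class. Let $W(t)$, $t\ge0$, be the $\mathcal{L}$-valued $\mathrm{Q}$-Wiener process described in the context, let $X(t,\mathbf{x})$ be the mild solution of the stochastic evolution equation $d\mathbf{X}(t)=A\mathbf{X}(t)\,dt+B\,dW(t)$, $\mathbf{X}(0)=\mathbf{x}$, and let $M_t$, $t\ge0$, be the associated Markov semigroup. Fix $T>0$. Then $M_t$ is $T$-regular if and only if there exists a constant $C_{\mathrm{obs}}>0$ such that $$\int_0^T\|B^{*}Z(t)\|_{\mathcal{L}}^2\,dt\ \ge\ C_{\mathrm{obs}}\,\|Z(0)\|_{\mathcal{H}}^2\qquad\text{for all } z\in\mathrm{Dom}(A^{*}),$$ where $Z$ is the solution of the adjoint system $\dot Z(t)=-A^{*}Z(t)$, $t\in[0,T]$, $Z(T)=z\in\mathrm{Dom}(A^{*})$.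
   Context: $S^{*}(t)$ and $B^{*}$ denote the adjoints of $S(t)$ and $B$; $S^{*}(t)$ is a strongly continuous semigroup whose generator is the adjoint $A^{*}$ of $A$. Noise: $\mathrm{Q}$ is a symmetric nonnegative bounded linear operator on $\mathcal{L}$ of trace class, with a complete orthonormal basis $\{e_k\}$ of $\mathcal{L}$ and a bounded sequence $\{\gamma_k\}$ of nonnegative real numbers such that $\mathrm{Q}e_k=\gamma_ke_k$, $k=1,2,\dots$. $W$ is an $\mathcal{L}$-valued $\mathrm{Q}$-Wiener process with the expansion $W(t)=\sum_{k=1}^\infty\gamma_k\beta_k(t)e_k$, where $\{\beta_k\}$ is a sequence of mutually independent real-valued Brownian motions on a probability space $(\Omega,\mathcal{F},\mathbb{P})$ with filtration $(\mathcal{F}_t)_{t\ge0}$. The mild solution is the $\mathcal{H}$-valued $\mathcal{F}_t$-adapted process $$X(t,\mathbf{x})=S(t)\mathbf{x}+\int_0^tS(t-s)B\,dW(s).$$ The transition function is $P_t(\mathbf{x},\Lambda)=\mathbb{P}(X(t,\mathbf{x})\in\Lambda)$ for Borel sets $\Lambda\subset\mathcal{H}$ and $\mathbf{x}\in\mathcal{H}$, and the Markov semigroup is $M_tf(\mathbf{x})=\int_{\mathcal{H}}f(z)\,P_t(\mathbf{x},dz)$. $M_t$ is called $t_0$-regular if all transition probabilities $P_{t_0}(\mathbf{x},\cdot)$, $\mathbf{x}\in\mathcal{H}$, are mutually equivalent (mutually absolutely continuous).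
   Formalization: With W expanded as in the context the equivalence is false as printed (e.g. Q = 0 gives Dirac laws although the inequality may hold); in the observability inequality ‖B*Z(t)‖ is therefore replaced by ‖(BQ)*Z(t)‖ = ‖QB*Z(t)‖. *)

theory Defs
  imports "HOL-Probability.Probability"
begin

text \<open>Strongly continuous semigroups. A family \<open>S\<close> is indexed by \<open>real\<close>, but only its values at
  times \<open>t \<ge> 0\<close> are constrained or used.\<close>

definition c0_semigroup :: "(real \<Rightarrow> 'h::real_normed_vector \<Rightarrow> 'h) \<Rightarrow> bool" where
  "c0_semigroup S \<longleftrightarrow>
     (\<forall>t\<ge>0. bounded_linear (S t)) \<and>
     (\<forall>x. S 0 x = x) \<and>
     (\<forall>s\<ge>0. \<forall>t\<ge>0. \<forall>x. S (s + t) x = S s (S t x)) \<and>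
     (\<forall>x. ((\<lambda>t. S t x) \<longlongrightarrow> x) (at_right 0))"

text \<open>Unbounded operators are represented by their graphs, so that \<open>Domain A\<close> is the domain
  of \<open>A\<close>.\<close>

definition generator :: "(real \<Rightarrow> 'h::real_normed_vector \<Rightarrow> 'h) \<Rightarrow> ('h \<times> 'h) set" where
  "generator S = {(x, y). ((\<lambda>h. (S h x - x) /\<^sub>R h) \<longlongrightarrow> y) (at_right 0)}"

text \<open>When \<open>A\<close> is densely defined, as every generator is, this relation is single-valued.\<close>

definition adjoint_graph :: "('h::real_inner \<times> 'h) set \<Rightarrow> ('h \<times> 'h) set" where
  "adjoint_graph A = {(z, w). \<forall>(x, y) \<in> A. y \<bullet> z = x \<bullet> w}"

text \<open>The classical solution of \<open>Z' = - A\<^sup>* Z\<close> on \<open>[0, T]\<close> with terminal value \<open>z\<close>.\<close>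

definition solves_adjoint_system ::
    "('h::real_inner \<times> 'h) set \<Rightarrow> real \<Rightarrow> 'h \<Rightarrow> (real \<Rightarrow> 'h) \<Rightarrow> bool" where
  "solves_adjoint_system A T z Z \<longleftrightarrow>
     (\<forall>t\<in>{0..T}. \<exists>w. (Z t, w) \<in> adjoint_graph A \<and>
        (Z has_vector_derivative - w) (at t within {0..T})) \<and>
     Z T = z"

text \<open>Trace class in the sense of nuclear operators.\<close>

definition trace_class :: "('a::real_inner \<Rightarrow> 'a) \<Rightarrow> bool" where
  "trace_class R \<longleftrightarrow> (\<exists>a b :: nat \<Rightarrow> 'a.
     summable (\<lambda>k. norm (a k) * norm (b k)) \<and> (\<forall>x. (\<lambda>k. (x \<bullet> a k) *\<^sub>R b k) sums R x))"

definition Qt :: "(real \<Rightarrow> 'h \<Rightarrow> 'h::{real_inner,banach,second_countable_topology}) \<Rightarrow>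
    ('l::real_inner \<Rightarrow> 'h) \<Rightarrow> real \<Rightarrow> 'h \<Rightarrow> 'h" where
  "Qt S B t x = (LBINT s:{0..t}. S s (B (adjoint B (adjoint (S s) x))))"

definition orthonormal_basis :: "nat set \<Rightarrow> (nat \<Rightarrow> 'l::real_inner) \<Rightarrow> bool" where
  "orthonormal_basis K e \<longleftrightarrow>
     (\<forall>i\<in>K. \<forall>j\<in>K. e i \<bullet> e j = (if i = j then 1 else 0)) \<and> closure (span (e ` K)) = UNIV"

text \<open>\<open>noise_covariance Q K e \<gamma>\<close>: the operator \<open>Q\<close> is diagonal in the basis \<open>e\<close> with
  eigenvalues \<open>\<gamma>\<close>. The index set \<open>K\<close> is \<open>{1..}\<close> for an infinite-dimensional space and \<open>{1..d}\<close>
  for a \<open>d\<close>-dimensional one.\<close>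

definition noise_covariance ::
    "('l::real_inner \<Rightarrow> 'l) \<Rightarrow> nat set \<Rightarrow> (nat \<Rightarrow> 'l) \<Rightarrow> (nat \<Rightarrow> real) \<Rightarrow> bool" where
  "noise_covariance Q K e \<gamma> \<longleftrightarrow>
     bounded_linear Q \<and> (\<forall>u v. Q u \<bullet> v = u \<bullet> Q v) \<and> (\<forall>u. 0 \<le> Q u \<bullet> u) \<and> trace_class Q \<and>
     orthonormal_basis K e \<and>
     (\<forall>k\<in>K. 0 \<le> \<gamma> k) \<and> bdd_above (\<gamma> ` K) \<and> (\<forall>k\<in>K. Q (e k) = \<gamma> k *\<^sub>R e k)"

definition time_filtration :: "'w measure \<Rightarrow> (real \<Rightarrow> 'w measure) \<Rightarrow> bool" where
  "time_filtration M F \<longleftrightarrow>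
     (\<forall>t\<ge>0. subalgebra M (F t)) \<and> (\<forall>s\<ge>0. \<forall>t\<ge>s. sets (F s) \<subseteq> sets (F t))"

definition brownian_motion ::
    "'w measure \<Rightarrow> (real \<Rightarrow> 'w measure) \<Rightarrow> (real \<Rightarrow> 'w \<Rightarrow> real) \<Rightarrow> bool" where
  "brownian_motion M F b \<longleftrightarrow>
     (\<forall>t\<ge>0. b t \<in> borel_measurable (F t)) \<and>
     (AE \<omega> in M. b 0 \<omega> = 0) \<and>
     (AE \<omega> in M. continuous_on {0..} (\<lambda>t. b t \<omega>)) \<and>
     (\<forall>s\<ge>0. \<forall>t>s.
        distributed M lborel (\<lambda>\<omega>. b t \<omega> - b s \<omega>) (normal_density 0 (sqrt (t - s))) \<and>
        prob_space.indep_set M (sets (F s))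
          (sets (vimage_algebra (space M) (\<lambda>\<omega>. b t \<omega> - b s \<omega>) borel)))"

text \<open>The processes \<open>\<beta> k\<close>, \<open>k \<in> K\<close>, are mutually independent, as random elements of the path
  space.\<close>

definition independent_brownian_motions ::
    "'w measure \<Rightarrow> (real \<Rightarrow> 'w measure) \<Rightarrow> nat set \<Rightarrow> (nat \<Rightarrow> real \<Rightarrow> 'w \<Rightarrow> real) \<Rightarrow> bool" where
  "independent_brownian_motions M F K \<beta> \<longleftrightarrow>
     (\<forall>k\<in>K. brownian_motion M F (\<beta> k)) \<and>
     prob_space.indep_vars M (\<lambda>_. \<Pi>\<^sub>M t\<in>{0..}. borel) (\<lambda>k \<omega>. \<lambda>t\<in>{0..}. \<beta> k t \<omega>) K"

text \<open>The process \<open>W t = (\<Sum>k\<in>K. \<gamma> k * \<beta> k t * e k)\<close>. With the weights \<open>\<gamma> k\<close> (rather than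
  their square roots), the covariance operator of \<open>W 1\<close> is \<open>Q \<circ> Q\<close> when \<open>Q (e k) = \<gamma> k *\<^sub>R e k\<close>.\<close>

definition wiener_process :: "'w measure \<Rightarrow> (real \<Rightarrow> 'w measure) \<Rightarrow> nat set \<Rightarrow>
    (nat \<Rightarrow> 'l::{real_inner,banach,second_countable_topology}) \<Rightarrow> (nat \<Rightarrow> real) \<Rightarrow>
    (nat \<Rightarrow> real \<Rightarrow> 'w \<Rightarrow> real) \<Rightarrow> (real \<Rightarrow> 'w \<Rightarrow> 'l) \<Rightarrow> bool" where
  "wiener_process M F K e \<gamma> \<beta> W \<longleftrightarrow>
     independent_brownian_motions M F K \<beta> \<and>
     (\<forall>t\<ge>0. W t \<in> borel_measurable (F t)) \<and>
     (AE \<omega> in M. continuous_on {0..} (\<lambda>t. W t \<omega>)) \<and>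
     (\<forall>t\<ge>0. AE \<omega> in M. ((\<lambda>k. (\<gamma> k * \<beta> k t \<omega>) *\<^sub>R e k) has_sum W t \<omega>) K)"

text \<open>Deterministic operator-valued step functions on \<open>[0, t]\<close>: value \<open>\<Psi> i\<close> on
  \<open>(p i, p (i + 1)]\<close> for \<open>i < n\<close>, and their integrals against \<open>W\<close>.\<close>

definition partition :: "real \<Rightarrow> nat \<Rightarrow> (nat \<Rightarrow> real) \<Rightarrow> bool" where
  "partition t n p \<longleftrightarrow> p 0 = 0 \<and> p n = t \<and> (\<forall>i<n. p i \<le> p (Suc i))"

definition step_function ::
    "nat \<Rightarrow> (nat \<Rightarrow> real) \<Rightarrow> (nat \<Rightarrow> 'l \<Rightarrow> 'h::real_vector) \<Rightarrow> real \<Rightarrow> 'l \<Rightarrow> 'h" where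
  "step_function n p \<Psi> s u = (\<Sum>i<n. indicator {p i <.. p (Suc i)} s *\<^sub>R \<Psi> i u)"

definition step_integral :: "nat \<Rightarrow> (nat \<Rightarrow> real) \<Rightarrow> (nat \<Rightarrow> 'l::real_vector \<Rightarrow> 'h::real_vector) \<Rightarrow>
    (real \<Rightarrow> 'w \<Rightarrow> 'l) \<Rightarrow> 'w \<Rightarrow> 'h" where
  "step_integral n p \<Psi> W \<omega> = (\<Sum>i<n. \<Psi> i (W (p (Suc i)) \<omega> - W (p i) \<omega>))"

definition hilbert_schmidt_norm2 ::
    "nat set \<Rightarrow> (nat \<Rightarrow> 'l) \<Rightarrow> ('l \<Rightarrow> 'h::real_normed_vector) \<Rightarrow> ennreal" where
  "hilbert_schmidt_norm2 K e D = (\<Sum>\<^sub>\<infinity>k\<in>K. ennreal ((norm (D (e k)))\<^sup>2))"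

text \<open>\<open>Y\<close> is (a version of) the stochastic integral of the deterministic operator-valued function
  \<open>\<Phi>\<close> against \<open>W\<close> over \<open>[0, t]\<close>: the mean-square limit of the integrals of step functions that
  approximate \<open>\<Phi>\<close> in the norm of the Ito isometry. Here \<open>R\<close> is the square root of the covariance
  operator of \<open>W 1\<close>.\<close>

definition stochastic_integral :: "'w measure \<Rightarrow> nat set \<Rightarrow> (nat \<Rightarrow> 'l::real_normed_vector) \<Rightarrow>
    ('l \<Rightarrow> 'l) \<Rightarrow> (real \<Rightarrow> 'w \<Rightarrow> 'l) \<Rightarrow> real \<Rightarrow> (real \<Rightarrow> 'l \<Rightarrow> 'h::real_normed_vector) \<Rightarrow>
    ('w \<Rightarrow> 'h) \<Rightarrow> bool" where
  "stochastic_integral M K e R W t \<Phi> Y \<longleftrightarrow>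
     Y \<in> borel_measurable M \<and>
     (\<exists>n p \<Psi>.
        (\<forall>m. partition t (n m) (p m) \<and> (\<forall>i<n m. bounded_linear (\<Psi> m i))) \<and>
        (\<lambda>m. \<integral>\<^sup>+s\<in>{0..t}. hilbert_schmidt_norm2 K e
            (\<lambda>u. \<Phi> s (R u) - step_function (n m) (p m) (\<Psi> m) s (R u)) \<partial>lborel) \<longlonglongrightarrow> 0 \<and>
        (\<lambda>m. \<integral>\<^sup>+\<omega>. ennreal ((norm (Y \<omega> - step_integral (n m) (p m) (\<Psi> m) W \<omega>))\<^sup>2) \<partial>M)
          \<longlonglongrightarrow> 0)"

text \<open>Since the covariance operator of \<open>W 1\<close> is \<open>Q \<circ> Q\<close>, its square root is \<open>Q\<close> itself.
  The noise thus drives the equation through the effective coefficient \<open>B \<circ> Q\<close>: the covariance of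
  \<open>X t x\<close> is \<open>Qt S (B \<circ> Q) t\<close>, which is \<open>Qt S B t\<close> when \<open>Q\<close> is the identity.\<close>

definition mild_solution :: "'w measure \<Rightarrow> (real \<Rightarrow> 'w measure) \<Rightarrow> nat set \<Rightarrow>
    (nat \<Rightarrow> 'l::real_normed_vector) \<Rightarrow> ('l \<Rightarrow> 'l) \<Rightarrow> (real \<Rightarrow> 'w \<Rightarrow> 'l) \<Rightarrow>
    (real \<Rightarrow> 'h \<Rightarrow> 'h) \<Rightarrow> ('l \<Rightarrow> 'h::real_normed_vector) \<Rightarrow> (real \<Rightarrow> 'h \<Rightarrow> 'w \<Rightarrow> 'h) \<Rightarrow> bool" where
  "mild_solution M F K e Q W S B X \<longleftrightarrow>
     (\<forall>x. \<forall>t\<ge>0. X t x \<in> borel_measurable (F t) \<and>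
        (\<exists>Y. stochastic_integral M K e Q W t (\<lambda>s u. S (t - s) (B u)) Y \<and>
             (AE \<omega> in M. X t x \<omega> = S t x + Y \<omega>)))"

definition transition ::
    "'w measure \<Rightarrow> (real \<Rightarrow> 'h \<Rightarrow> 'w \<Rightarrow> 'h::topological_space) \<Rightarrow> real \<Rightarrow> 'h \<Rightarrow> 'h measure" where
  "transition M X t x = distr M borel (X t x)"

text \<open>Regularity at time \<open>t\<close> of the Markov semigroup with transition probabilities \<open>P\<close>.\<close>

definition regular_at :: "(real \<Rightarrow> 'h \<Rightarrow> 'h measure) \<Rightarrow> real \<Rightarrow> bool" where
  "regular_at P t \<longleftrightarrow> (\<forall>x y. absolutely_continuous (P t x) (P t y))"

end

(*
  Let Y be the stochastic convolution at time T, so that P_T(x, .) is the law of S(T)x + Y, and let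
  I(z) be the integral of |Q B* S*(T - s) z|^2 over [0, T], the observation of the adjoint solution
  that ends in z. By the Ito isometry I(z) is the variance of <Y, z>.

  If the law of h + Y is absolutely continuous with respect to that of Y, then <h, z>^2 <= c I(z):
  otherwise some z_n satisfy <h, z_n> = 1 and <Y, z_n> -> 0 almost surely. For h = S(T)x and all x,
  the uniform boundedness principle turns this into |S*(T) z|^2 <= C I(z), which is observability,
  because the adjoint solution is Z(t) = S*(T - t) z.

  Conversely, let <h, z>^2 <= c I(z). Approximate Y in mean square by finite sums
  G = sum_j xi_j v_j with independent standard normal xi_j. Tikhonov regularisation gives
  coefficients a with sum_j a_j v_j close to h and |a|^2 <= 2c', where c' depends only on c, and a
  shift of G by sum_j a_j v_j satisfies (E f(G + shift))^2 <= exp(|a|^2) E f(G)^2 by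
  Cauchy-Schwarz. The bound survives the passage to the limit, so mu_h(C)^2 <= exp(2c') mu(C) for
  closed C, where mu and mu_h are the laws of Y and h + Y; by inner regularity every mu-null set is
  mu_h-null.
*)
theory Submission
  imports Defs
begin

text \<open>No translation-invariant reference measure is at hand on an infinite-dimensional space,
  so densities are used in finitely many variables only. What survives the limit is an inequality
  for bounded continuous functions whose constant depends on the squared length of the shift
  coefficients and not on the number of variables. Squaring the expectation is the price for turning
  a density into such an inequality.

  Regularisation enters because \<open>h\<close> need not lie in the span of the vectors
  \<open>v j\<close>; even if it does, the variance bound controls exact coefficients only up to the
  error of replacing \<open>Y\<close> by a finite sum. That error is used as the regularising term.

  The stochastic integral is specified only through some sequence of approximating step functions.
  All facts about \<open>Y\<close> are therefore drawn from the predicate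
  \<open>step_approximable\<close>, which determines \<open>Y\<close> up to null sets and ties it to
  finitely many Brownian motions. Factors 2 and 4 are given away freely, since observability asks
  for some positive constant and not for the best one.\<close>

section \<open>Hilbert space preliminaries\<close>

text \<open>The solution minimises the energy \<open>J x = a x x - 2 * \<phi> x\<close> over
  \<open>V\<close>. By the parallelogram identity for \<open>a\<close> and coercivity, minimising
  sequences are Cauchy. Three uses share this form: Riesz representation, orthogonal projection onto
  a closed subspace, and Tikhonov regularisation.\<close>

lemma symmetric_lax_milgram:
  fixes a :: "'h::{real_inner,banach} \<Rightarrow> 'h \<Rightarrow> real"
  assumes a: "bounded_bilinear a" and sym: "\<And>x y. a x y = a y x"
    and "\<delta> > 0" and coercive: "\<And>x. \<delta> * (norm x)\<^sup>2 \<le> a x x"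
    and \<phi>: "bounded_linear \<phi>" and V: "subspace V" "closed V"
  obtains x where "x \<in> V" "\<And>y. y \<in> V \<Longrightarrow> a x y = \<phi> y"
proof -
  interpret a: bounded_bilinear a by fact
  interpret \<phi>: bounded_linear \<phi> by fact
  define J where "J x = a x x - 2 * \<phi> x" for x
  obtain C where C: "\<And>x. norm (\<phi> x) \<le> norm x * C"
    using \<phi>.bounded by blast
  have lower: "- C\<^sup>2 / \<delta> \<le> J x" for x
  proof -
    have "0 \<le> \<delta> * (norm x - C / \<delta>)\<^sup>2" using \<open>\<delta> > 0\<close> by simp
    also have "\<dots> = \<delta> * (norm x)\<^sup>2 - 2 * (norm x * C) + C\<^sup>2 / \<delta>"
      using \<open>\<delta> > 0\<close> by (simp add: power2_eq_square field_simps)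
    finally show ?thesis using coercive[of x] C[of x] by (auto simp: J_def)
  qed
  have "0 \<in> V" using V(1) by (rule subspace_0)
  define m where "m = Inf (J ` V)"
  have bdd: "bdd_below (J ` V)" using lower by (intro bdd_belowI2)
  have m_le: "m \<le> J x" if "x \<in> V" for x
    unfolding m_def using bdd that by (intro cInf_lower) auto
  have "\<exists>x\<in>V. J x < m + 1 / Suc n" for n
  proof -
    have "m < m + 1 / Suc n" by simp
    then show ?thesis unfolding m_def
      using cInf_less_iff[of "J ` V"] \<open>0 \<in> V\<close> bdd by (metis (no_types, lifting) empty_iff imageE image_is_empty)
  qed
  then obtain u where uV: "\<And>n. u n \<in> V" and uJ: "\<And>n. J (u n) < m + 1 / Suc n"
    by metis
  have par: "a (x - y) (x - y) = 2 * (J x + J y - 2 * J ((1/2) *\<^sub>R (x + y)))" for x y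
  proof -
    have "a (x - y) (x - y) = a x x - 2 * a x y + a y y"
      by (simp add: a.diff_left a.diff_right sym[of y x])
    moreover have "J ((1/2) *\<^sub>R (x + y)) = 1/4 * a (x + y) (x + y) - \<phi> (x + y)"
      by (simp add: J_def a.scaleR_left a.scaleR_right \<phi>.scaleR)
    moreover have "a (x + y) (x + y) = a x x + 2 * a x y + a y y"
      by (simp add: a.add_left a.add_right sym[of y x])
    ultimately show ?thesis unfolding J_def[of x] J_def[of y] \<phi>.add by argo
  qed
  have arith: "A \<le> 2 * (p + q)"
    if "A = 2 * (Ji + Jj - 2 * Jm)" "m \<le> Jm" "Ji < m + p" "Jj < m + q" for A Ji Jj Jm p q :: real
  proof -
    have "A = 2 * Ji + 2 * Jj - 4 * Jm" using that(1) by simp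
    with that(2-4) show ?thesis by argo
  qed
  have dist_le: "\<delta> * (norm (u i - u j))\<^sup>2 \<le> 2 * (1 / Suc i + 1 / Suc j)" for i j
  proof -
    have "(1/2) *\<^sub>R (u i + u j) \<in> V" using V(1) uV by (simp add: subspace_add subspace_scale)
    then have "a (u i - u j) (u i - u j) \<le> 2 * (1 / Suc i + 1 / Suc j)"
      by (intro arith[OF par m_le uJ uJ])
    with coercive[of "u i - u j"] show ?thesis by linarith
  qed
  have "Cauchy u"
  proof (rule metric_CauchyI)
    fix \<epsilon> :: real assume "\<epsilon> > 0"
    then obtain N where N: "4 / (\<delta> * \<epsilon>\<^sup>2) < real N" using reals_Archimedean2 by blast
    have "dist (u i) (u j) < \<epsilon>" if "i \<ge> N" "j \<ge> N" for i j
    proof -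
      have "0 < real N" using \<open>\<delta> > 0\<close> \<open>\<epsilon> > 0\<close> by (intro less_trans[OF _ N] divide_pos_pos mult_pos_pos) auto
      then have N0: "N > 0" by simp
      have 1: "1 / Suc i < 1 / N" "1 / Suc j < 1 / N"
        using that N0 by (auto simp: field_simps)
      have "\<delta> * (norm (u i - u j))\<^sup>2 < 4 / N" using dist_le[of i j] 1 by simp
      also have "\<dots> < \<delta> * \<epsilon>\<^sup>2" using N N0 \<open>\<delta> > 0\<close> \<open>\<epsilon> > 0\<close> by (simp add: field_simps)
      finally have "(norm (u i - u j))\<^sup>2 < \<epsilon>\<^sup>2" using \<open>\<delta> > 0\<close> by simp
      then show ?thesis using \<open>\<epsilon> > 0\<close> by (simp add: dist_norm power2_less_imp_less)
    qed
    then show "\<exists>N. \<forall>i\<ge>N. \<forall>j\<ge>N. dist (u i) (u j) < \<epsilon>" by blast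
  qed
  then obtain x where x: "u \<longlonglongrightarrow> x" using Cauchy_convergent_iff convergent_def by blast
  have xV: "x \<in> V" using V(2) uV x closed_sequentially by blast
  have "(\<lambda>n. J (u n)) \<longlonglongrightarrow> J x"
    unfolding J_def by (intro tendsto_intros a.tendsto \<phi>.tendsto x)
  moreover have "(\<lambda>n. m + 1 / Suc n) \<longlonglongrightarrow> m + 0"
    by (intro tendsto_intros) (use LIMSEQ_inverse_real_of_nat in \<open>simp add: inverse_eq_divide\<close>)
  ultimately have "J x \<le> m + 0"
    by (rule LIMSEQ_le) (use uJ in \<open>auto intro: less_imp_le\<close>)
  then have Jx: "J x \<le> m" by simp
  have "a x y = \<phi> y" if "y \<in> V" for y
  proof (rule ccontr)
    assume ne: "a x y \<noteq> \<phi> y"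
    define g where "g = a x y - \<phi> y"
    define c where "c = a y y"
    have "c \<ge> 0" using \<open>\<delta> > 0\<close> unfolding c_def
      by (intro order_trans[OF _ coercive[of y]]) simp
    \<comment> \<open>Minimising \<open>2 * t * g + t^2 * c\<close> would give
      \<open>- g / c\<close>; the denominator \<open>c + 1\<close> avoids a separate case
      \<open>c = 0\<close> and still makes the variation negative.\<close>
    define t where "t = - g / (c + 1)"
    have "x + t *\<^sub>R y \<in> V" using V(1) xV that by (simp add: subspace_add subspace_scale)
    then have "J x \<le> J (x + t *\<^sub>R y)" using m_le Jx by fastforce
    also have "\<dots> = J x + 2 * t * g + t\<^sup>2 * c"
      by (simp add: J_def g_def c_def a.add_left a.add_right a.scaleR_left a.scaleR_right
          \<phi>.add \<phi>.scaleR sym[of y x] power2_eq_square algebra_simps)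
    finally have "0 \<le> 2 * t * g + t\<^sup>2 * c" by simp
    also have "\<dots> \<le> 2 * t * g + t\<^sup>2 * (c + 1)" by (simp add: mult_left_mono)
    also have "\<dots> = t * (2 * g + t * (c + 1))" by (simp add: power2_eq_square algebra_simps)
    also have "\<dots> = t * (2 * g + - g)" using \<open>c \<ge> 0\<close> by (simp add: t_def)
    also have "\<dots> = - g\<^sup>2 / (c + 1)" by (simp add: t_def power2_eq_square)
    finally have "g\<^sup>2 \<le> 0" using \<open>c \<ge> 0\<close> by (simp add: field_simps)
    then show False using ne by (simp add: g_def)
  qed
  with xV that show ?thesis by blast
qed

lemma riesz_representation:
  fixes \<phi> :: "'h::{real_inner,banach} \<Rightarrow> real"
  assumes "bounded_linear \<phi>"
  obtains z where "\<And>y. \<phi> y = y \<bullet> z"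
proof -
  obtain z where "\<And>y. y \<in> UNIV \<Longrightarrow> z \<bullet> y = \<phi> y"
    using symmetric_lax_milgram[of inner 1 \<phi> UNIV] assms bounded_bilinear_inner
    by (auto simp: inner_commute power2_norm_eq_inner)
  then show thesis using that by (metis UNIV_I inner_commute)
qed

text \<open>\<open>adjoint\<close> is a Hilbert choice, so its defining identity is available only
  once some operator satisfies it; Riesz representation supplies one.\<close>

lemma adjoint_inner:
  fixes f :: "'a::{real_inner,banach} \<Rightarrow> 'b::real_inner"
  assumes "bounded_linear f"
  shows "f x \<bullet> y = x \<bullet> adjoint f y"
proof -
  have "\<exists>z. \<forall>x. f x \<bullet> y = x \<bullet> z" for y
    using riesz_representation[OF bounded_linear_compose[OF bounded_linear_inner_left assms], of y]
    by metis
  then have "\<exists>f'. \<forall>x y. f x \<bullet> y = x \<bullet> f' y" by metis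
  from someI_ex[OF this] show ?thesis unfolding adjoint_def by blast
qed

lemma bounded_linear_adjoint:
  fixes f :: "'a::{real_inner,banach} \<Rightarrow> 'b::real_inner"
  assumes "bounded_linear f"
  shows "bounded_linear (adjoint f)" and "norm (adjoint f y) \<le> onorm f * norm y"
proof -
  have le: "norm (adjoint f y) \<le> onorm f * norm y" for y
  proof -
    have "(norm (adjoint f y))\<^sup>2 = f (adjoint f y) \<bullet> y"
      by (simp add: power2_norm_eq_inner adjoint_inner[OF assms])
    also have "\<dots> \<le> norm (f (adjoint f y)) * norm y" by (rule norm_cauchy_schwarz)
    also have "\<dots> \<le> (onorm f * norm (adjoint f y)) * norm y"
      by (intro mult_right_mono onorm assms) auto
    finally have "norm (adjoint f y) * norm (adjoint f y) \<le> norm (adjoint f y) * (onorm f * norm y)"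
      by (simp add: power2_eq_square ac_simps)
    then show ?thesis
      by (cases "norm (adjoint f y) = 0") (auto simp: onorm_pos_le[OF assms] intro: mult_nonneg_nonneg)
  qed
  then show "norm (adjoint f y) \<le> onorm f * norm y" .
  have eqI: "u = v" if "\<And>x. x \<bullet> u = x \<bullet> v" for u v :: 'a
    using that[of "u - v"] by (metis eq_iff_diff_eq_0 inner_diff_right inner_eq_zero_iff)
  show "bounded_linear (adjoint f)"
  proof (rule bounded_linear_intro[where K = "onorm f"])
    show "adjoint f (x + y) = adjoint f x + adjoint f y" for x y
      by (rule eqI) (simp add: inner_add_right flip: adjoint_inner[OF assms])
    show "adjoint f (r *\<^sub>R x) = r *\<^sub>R adjoint f x" for r x
      by (rule eqI) (simp flip: adjoint_inner[OF assms])
    show "norm (adjoint f x) \<le> norm x * onorm f" for x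
      using le[of x] by (simp add: mult.commute)
  qed
qed

lemma subspace_closure:
  fixes V :: "'a::real_normed_vector set"
  assumes "subspace V"
  shows "subspace (closure V)"
  unfolding subspace_def
proof (intro conjI ballI allI)
  show "0 \<in> closure V" using assms closure_subset subspace_0 by blast
next
  fix x y assume "x \<in> closure V" "y \<in> closure V"
  then obtain f g where "\<And>n. f n \<in> V" "f \<longlonglongrightarrow> x" "\<And>n. g n \<in> V" "g \<longlonglongrightarrow> y"
    by (auto simp: closure_sequential)
  then show "x + y \<in> closure V"
    unfolding closure_sequential using assms
    by (intro exI[of _ "\<lambda>n. f n + g n"]) (auto intro: tendsto_add subspace_add)
next
  fix c x assume "x \<in> closure V"
  then obtain f where "\<And>n. f n \<in> V" "f \<longlonglongrightarrow> x"
    by (auto simp: closure_sequential)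
  then show "c *\<^sub>R x \<in> closure V"
    unfolding closure_sequential using assms
    by (intro exI[of _ "\<lambda>n. c *\<^sub>R f n"]) (auto intro: tendsto_scaleR subspace_scale)
qed

text \<open>Lax-Milgram with the inner product on \<open>closure V\<close> yields the orthogonal
  projection of \<open>y\<close>, and the remainder is orthogonal to \<open>V\<close>, hence
  zero.\<close>

lemma orthogonal_trivial_imp_dense:
  fixes V :: "'h::{real_inner,banach} set"
  assumes V: "subspace V" and orth: "\<And>x. (\<And>v. v \<in> V \<Longrightarrow> v \<bullet> x = 0) \<Longrightarrow> x = 0"
  shows "closure V = UNIV"
proof -
  have "y \<in> closure V" for y
  proof -
    obtain x where x: "x \<in> closure V" "\<And>v. v \<in> closure V \<Longrightarrow> x \<bullet> v = y \<bullet> v"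
      using symmetric_lax_milgram[of inner 1 "inner y" "closure V"] subspace_closure[OF V]
        bounded_bilinear_inner bounded_linear_inner_right
      by (auto simp: inner_commute power2_norm_eq_inner)
    have "y - x = 0"
      using x(2) closure_subset[of V] by (intro orth) (auto simp: inner_diff_right inner_commute)
    with x(1) show ?thesis by simp
  qed
  then show ?thesis by blast
qed

text \<open>The supremum behind \<open>onorm\<close> need not be attained, hence the factor
  \<open>c < 1\<close>.\<close>

lemma exists_near_norming:
  fixes f :: "'a::real_normed_vector \<Rightarrow> 'b::real_normed_vector"
  assumes "bounded_linear f" "0 \<le> c" "c < 1" "onorm f > 0" "r > 0"
  obtains \<xi> where "norm \<xi> \<le> r" "norm (f \<xi>) \<ge> c * r * onorm f"
proof -
  interpret bounded_linear f by fact
  have "\<exists>u. norm (f u) > c * onorm f * norm u"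
  proof (rule ccontr)
    assume "\<not> ?thesis"
    then have "onorm f \<le> c * onorm f"
      using assms by (intro onorm_bound) (auto simp: not_less)
    with assms show False by simp
  qed
  then obtain u where u: "norm (f u) > c * onorm f * norm u" by blast
  then have "u \<noteq> 0" by (auto simp: zero)
  define \<xi> where "\<xi> = (r / norm u) *\<^sub>R u"
  have "norm \<xi> = r" using \<open>u \<noteq> 0\<close> \<open>r > 0\<close> by (simp add: \<xi>_def)
  moreover have "norm (f \<xi>) = r / norm u * norm (f u)" using \<open>r > 0\<close> by (simp add: \<xi>_def scaleR)
  moreover have "r / norm u * norm (f u) \<ge> r / norm u * (c * onorm f * norm u)"
    using u \<open>r > 0\<close> by (intro mult_left_mono) auto
  ultimately show thesis using that[of \<xi>] \<open>u \<noteq> 0\<close> by (simp add: mult.commute mult.left_commute)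
qed

text \<open>Sokal's proof: one of \<open>x + \<xi>\<close> and \<open>x - \<xi>\<close> has an image of norm at least \<open>norm (f \<xi>)\<close>, so
  that a point with unbounded orbit can be built by corrections of size \<open>(1/3) ^ n\<close>.\<close>

lemma uniform_boundedness:
  fixes \<F> :: "('a::banach \<Rightarrow> 'b::real_normed_vector) set"
  assumes bl: "\<And>f. f \<in> \<F> \<Longrightarrow> bounded_linear f"
    and pointwise: "\<And>x. \<exists>c. \<forall>f\<in>\<F>. norm (f x) \<le> c"
  shows "\<exists>C. \<forall>f\<in>\<F>. \<forall>x. norm (f x) \<le> C * norm x"
proof -
  have "\<exists>C. \<forall>f\<in>\<F>. onorm f \<le> C"
  proof (rule ccontr)
    assume "\<not> ?thesis"
    \<comment> \<open>Operator norms above \<open>4 ^ n\<close> outgrow the corrections of size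
      \<open>(1/3) ^ n\<close>, so the images will grow like \<open>(4/3) ^ n\<close>.\<close>
    then have "\<forall>n::nat. \<exists>f\<in>\<F>. onorm f > 4 ^ n" by (auto simp: not_le)
    then obtain f where f: "\<And>n::nat. f n \<in> \<F>" "\<And>n. onorm (f n) > 4 ^ n" by metis
    have "\<exists>y. norm (y - x) \<le> (1/3) ^ n \<and> norm (f n y) \<ge> 3/4 * (1/3) ^ n * onorm (f n)" for n x
    proof -
      interpret bounded_linear "f n" using bl f by blast
      obtain \<xi> where \<xi>: "norm \<xi> \<le> (1/3) ^ n" "norm (f n \<xi>) \<ge> 3/4 * (1/3) ^ n * onorm (f n)"
        using exists_near_norming[of "f n" "3/4" "(1/3) ^ n"] bounded_linear_axioms
          less_trans[OF _ f(2)[of n], of 0] by auto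
      have "2 * norm (f n \<xi>) = norm (f n (x + \<xi>) - f n (x - \<xi>))"
        by (simp add: add diff flip: scaleR_2)
      also have "\<dots> \<le> norm (f n (x + \<xi>)) + norm (f n (x - \<xi>))" by (rule norm_triangle_ineq4)
      finally have "norm (f n \<xi>) \<le> norm (f n (x + \<xi>)) \<or> norm (f n \<xi>) \<le> norm (f n (x - \<xi>))"
        by linarith
      then show ?thesis
      proof
        assume "norm (f n \<xi>) \<le> norm (f n (x + \<xi>))"
        with \<xi> show ?thesis by (intro exI[of _ "x + \<xi>"]) auto
      next
        assume "norm (f n \<xi>) \<le> norm (f n (x - \<xi>))"
        with \<xi> show ?thesis by (intro exI[of _ "x - \<xi>"]) auto
      qed
    qed
    then have "\<exists>g. \<forall>n x. norm (g n x - x) \<le> (1/3) ^ n \<and> norm (f n (g n x)) \<ge> 3/4 * (1/3) ^ n * onorm (f n)"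
      by (intro choice allI)
    then obtain g where g: "\<And>n x. norm (g n x - x) \<le> (1/3) ^ n"
      "\<And>n x. norm (f n (g n x)) \<ge> 3/4 * (1/3) ^ n * onorm (f n)" by blast
    define u where "u = rec_nat 0 (\<lambda>n. g (Suc n))"
    have u_Suc: "u (Suc n) = g (Suc n) (u n)" for n by (simp add: u_def)
    have step: "norm (u (Suc n) - u n) \<le> (1/3) ^ Suc n" for n unfolding u_Suc by (rule g)
    \<comment> \<open>The bound is the geometric sum of the corrections made after stage
      \<open>n\<close>.\<close>
    have far: "norm (u (n + k) - u n) \<le> 1/2 * (1/3) ^ n * (1 - (1/3) ^ k)" for n k
    proof (induction k)
      case (Suc k)
      have "norm (u (n + Suc k) - u n) \<le> norm (u (Suc (n + k)) - u (n + k)) + norm (u (n + k) - u n)"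
        by (rule order_trans[OF _ norm_triangle_ineq]) simp
      also have "\<dots> \<le> (1/3) ^ Suc (n + k) + 1/2 * (1/3) ^ n * (1 - (1/3) ^ k)"
        using Suc step by (intro add_mono)
      also have "\<dots> = 1/2 * (1/3) ^ n * (1 - (1/3) ^ Suc k)"
      proof -
        have "1/3 * (q * p) + 1/2 * q * (1 - p) = 1/2 * q * (1 - 1/3 * p)" for p q :: real
          by (simp add: field_simps)
        then show ?thesis by (simp only: power_add power_Suc)
      qed
      finally show ?case .
    qed simp
    have far': "norm (u (n + k) - u n) \<le> 1/2 * (1/3) ^ n" for n k
      by (rule order_trans[OF far]) (simp add: mult_left_le)
    have "Cauchy u"
    proof (rule metric_CauchyI)
      fix \<epsilon> :: real assume "\<epsilon> > 0"
      then have "\<exists>N. (1/3 :: real) ^ N < \<epsilon>" by (rule real_arch_pow_inv) simp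
      then obtain N where N: "(1/3 :: real) ^ N < \<epsilon>" by (elim exE)
      have "dist (u i) (u j) < \<epsilon>" if ij: "i \<ge> N" "j \<ge> N" for i j
      proof -
        obtain k l where "i = N + k" "j = N + l"
          using le_Suc_ex[OF ij(1)] le_Suc_ex[OF ij(2)] by auto
        then have "dist (u i) (u N) \<le> 1/2 * (1/3) ^ N" "dist (u j) (u N) \<le> 1/2 * (1/3) ^ N"
          using far' by (auto simp: dist_norm)
        then show ?thesis using N dist_triangle2[of "u i" "u j" "u N"] by simp
      qed
      then show "\<exists>N. \<forall>i\<ge>N. \<forall>j\<ge>N. dist (u i) (u j) < \<epsilon>" by blast
    qed
    then obtain x where x: "u \<longlonglongrightarrow> x" using Cauchy_convergent_iff convergent_def by blast
    have near: "norm (x - u n) \<le> 1/2 * (1/3) ^ n" for n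
    proof (rule LIMSEQ_le_const2)
      show "(\<lambda>k. norm (u (n + k) - u n)) \<longlonglongrightarrow> norm (x - u n)"
        using LIMSEQ_ignore_initial_segment[OF x, of n] by (intro tendsto_intros) (simp add: add.commute)
    qed (use far' in auto)
    obtain c where c: "\<And>f. f \<in> \<F> \<Longrightarrow> norm (f x) \<le> c" using pointwise by blast
    \<comment> \<open>At stage \<open>Suc n\<close> the image has norm at least 3/4 of
      \<open>(1/3) ^ Suc n\<close> times the operator norm, and all later corrections together undo
      at most 1/2 of it; a quarter remains.\<close>
    have grow: "1/4 * (4/3) ^ Suc n \<le> c" for n
    proof -
      interpret bounded_linear "f (Suc n)" using bl f by blast
      let ?r = "(1/3 :: real) ^ Suc n" and ?o = "onorm (f (Suc n))"
      have "3/4 * ?r * ?o \<le> norm (f (Suc n) (u (Suc n)))" unfolding u_Suc by (rule g)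
      also have "\<dots> \<le> norm (f (Suc n) x) + norm (f (Suc n) (x - u (Suc n)))"
        unfolding diff by (subst norm_minus_commute) (rule norm_triangle_sub)
      also have "norm (f (Suc n) (x - u (Suc n))) \<le> ?o * norm (x - u (Suc n))"
        by (intro onorm bounded_linear_axioms)
      also have "\<dots> \<le> ?o * (1/2 * ?r)"
        by (intro mult_left_mono near onorm_pos_le bounded_linear_axioms)
      finally have le: "3/4 * ?r * ?o \<le> norm (f (Suc n) x) + ?o * (1/2 * ?r)" by simp
      have "1/4 * r * q \<le> w" if "3/4 * r * q \<le> w + q * (1/2 * r)" for r q w :: real
        using that by (simp add: field_simps)
      from this[OF le] have "1/4 * ?r * ?o \<le> norm (f (Suc n) x)" .
      also have "\<dots> \<le> c" using c f by blast
      finally have 1: "1/4 * ?r * ?o \<le> c" .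
      have "1/4 * (4/3) ^ Suc n = 1/4 * ?r * 4 ^ Suc n" by (simp add: power_divide)
      also have "\<dots> \<le> 1/4 * ?r * ?o" using f(2)[of "Suc n"] by (intro mult_left_mono) auto
      finally show ?thesis using 1 by linarith
    qed
    obtain n where "4 * c < (4/3 :: real) ^ n" using real_arch_pow[of "4/3" "4 * c"] by auto
    also have "\<dots> \<le> (4/3) ^ Suc n" by simp
    finally show False using grow[of n] by simp
  qed
  then obtain C where "\<And>f. f \<in> \<F> \<Longrightarrow> onorm f \<le> C" by blast
  then show ?thesis
    using bl by (meson mult_right_mono norm_ge_zero onorm order_trans)
qed

section \<open>Strongly continuous semigroups and their adjoints\<close>

locale semigroup_c0 =
  fixes S :: "real \<Rightarrow> 'h \<Rightarrow> 'h::{real_inner,banach}"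
  assumes c0: "c0_semigroup S"
begin

lemma bounded_linear_S: "t \<ge> 0 \<Longrightarrow> bounded_linear (S t)"
  and S_zero: "S 0 x = x"
  and S_add: "s \<ge> 0 \<Longrightarrow> t \<ge> 0 \<Longrightarrow> S (s + t) x = S s (S t x)"
  and S_right: "((\<lambda>t. S t x) \<longlongrightarrow> x) (at_right 0)"
  using c0 by (auto simp: c0_semigroup_def)

lemma S_diff: "t \<ge> 0 \<Longrightarrow> S t (x - y) = S t x - S t y"
  using bounded_linear_S by (simp add: linear_simps)

lemma S_near_zero:
  assumes "\<epsilon> > 0"
  obtains d where "d > 0" "\<And>t. 0 \<le> t \<Longrightarrow> t < d \<Longrightarrow> norm (S t x - x) < \<epsilon>"
proof -
  from S_right[of x] assms obtain d where "d > 0" "\<And>t. 0 < t \<Longrightarrow> t < d \<Longrightarrow> norm (S t x - x) < \<epsilon>"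
    unfolding tendsto_iff eventually_at_right_field by (auto simp: dist_norm)
  then show thesis using that[of d] assms S_zero by (metis diff_self less_eq_real_def norm_zero)
qed

text \<open>If this fails, there are times \<open>t n\<close> tending to 0 whose operators have
  unbounded norms. Strong continuity at 0 makes each orbit along \<open>t n\<close> convergent,
  hence bounded, against the uniform boundedness principle.\<close>

lemma locally_bounded_at_0:
  obtains \<delta> C where "\<delta> > 0" "\<And>t x. 0 \<le> t \<Longrightarrow> t \<le> \<delta> \<Longrightarrow> norm (S t x) \<le> C * norm x"
proof (rule ccontr)
  assume "\<not> thesis"
  have "\<exists>t x. 0 \<le> t \<and> t \<le> 1 / Suc n \<and> norm (S t x) > real n * norm x" for n
  proof (rule ccontr)
    assume "\<nexists>t x. 0 \<le> t \<and> t \<le> 1 / Suc n \<and> norm (S t x) > real n * norm x"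
    then have "\<And>t x. 0 \<le> t \<Longrightarrow> t \<le> 1 / Suc n \<Longrightarrow> norm (S t x) \<le> real n * norm x"
      by (auto simp: not_less)
    with that[of "1 / Suc n" "real n"] \<open>\<not> thesis\<close> show False by simp
  qed
  then obtain t x where t: "\<And>n. 0 \<le> t n" "\<And>n. t n \<le> 1 / Suc n"
    and x: "\<And>n. norm (S (t n) (x n)) > real n * norm (x n)" by metis
  have t0: "t \<longlonglongrightarrow> 0"
    using t LIMSEQ_inverse_real_of_nat
    by (intro tendsto_sandwich[of "\<lambda>_. 0" t _ "\<lambda>n. inverse (real (Suc n))"])
       (auto simp: inverse_eq_divide)
  have "(\<lambda>n. S (t n) y) \<longlonglongrightarrow> y" for y
  proof (rule LIMSEQ_I)
    fix r :: real assume "r > 0"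
    then obtain d where d: "d > 0" "\<And>t. 0 \<le> t \<Longrightarrow> t < d \<Longrightarrow> norm (S t y - y) < r"
      using S_near_zero[of r y] by blast
    then show "\<exists>no. \<forall>n\<ge>no. norm (S (t n) y - y) < r"
      using LIMSEQ_D[OF t0 d(1)] t(1) by (auto simp: abs_less_iff)
  qed
  then have "\<exists>c. \<forall>f\<in>range (\<lambda>n. S (t n)). norm (f y) \<le> c" for y
    using convergent_imp_Bseq[of "\<lambda>n. S (t n) y"] by (auto simp: convergent_def Bseq_def)
  then have "\<exists>C. \<forall>f\<in>range (\<lambda>n. S (t n)). \<forall>y. norm (f y) \<le> C * norm y"
    by (intro uniform_boundedness) (use bounded_linear_S[OF t(1)] in auto)
  then obtain C where C: "\<And>n y. norm (S (t n) y) \<le> C * norm y" by blast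
  obtain n where n: "real n \<ge> C" using real_arch_simple by blast
  have "real n * norm (x n) < C * norm (x n)" using x C less_le_trans by blast
  then show False using n by (meson mult_right_mono norm_ge_zero not_le)
qed

lemma locally_bounded:
  obtains C where "C \<ge> 0" "\<And>t x. 0 \<le> t \<Longrightarrow> t \<le> T \<Longrightarrow> norm (S t x) \<le> C * norm x"
proof -
  obtain \<delta> C where \<delta>: "\<delta> > 0" and C: "\<And>t x. 0 \<le> t \<Longrightarrow> t \<le> \<delta> \<Longrightarrow> norm (S t x) \<le> C * norm x"
    by (rule locally_bounded_at_0) blast
  \<comment> \<open>A bound of at least 1 has increasing powers, so times shorter than
    \<open>\<delta>\<close> need no sharper estimate.\<close>
  define D where "D = max C 1"
  have D: "D \<ge> 1" "\<And>t x. 0 \<le> t \<Longrightarrow> t \<le> \<delta> \<Longrightarrow> norm (S t x) \<le> D * norm x"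
    using order_trans[OF C mult_right_mono[of C D]] by (auto simp: D_def)
  have *: "norm (S t x) \<le> D ^ Suc n * norm x" if "0 \<le> t" "t \<le> Suc n * \<delta>" for n t x
    using that
  proof (induction n arbitrary: t)
    case 0 then show ?case using D(2) by simp
  next
    case (Suc n)
    show ?case
    proof (cases "t \<le> \<delta>")
      case True
      then have "norm (S t x) \<le> D * norm x" using D(2) Suc.prems by blast
      also have "\<dots> \<le> D ^ Suc (Suc n) * norm x"
        using D(1) power_increasing[of 1 "Suc (Suc n)" D] by (intro mult_right_mono) auto
      finally show ?thesis .
    next
      case False
      have "S t x = S \<delta> (S (t - \<delta>) x)" using False \<delta> S_add[of \<delta> "t - \<delta>" x] by simp
      also have "norm \<dots> \<le> D * norm (S (t - \<delta>) x)" using D(2) \<delta> by simp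
      also have "\<dots> \<le> D * (D ^ Suc n * norm x)"
        using False Suc.prems D(1) by (intro mult_left_mono Suc.IH) (auto simp: algebra_simps)
      finally show ?thesis by (simp add: mult.assoc)
    qed
  qed
  obtain n where "T / \<delta> \<le> real n" using real_arch_simple by blast
  then have "T \<le> Suc n * \<delta>" using \<delta> by (simp add: field_simps)
  then show thesis using that[of "D ^ Suc n"] * D(1) by (auto intro: order_trans)
qed

text \<open>Factoring out the operator at the earlier time reduces continuity from both sides at any
  time to the one-sided limit at 0.\<close>

lemma norm_S_diff_le:
  assumes C: "\<And>t x. 0 \<le> t \<Longrightarrow> t \<le> T \<Longrightarrow> norm (S t x) \<le> C * norm x"
    and "s \<in> {0..T}" "t \<in> {0..T}"
  shows "norm (S s x - S t x) \<le> C * norm (S \<bar>s - t\<bar> x - x)"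
proof -
  have *: "norm (S s x - S t x) \<le> C * norm (S (s - t) x - x)"
    if "t \<le> s" "t \<in> {0..T}" "s \<in> {0..T}" for s t
  proof -
    have "S s x - S t x = S t (S (s - t) x - x)"
      using S_add[of t "s - t" x] that by (simp add: S_diff)
    then show ?thesis using C that by simp
  qed
  show ?thesis
    using *[of t s] *[of s t] assms(2,3) by (cases "t \<le> s") (auto simp: norm_minus_commute)
qed

lemma continuous_on_S: "continuous_on {0..} (\<lambda>t. S t x)"
proof -
  \<comment> \<open>Right-open intervals are relatively open in \<open>{0..}\<close>, so continuity
    on each of them yields continuity on the whole half-line.\<close>
  have "continuous_on {0..<T} (\<lambda>t. S t x)" for T
  proof -
    obtain C where C: "C \<ge> 0" "\<And>t x. 0 \<le> t \<Longrightarrow> t \<le> T \<Longrightarrow> norm (S t x) \<le> C * norm x"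
      using locally_bounded by blast
    show ?thesis
      unfolding continuous_on_iff
    proof (intro ballI allI impI)
      fix t \<epsilon> assume t: "t \<in> {0..<T}" and "(\<epsilon>::real) > 0"
      then have "\<epsilon> / (C + 1) > 0" using C(1) by simp
      then obtain d where d: "d > 0" "\<And>s. 0 \<le> s \<Longrightarrow> s < d \<Longrightarrow> norm (S s x - x) < \<epsilon> / (C + 1)"
        using S_near_zero[of "\<epsilon> / (C + 1)" x] by blast
      have "dist (S s x) (S t x) < \<epsilon>" if "s \<in> {0..<T}" "dist s t < d" for s
      proof -
        have "norm (S s x - S t x) \<le> C * norm (S \<bar>s - t\<bar> x - x)"
          using that t C(2) by (intro norm_S_diff_le) auto
        also have "\<dots> \<le> C * (\<epsilon> / (C + 1))"
          using d(2)[of "\<bar>s - t\<bar>"] that C(1) by (intro mult_left_mono) (auto simp: dist_real_def)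
        also have "\<dots> < \<epsilon>" using \<open>\<epsilon> > 0\<close> C(1) by (simp add: field_simps)
        finally show ?thesis by (simp add: dist_norm)
      qed
      with d(1) show "\<exists>d>0. \<forall>s\<in>{0..<T}. dist s t < d \<longrightarrow> dist (S s x) (S t x) < \<epsilon>" by blast
    qed
  qed
  then have "continuous (at t within {0..}) (\<lambda>t. S t x)" if "t \<ge> 0" for t
  proof -
    have "continuous (at t within {0..<t+1}) (\<lambda>t. S t x)"
      using \<open>\<And>T. continuous_on {0..<T} (\<lambda>t. S t x)\<close> that by (auto simp: continuous_on_eq_continuous_within)
    moreover have "at t within {0..<t+1} = at t within {0..}"
      by (rule at_within_nhd[of _ "{t-1<..<t+1}"]) auto
    ultimately show ?thesis by simp
  qed
  then show ?thesis by (simp add: continuous_on_eq_continuous_within)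
qed

section \<open>Orbit integrals and density of the domain of the generator\<close>

definition orbit_integral :: "'h \<Rightarrow> real \<Rightarrow> 'h" where
  "orbit_integral x t = integral {0..t} (\<lambda>s. S s x)"

lemma S_integrable: "0 \<le> a \<Longrightarrow> (\<lambda>s. S s x) integrable_on {a..b}"
  by (intro integrable_continuous_real continuous_on_subset[OF continuous_on_S]) auto

lemma orbit_integral_deriv:
  assumes "t \<in> {0..T}"
  shows "(orbit_integral x has_vector_derivative S t x) (at t within {0..T})"
  unfolding orbit_integral_def
  by (rule integral_has_vector_derivative[OF _ assms])
     (auto intro: continuous_on_subset[OF continuous_on_S])

text \<open>\<open>generator\<close> speaks of right quotients at 0, whereas calculus on
  \<open>{0..T}\<close> produces derivatives within the interval; this passes from the latter to the
  former.\<close>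

lemma right_quotient_tendsto:
  assumes "(f has_vector_derivative D) (at a within {0..T})" "a \<ge> 0" "a < T"
  shows "((\<lambda>h. (f (a + h) - f a) /\<^sub>R h) \<longlongrightarrow> D) (at_right 0)"
proof -
  have "at a within {a..T} = at_right a"
    by (metis assms(3) at_within_Icc_at_right)
  then have "(f has_vector_derivative D) (at_right a)"
    using has_vector_derivative_within_subset[OF assms(1), of "{a..T}"] assms(2) by auto
  then have "((\<lambda>y. (1 / norm (y - a)) *\<^sub>R (f y - (f a + (y - a) *\<^sub>R D))) \<longlongrightarrow> 0) (at_right a)"
    by (simp add: has_vector_derivative_def has_derivative_within)
  then have "((\<lambda>h. (1 / norm h) *\<^sub>R (f (a + h) - (f a + h *\<^sub>R D))) \<longlongrightarrow> 0) (at_right 0)"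
    unfolding filterlim_at_right_to_0[where a = a] by (simp add: add.commute)
  then have "((\<lambda>h. (1 / norm h) *\<^sub>R (f (a + h) - (f a + h *\<^sub>R D)) + D) \<longlongrightarrow> 0 + D) (at_right 0)"
    by (intro tendsto_intros)
  moreover have "\<forall>\<^sub>F h in at_right 0. (1 / norm h) *\<^sub>R (f (a + h) - (f a + h *\<^sub>R D)) + D = (f (a + h) - f a) /\<^sub>R h"
    using eventually_at_right_less[of "0::real"]
    by eventually_elim (simp add: scaleR_diff_right scaleR_add_right divide_inverse)
  ultimately show ?thesis by (auto intro: Lim_transform_eventually)
qed

lemma S_orbit_integral:
  assumes "r \<ge> 0" "t \<ge> 0"
  shows "S r (orbit_integral x t) = orbit_integral x (t + r) - orbit_integral x r"
proof -
  have "S r (orbit_integral x t) = integral {0..t} (S r \<circ> (\<lambda>s. S s x))"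
    unfolding orbit_integral_def using integral_linear[OF S_integrable bounded_linear_S] assms by simp
  also have "\<dots> = integral {0..t} (\<lambda>s. S (s + r) x)"
    using assms by (intro integral_cong) (simp add: S_add[symmetric] add.commute)
  also have "\<dots> = integral {r..t + r} (\<lambda>s. S s x)"
    using integral_shift_Icc_real[of 0 t "\<lambda>s. S s x" r] by (simp add: o_def add.commute)
  also have "\<dots> = orbit_integral x (t + r) - orbit_integral x r"
    unfolding orbit_integral_def
    using Henstock_Kurzweil_Integration.integral_combine[of 0 r "t + r" "\<lambda>s. S s x"] assms S_integrable by (simp add: algebra_simps)
  finally show ?thesis .
qed

text \<open>This is the source of elements of the domain. By the shift formula
  \<open>S_orbit_integral\<close> the difference quotient of the semigroup splits into the right
  quotients of the orbit integral at \<open>h\<close> and at 0, whose limits are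
  \<open>S h x\<close> and \<open>x\<close>.\<close>

lemma orbit_integral_generator:
  assumes "h > 0"
  shows "(orbit_integral x h, S h x - x) \<in> generator S"
proof -
  let ?F = "orbit_integral x"
  have "((\<lambda>r. (?F (h + r) - ?F h) /\<^sub>R r - (?F (0 + r) - ?F 0) /\<^sub>R r) \<longlongrightarrow> S h x - S 0 x) (at_right 0)"
    using assms
    by (intro tendsto_diff right_quotient_tendsto[of _ _ _ "h + 1"] orbit_integral_deriv) auto
  moreover have "\<forall>\<^sub>F r in at_right 0. (?F (h + r) - ?F h) /\<^sub>R r - (?F (0 + r) - ?F 0) /\<^sub>R r
      = (S r (?F h) - ?F h) /\<^sub>R r"
    using eventually_at_right_less[of "0::real"]
  proof eventually_elim
    case (elim r)
    have "?F 0 = 0" by (simp add: orbit_integral_def)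
    with elim assms show ?case
      by (simp add: S_orbit_integral scaleR_diff_right algebra_simps)
  qed
  ultimately have "((\<lambda>r. (S r (?F h) - ?F h) /\<^sub>R r) \<longlongrightarrow> S h x - S 0 x) (at_right 0)"
    by (rule Lim_transform_eventually)
  then show ?thesis by (simp add: generator_def S_zero)
qed

lemma orbit_average_tendsto:
  "((\<lambda>h. orbit_integral x h /\<^sub>R h) \<longlongrightarrow> x) (at_right 0)"
  using right_quotient_tendsto[OF orbit_integral_deriv[of 0 1 x]]
  by (simp add: orbit_integral_def S_zero)

lemma generator_scaleR:
  assumes "(x, y) \<in> generator S"
  shows "(c *\<^sub>R x, c *\<^sub>R y) \<in> generator S"
proof -
  have "((\<lambda>h. c *\<^sub>R ((S h x - x) /\<^sub>R h)) \<longlongrightarrow> c *\<^sub>R y) (at_right 0)"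
    using assms by (intro tendsto_intros) (simp add: generator_def)
  moreover have "\<forall>\<^sub>F h in at_right 0. c *\<^sub>R ((S h x - x) /\<^sub>R h) = (S h (c *\<^sub>R x) - c *\<^sub>R x) /\<^sub>R h"
    using eventually_at_right_less[of "0::real"]
    by eventually_elim (simp add: linear_simps bounded_linear_S scaleR_diff_right mult.commute)
  ultimately show ?thesis unfolding generator_def by (auto intro: Lim_transform_eventually)
qed

lemma Domain_generator_dense: "closure (Domain (generator S)) = UNIV"
proof -
  have "x \<in> closure (Domain (generator S))" for x
  proof (rule Lim_in_closed_set[OF closed_closure _ _ orbit_average_tendsto])
    show "\<forall>\<^sub>F h in at_right 0. orbit_integral x h /\<^sub>R h \<in> closure (Domain (generator S))"
      using eventually_at_right_less[of "0::real"]
    proof eventually_elim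
      case (elim h)
      then show ?case
        using generator_scaleR[OF orbit_integral_generator] closure_subset by blast
    qed
  qed simp
  then show ?thesis by blast
qed

text \<open>Statements about adjoint orbits are tested, here and in the next lemma, against vectors
  of the dense domain, since their orbits under \<open>S\<close> are differentiable.\<close>

lemma eq_by_generator_domain:
  assumes "\<And>x y. (x, y) \<in> generator S \<Longrightarrow> x \<bullet> u = x \<bullet> v"
  shows "u = v"
proof -
  have "closed {x. x \<bullet> u = x \<bullet> v}" by (intro closed_Collect_eq continuous_intros)
  then have "closure (Domain (generator S)) \<subseteq> {x. x \<bullet> u = x \<bullet> v}"
    using assms by (intro closure_minimal) auto
  then have "(u - v) \<bullet> u = (u - v) \<bullet> v" using Domain_generator_dense by blast
  then show ?thesis by (metis eq_iff_diff_eq_0 inner_diff_right inner_eq_zero_iff)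
qed

lemma norm_le_by_generator_domain:
  assumes "\<And>x y. (x, y) \<in> generator S \<Longrightarrow> \<bar>x \<bullet> u\<bar> \<le> c * norm x" "c \<ge> 0"
  shows "norm u \<le> c"
proof -
  have "closed {x. \<bar>x \<bullet> u\<bar> \<le> c * norm x}" by (intro closed_Collect_le continuous_intros)
  then have "closure (Domain (generator S)) \<subseteq> {x. \<bar>x \<bullet> u\<bar> \<le> c * norm x}"
    using assms by (intro closure_minimal) auto
  then have *: "\<bar>x \<bullet> u\<bar> \<le> c * norm x" for x using Domain_generator_dense by blast
  show ?thesis
  proof (cases "u = 0")
    case True
    with assms(2) show ?thesis by simp
  next
    case False
    have "norm u * norm u \<le> c * norm u" using *[of u] by (simp add: dot_square_norm power2_eq_square)
    with False show ?thesis by simp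
  qed
qed

lemma generator_S:
  assumes "(x, y) \<in> generator S" "t \<ge> 0"
  shows "(S t x, S t y) \<in> generator S"
proof -
  interpret St: bounded_linear "S t" using bounded_linear_S assms by blast
  have "((\<lambda>h. S t ((S h x - x) /\<^sub>R h)) \<longlongrightarrow> S t y) (at_right 0)"
    using assms by (intro St.tendsto) (simp add: generator_def)
  moreover have "\<forall>\<^sub>F h in at_right 0. S t ((S h x - x) /\<^sub>R h) = (S h (S t x) - S t x) /\<^sub>R h"
    using eventually_at_right_less[of "0::real"]
    by eventually_elim
       (use assms in \<open>simp add: St.scaleR St.diff S_add[symmetric] add.commute\<close>)
  ultimately show ?thesis unfolding generator_def by (auto intro: Lim_transform_eventually)
qed

lemma orbit_deriv:
  assumes xy: "(x, y) \<in> generator S" and "t \<in> {0..T}"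
  shows "((\<lambda>t. S t x) has_vector_derivative S t y) (at t within {0..T})"
proof -
  obtain C where C: "C \<ge> 0" "\<And>t x. 0 \<le> t \<Longrightarrow> t \<le> T \<Longrightarrow> norm (S t x) \<le> C * norm x"
    using locally_bounded by blast
  show ?thesis
    unfolding has_vector_derivative_def has_derivative_within_alt
  proof (intro conjI allI impI)
    show "bounded_linear (\<lambda>h. h *\<^sub>R S t y)" by (rule bounded_linear_scaleR_left)
    fix \<epsilon> :: real assume "\<epsilon> > 0"
    \<comment> \<open>The factor 2 pays for the two error terms of the left-hand derivative, and
      \<open>C + 1\<close> guards against \<open>C = 0\<close>.\<close>
    define \<eta> where "\<eta> = \<epsilon> / (2 * (C + 1))"
    have \<eta>: "\<eta> > 0" "2 * C * \<eta> \<le> \<epsilon>" using \<open>\<epsilon> > 0\<close> C(1) by (auto simp: \<eta>_def field_simps)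
    have "\<forall>\<^sub>F h in at_right 0. dist ((S h x - x) /\<^sub>R h) y < \<eta>"
      using xy \<eta>(1) by (auto simp: generator_def tendsto_iff)
    then obtain d1 where d1: "d1 > 0" "\<And>h. 0 < h \<Longrightarrow> h < d1 \<Longrightarrow> dist ((S h x - x) /\<^sub>R h) y < \<eta>"
      unfolding eventually_at_right_field by auto
    have d1': "norm (S h x - x - h *\<^sub>R y) \<le> \<eta> * h" if "0 < h" "h < d1" for h
    proof -
      have "S h x - x - h *\<^sub>R y = h *\<^sub>R ((S h x - x) /\<^sub>R h - y)"
        using that by (simp add: scaleR_diff_right)
      also have "norm \<dots> = h * norm ((S h x - x) /\<^sub>R h - y)" using that by simp
      also have "\<dots> \<le> h * \<eta>" using d1(2)[OF that] that by (intro mult_left_mono) (auto simp: dist_norm)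
      finally show ?thesis by (simp add: mult.commute)
    qed
    obtain d2 where d2: "d2 > 0" "\<And>s. 0 \<le> s \<Longrightarrow> s < d2 \<Longrightarrow> norm (S s y - y) < \<eta>"
      using S_near_zero[OF \<eta>(1), of y] by blast
    have "norm (S s x - S t x - (s - t) *\<^sub>R S t y) \<le> \<epsilon> * norm (s - t)"
      if "s \<in> {0..T}" "norm (s - t) < min d1 d2" for s
    proof (cases s t rule: linorder_cases)
      case equal then show ?thesis by simp
    next
      case greater
      let ?h = "s - t"
      have "S s x = S t (S ?h x)" using S_add[of t ?h x] assms greater by simp
      then have "S s x - S t x - ?h *\<^sub>R S t y = S t (S ?h x - x - ?h *\<^sub>R y)"
        using bounded_linear_S assms by (simp add: linear_simps)
      also have "norm \<dots> \<le> C * (\<eta> * ?h)"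
        using that greater assms C by (intro order_trans[OF C(2)] mult_left_mono d1') auto
      also have "\<dots> \<le> 2 * C * \<eta> * ?h" using C(1) \<eta>(1) greater by (simp add: mult_nonneg_nonneg)
      also have "\<dots> \<le> \<epsilon> * ?h" using \<eta>(2) greater by (intro mult_right_mono) auto
      finally show ?thesis using greater by simp
    next
      \<comment> \<open>For the left-hand derivative the earlier time \<open>s\<close> is factored
        out. The expected derivative is \<open>S s\<close> applied to \<open>S ?h y\<close> instead
        of \<open>y\<close>, which adds the error \<open>S ?h y - y\<close>.\<close>
      case less
      let ?h = "t - s"
      have s: "s \<ge> 0" using that by simp
      have 1: "S t u = S s (S ?h u)" for u using S_add[of s ?h u] s less by simp
      have "S s x - S t x - (s - t) *\<^sub>R S t y = S s (?h *\<^sub>R (S ?h y - y) - (S ?h x - x - ?h *\<^sub>R y))"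
        using bounded_linear_S[OF s] by (simp add: 1 linear_simps algebra_simps)
      also have "norm \<dots> \<le> C * (?h * \<eta> + \<eta> * ?h)"
      proof -
        have 2: "norm (?h *\<^sub>R (S ?h y - y)) \<le> ?h * \<eta>"
          using d2(2)[of ?h] less that by (auto intro!: mult_left_mono)
        have "norm (?h *\<^sub>R (S ?h y - y) - (S ?h x - x - ?h *\<^sub>R y)) \<le> ?h * \<eta> + \<eta> * ?h"
          by (rule order_trans[OF norm_triangle_ineq4 add_mono[OF 2 d1']]) (use that less in auto)
        with C(1) show ?thesis
          using that less assms by (intro order_trans[OF C(2)] mult_left_mono) auto
      qed
      also have "\<dots> \<le> \<epsilon> * ?h" using mult_right_mono[OF \<eta>(2), of ?h] less by (simp add: algebra_simps)
      finally show ?thesis using less by simp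
    qed
    then show "\<exists>d>0. \<forall>s\<in>{0..T}. norm (s - t) < d \<longrightarrow>
        norm (S s x - S t x - (s - t) *\<^sub>R S t y) \<le> \<epsilon> * norm (s - t)"
      using d1(1) d2(1) by (intro exI[of _ "min d1 d2"]) auto
  qed
qed

end

section \<open>The adjoint semigroup and the backward adjoint equation\<close>

context semigroup_c0
begin

abbreviation Sadj :: "real \<Rightarrow> 'h \<Rightarrow> 'h" where "Sadj t \<equiv> adjoint (S t)"

abbreviation Astar :: "('h \<times> 'h) set" where "Astar \<equiv> adjoint_graph (generator S)"

lemma Sadj: "t \<ge> 0 \<Longrightarrow> x \<bullet> Sadj t z = S t x \<bullet> z"
  using adjoint_inner[OF bounded_linear_S] by simp

lemma norm_Sadj_le:
  assumes "\<And>x. norm (S t x) \<le> C * norm x" "t \<ge> 0" "C \<ge> 0"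
  shows "norm (Sadj t z) \<le> C * norm z"
proof -
  have "norm (Sadj t z) \<le> onorm (S t) * norm z"
    using bounded_linear_adjoint(2) bounded_linear_S assms by blast
  also have "\<dots> \<le> C * norm z" using assms by (intro mult_right_mono onorm_bound) auto
  finally show ?thesis .
qed

lemma Sadj_0: "Sadj 0 z = z"
  by (rule eq_by_generator_domain) (simp add: Sadj S_zero)

lemma Sadj_diff: "t \<ge> 0 \<Longrightarrow> Sadj t (x - y) = Sadj t x - Sadj t y"
  using bounded_linear_adjoint(1)[OF bounded_linear_S] by (simp add: linear_simps)

lemma AstarD: "(z, w) \<in> Astar \<Longrightarrow> (x, y) \<in> generator S \<Longrightarrow> y \<bullet> z = x \<bullet> w"
  unfolding adjoint_graph_def by blast

lemma Astar_Sadj: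
  assumes "(z, w) \<in> Astar" "t \<ge> 0"
  shows "(Sadj t z, Sadj t w) \<in> Astar"
  unfolding adjoint_graph_def
  using AstarD[OF assms(1) generator_S] assms(2) by (auto simp: Sadj)

lemma generator_FTC:
  assumes "(x, y) \<in> generator S" "h \<ge> 0"
  shows "orbit_integral y h = S h x - x"
proof -
  have "((\<lambda>s. S s y) has_integral (S h x - S 0 x)) {0..h}"
    using assms by (intro fundamental_theorem_of_calculus orbit_deriv) auto
  then show ?thesis by (simp add: orbit_integral_def integral_unique S_zero)
qed

text \<open>Boundedness makes the adjoint of this map usable. That adjoint stands in for the average
  of an adjoint orbit as long as the orbit is not known to be norm continuous.\<close>

lemma bounded_linear_orbit_integral:
  assumes "h \<ge> 0"
  shows "bounded_linear (\<lambda>x. orbit_integral x h)"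
proof -
  obtain C where C: "C \<ge> 0" "\<And>t x. 0 \<le> t \<Longrightarrow> t \<le> h \<Longrightarrow> norm (S t x) \<le> C * norm x"
    using locally_bounded by blast
  show ?thesis
  proof (rule bounded_linear_intro[where K = "C * h"])
    fix x y :: 'h and r :: real
    have "orbit_integral (x + y) h = integral {0..h} (\<lambda>s. S s x + S s y)"
      unfolding orbit_integral_def
      by (intro integral_cong) (simp add: linear_simps bounded_linear_S)
    then show "orbit_integral (x + y) h = orbit_integral x h + orbit_integral y h"
      by (simp add: orbit_integral_def Henstock_Kurzweil_Integration.integral_add S_integrable)
    have "orbit_integral (r *\<^sub>R x) h = integral {0..h} (\<lambda>s. r *\<^sub>R S s x)"
      unfolding orbit_integral_def
      by (intro integral_cong) (simp add: linear_simps bounded_linear_S)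
    then show "orbit_integral (r *\<^sub>R x) h = r *\<^sub>R orbit_integral x h"
      by (simp add: orbit_integral_def)
    have "norm (orbit_integral x h) \<le> (C * norm x) * (h - 0)"
      unfolding orbit_integral_def
      using assms C(2) by (intro integral_bound continuous_on_subset[OF continuous_on_S]) auto
    then show "norm (orbit_integral x h) \<le> norm x * (C * h)" by (simp add: ac_simps)
  qed
qed

lemma subspace_Domain_Astar: "subspace (Domain Astar)"
  unfolding subspace_def
proof (intro conjI ballI allI)
  show "0 \<in> Domain Astar" by (intro DomainI[of _ 0]) (auto simp: adjoint_graph_def)
next
  fix z z' assume "z \<in> Domain Astar" "z' \<in> Domain Astar"
  then obtain w w' where "(z, w) \<in> Astar" "(z', w') \<in> Astar" by blast
  then have "(z + z', w + w') \<in> Astar" by (fastforce simp: adjoint_graph_def inner_add_right)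
  then show "z + z' \<in> Domain Astar" by blast
next
  fix c z assume "z \<in> Domain Astar"
  then obtain w where "(z, w) \<in> Astar" by blast
  then have "(c *\<^sub>R z, c *\<^sub>R w) \<in> Astar" by (fastforce simp: adjoint_graph_def)
  then show "c *\<^sub>R z \<in> Domain Astar" by blast
qed

text \<open>The weak averages \<open>\<integral>\<^sub>0\<^sup>h S\<^sup>*(s) v ds\<close> lie in the domain of the adjoint of the generator; a
  vector orthogonal to all of them has vanishing orbit averages.\<close>

lemma Domain_Astar_dense: "closure (Domain Astar) = UNIV"
proof (rule orthogonal_trivial_imp_dense[OF subspace_Domain_Astar])
  fix x assume orth: "\<And>z. z \<in> Domain Astar \<Longrightarrow> z \<bullet> x = 0"
  have "orbit_integral x h = 0" if "h > 0" for h
  proof -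
    \<comment> \<open>Pairing \<open>x\<close> with the adjoint average of its own orbit integral
      gives the squared norm of that integral, so orthogonality makes it vanish.\<close>
    let ?v = "orbit_integral x h"
    let ?z = "adjoint (\<lambda>x. orbit_integral x h) ?v"
    have z: "u \<bullet> ?z = orbit_integral u h \<bullet> ?v" for u
      using adjoint_inner[OF bounded_linear_orbit_integral, of h u ?v] that by simp
    have "(?z, Sadj h ?v - ?v) \<in> Astar"
      unfolding adjoint_graph_def
      using that by (auto simp: z generator_FTC inner_diff_left inner_diff_right Sadj)
    then have "?z \<bullet> x = 0" using orth by blast
    with z[of x] show ?thesis by (simp add: inner_commute)
  qed
  then have "\<forall>\<^sub>F h in at_right 0. 0 = orbit_integral x h /\<^sub>R h"
    using eventually_at_right_less[of "0::real"] by (auto elim!: eventually_mono)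
  then have "((\<lambda>_. 0) \<longlongrightarrow> x) (at_right (0::real))"
    using Lim_transform_eventually[OF orbit_average_tendsto, of x "\<lambda>_. 0"]
    by (auto elim!: eventually_mono)
  then show "x = 0" using tendsto_unique[OF _ tendsto_const] trivial_limit_at_right_real by metis
qed

lemma inner_orbit_deriv:
  assumes "(x, y) \<in> generator S" "(z, w) \<in> Astar" "t \<in> {0..T}"
  shows "((\<lambda>t. S t x \<bullet> z) has_real_derivative S t x \<bullet> w) (at t within {0..T})"
proof -
  have "((\<lambda>t. S t x \<bullet> z) has_vector_derivative S t y \<bullet> z) (at t within {0..T})"
    using bounded_linear.has_vector_derivative[OF bounded_linear_inner_left orbit_deriv[OF assms(1,3)]] .
  moreover have "S t y \<bullet> z = S t x \<bullet> w" using AstarD[OF assms(2) generator_S[OF assms(1)]] assms(3) by simp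
  ultimately show ?thesis by (simp add: has_real_derivative_iff_has_vector_derivative)
qed

text \<open>The mean value theorem for the scalar orbits \<open>S r x \<bullet> z\<close> with \<open>x\<close> in the domain of the generator; the
  norm continuity of \<open>r \<mapsto> S\<^sup>*(r) w\<close> is not yet known at this point.\<close>

lemma Sadj_taylor:
  assumes zw: "(z, w) \<in> Astar" and s: "s \<in> {0..T}" and t: "t \<in> {0..T}" and "B \<ge> 0"
    and B: "\<And>r. r \<in> closed_segment s t \<Longrightarrow> norm (Sadj r w - v) \<le> B"
  shows "norm (Sadj t z - Sadj s z - (t - s) *\<^sub>R v) \<le> B * \<bar>t - s\<bar>"
proof (rule norm_le_by_generator_domain)
  fix x y assume xy: "(x, y) \<in> generator S"
  let ?g = "\<lambda>r. S r x \<bullet> z - r * (x \<bullet> v)"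
  have sub: "closed_segment s t \<subseteq> {0..T}" using s t by (auto simp: closed_segment_eq_real_ivl)
  have "norm (?g t - ?g s) \<le> (B * norm x) * norm (t - s)"
  proof (rule field_differentiable_bound[where S = "closed_segment s t" and f' = "\<lambda>r. S r x \<bullet> w - x \<bullet> v"])
    fix r assume r: "r \<in> closed_segment s t"
    show "(?g has_field_derivative S r x \<bullet> w - x \<bullet> v) (at r within closed_segment s t)"
    proof -
      have "((\<lambda>t. S t x \<bullet> z) has_real_derivative S r x \<bullet> w) (at r within closed_segment s t)"
        using DERIV_subset[OF inner_orbit_deriv[OF xy zw] sub] sub r by blast
      then show ?thesis by (auto intro!: derivative_eq_intros)
    qed
    have "S r x \<bullet> w - x \<bullet> v = x \<bullet> (Sadj r w - v)" using sub r by (auto simp: Sadj inner_diff_right)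
    also have "\<bar>\<dots>\<bar> \<le> norm x * B"
      by (rule order_trans[OF Cauchy_Schwarz_ineq2 mult_left_mono[OF B[OF r]]]) simp
    finally show "norm (S r x \<bullet> w - x \<bullet> v) \<le> B * norm x" by (simp add: mult.commute)
  qed auto
  moreover have "?g t - ?g s = x \<bullet> (Sadj t z - Sadj s z - (t - s) *\<^sub>R v)"
    using s t by (simp add: inner_diff_right Sadj algebra_simps)
  ultimately show "\<bar>x \<bullet> (Sadj t z - Sadj s z - (t - s) *\<^sub>R v)\<bar> \<le> B * \<bar>t - s\<bar> * norm x"
    by (simp add: ac_simps)
qed (use \<open>B \<ge> 0\<close> in simp)

text \<open>On the domain of the adjoint generator orbits are Lipschitz, by
  \<open>Sadj_taylor\<close> with \<open>v = 0\<close>. Density of that domain and the uniform bound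
  on \<open>[0, T]\<close> carry continuity over to every \<open>z\<close>.\<close>

lemma continuous_on_Sadj: "continuous_on {0..T} (\<lambda>t. Sadj t z)"
proof -
  obtain C where C: "C \<ge> 0" "\<And>t x. 0 \<le> t \<Longrightarrow> t \<le> T \<Longrightarrow> norm (S t x) \<le> C * norm x"
    using locally_bounded by blast
  have Cadj: "norm (Sadj t z) \<le> C * norm z" if "t \<in> {0..T}" for t z
    using C that by (intro norm_Sadj_le) auto
  show ?thesis
    unfolding continuous_on_iff
  proof (intro ballI allI impI)
    fix t \<epsilon> assume t: "t \<in> {0..T}" and "(\<epsilon>::real) > 0"
    define \<eta> where "\<eta> = \<epsilon> / (4 * (C + 1))"
    have \<eta>: "\<eta> > 0" "C * \<eta> \<le> \<epsilon> / 4" using \<open>\<epsilon> > 0\<close> C(1) by (auto simp: \<eta>_def field_simps)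
    have "z \<in> closure (Domain Astar)" by (simp add: Domain_Astar_dense)
    then obtain z' where z': "z' \<in> Domain Astar" "dist z' z < \<eta>"
      using \<eta>(1) closure_approachable by blast
    then obtain w where w: "(z', w) \<in> Astar" by blast
    define L where "L = C * norm w"
    have L: "L \<ge> 0" using C(1) by (simp add: L_def)
    define d where "d = \<epsilon> / (4 * (L + 1))"
    have d: "d > 0" "L * d \<le> \<epsilon> / 4" using \<open>\<epsilon> > 0\<close> L by (auto simp: d_def field_simps)
    have "dist (Sadj s z) (Sadj t z) < \<epsilon>" if s: "s \<in> {0..T}" "dist s t < d" for s
    proof -
      have 1: "norm (Sadj r (z - z')) \<le> \<epsilon> / 4" if "r \<in> {0..T}" for r
      proof -
        have "norm (Sadj r (z - z')) \<le> C * norm (z - z')" by (rule Cadj[OF that])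
        also have "\<dots> \<le> C * \<eta>" using z'(2) C(1) by (intro mult_left_mono) (auto simp: dist_norm norm_minus_commute)
        finally show ?thesis using \<eta>(2) by simp
      qed
      have "norm (Sadj s z' - Sadj t z' - (s - t) *\<^sub>R 0) \<le> L * \<bar>s - t\<bar>"
      proof (rule Sadj_taylor[OF w t s(1) L])
        fix r assume "r \<in> closed_segment t s"
        then have "r \<in> {0..T}" using t s(1) by (auto simp: closed_segment_eq_real_ivl split: if_splits)
        then show "norm (Sadj r w - 0) \<le> L" using Cadj[of r w] by (simp add: L_def)
      qed
      also have "\<dots> \<le> L * d" using s(2) L by (intro mult_left_mono) (auto simp: dist_real_def)
      finally have 2: "norm (Sadj s z' - Sadj t z') \<le> \<epsilon> / 4" using d(2) by simp
      have "Sadj s z - Sadj t z = Sadj s (z - z') + (Sadj s z' - Sadj t z') - Sadj t (z - z')"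
        using s t by (simp add: Sadj_diff)
      also have "norm \<dots> \<le> norm (Sadj s (z - z')) + norm (Sadj s z' - Sadj t z') + norm (Sadj t (z - z'))"
        by (intro order_trans[OF norm_triangle_ineq4] add_right_mono norm_triangle_ineq)
      also have "\<dots> < \<epsilon>" using 1[OF s(1)] 1[OF t] 2 \<open>\<epsilon> > 0\<close> by linarith
      finally show ?thesis by (simp add: dist_norm)
    qed
    with d(1) show "\<exists>d>0. \<forall>s\<in>{0..T}. dist s t < d \<longrightarrow> dist (Sadj s z) (Sadj t z) < \<epsilon>" by blast
  qed
qed

text \<open>With the orbit of \<open>w\<close> now norm continuous, \<open>Sadj_taylor\<close>
  applies with \<open>v = Sadj t w\<close> and an arbitrarily small bound near
  \<open>t\<close>.\<close>

lemma Sadj_deriv: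
  assumes zw: "(z, w) \<in> Astar" and t: "t \<in> {0..T}"
  shows "((\<lambda>t. Sadj t z) has_vector_derivative Sadj t w) (at t within {0..T})"
  unfolding has_vector_derivative_def has_derivative_within_alt
proof (intro conjI allI impI)
  show "bounded_linear (\<lambda>h. h *\<^sub>R Sadj t w)" by (rule bounded_linear_scaleR_left)
  fix \<epsilon> :: real assume "\<epsilon> > 0"
  then obtain d where d: "d > 0" "\<And>s. s \<in> {0..T} \<Longrightarrow> dist s t < d \<Longrightarrow> dist (Sadj s w) (Sadj t w) < \<epsilon>"
    using continuous_on_Sadj[of T w] t unfolding continuous_on_iff by blast
  have "norm (Sadj s z - Sadj t z - (s - t) *\<^sub>R Sadj t w) \<le> \<epsilon> * norm (s - t)"
    if s: "s \<in> {0..T}" "norm (s - t) < d" for s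
    unfolding real_norm_def
  proof (rule Sadj_taylor[OF zw t s(1)])
    fix r assume "r \<in> closed_segment t s"
    then have "r \<in> {0..T}" "dist r t < d"
      using t s by (auto simp: closed_segment_eq_real_ivl dist_real_def split: if_splits)
    then show "norm (Sadj r w - Sadj t w) \<le> \<epsilon>" using d(2) by (auto simp: dist_norm intro: less_imp_le)
  qed (use \<open>\<epsilon> > 0\<close> in simp)
  with d(1) show "\<exists>d>0. \<forall>s\<in>{0..T}. norm (s - t) < d \<longrightarrow>
      norm (Sadj s z - Sadj t z - (s - t) *\<^sub>R Sadj t w) \<le> \<epsilon> * norm (s - t)" by blast
qed

lemma solves_adjoint_system_Sadj:
  assumes "(z, w) \<in> Astar"
  shows "solves_adjoint_system (generator S) T z (\<lambda>t. Sadj (T - t) z)"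
  unfolding solves_adjoint_system_def
proof (intro conjI ballI exI)
  fix t assume t: "t \<in> {0..T}"
  then show "(Sadj (T - t) z, Sadj (T - t) w) \<in> Astar" using Astar_Sadj[OF assms] by simp
  have "((\<lambda>s. T - s) has_vector_derivative - 1) (at t within {0..T})"
    by (auto intro!: derivative_eq_intros)
  moreover have "((\<lambda>t. Sadj t z) has_vector_derivative Sadj (T - t) w) (at (T - t) within (\<lambda>s. T - s) ` {0..T})"
    by (rule has_vector_derivative_within_subset[OF Sadj_deriv[OF assms, of "T - t" T]]) (use t in auto)
  ultimately have "(((\<lambda>t. Sadj t z) \<circ> (\<lambda>s. T - s)) has_vector_derivative - 1 *\<^sub>R Sadj (T - t) w) (at t within {0..T})"
    by (rule vector_diff_chain_within)
  then show "((\<lambda>t. Sadj (T - t) z) has_vector_derivative - Sadj (T - t) w) (at t within {0..T})"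
    by (simp add: o_def)
qed (simp add: Sadj_0)

text \<open>For \<open>x\<close> in the domain of the generator, the pairing of
  \<open>S (t - s) x\<close> with \<open>Z t\<close> has derivative zero on \<open>[s, T]\<close>.
  Its value at \<open>s\<close> is \<open>x \<bullet> Z s\<close> and its value at \<open>T\<close>
  is \<open>x \<bullet> Sadj (T - s) z\<close>.\<close>

lemma solves_adjoint_system_unique:
  assumes Z: "solves_adjoint_system (generator S) T z Z" and s: "s \<in> {0..T}"
  shows "Z s = Sadj (T - s) z"
proof (rule eq_by_generator_domain)
  fix x y assume xy: "(x, y) \<in> generator S"
  obtain w where w: "\<And>t. t \<in> {0..T} \<Longrightarrow> (Z t, w t) \<in> Astar"
    "\<And>t. t \<in> {0..T} \<Longrightarrow> (Z has_vector_derivative - w t) (at t within {0..T})"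
    using Z unfolding solves_adjoint_system_def by metis
  let ?g = "\<lambda>t. S (t - s) x \<bullet> Z t"
  have "(?g has_vector_derivative 0) (at t within {s..T})" if t: "t \<in> {s..T}" for t
  proof -
    have "((\<lambda>t. t - s) has_vector_derivative 1) (at t within {s..T})"
      by (auto intro!: derivative_eq_intros)
    moreover have "((\<lambda>t. S t x) has_vector_derivative S (t - s) y) (at (t - s) within (\<lambda>t. t - s) ` {s..T})"
      by (rule has_vector_derivative_within_subset[OF orbit_deriv[OF xy, of "t - s" T]]) (use t s in auto)
    ultimately have "(((\<lambda>t. S t x) \<circ> (\<lambda>t. t - s)) has_vector_derivative 1 *\<^sub>R S (t - s) y) (at t within {s..T})"
      by (rule vector_diff_chain_within)
    then have 1: "((\<lambda>t. S (t - s) x) has_vector_derivative S (t - s) y) (at t within {s..T})"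
      by (simp add: o_def)
    have 2: "(Z has_vector_derivative - w t) (at t within {s..T})"
      using w(2)[of t] t s by (auto intro: has_vector_derivative_within_subset)
    have "(?g has_vector_derivative S (t - s) x \<bullet> (- w t) + S (t - s) y \<bullet> Z t) (at t within {s..T})"
      by (rule bounded_bilinear.has_vector_derivative[OF bounded_bilinear_inner 1 2])
    moreover have "S (t - s) y \<bullet> Z t = S (t - s) x \<bullet> w t"
      using AstarD[OF w(1) generator_S[OF xy]] t s by simp
    ultimately show ?thesis by simp
  qed
  then obtain c where c: "\<And>t. t \<in> {s..T} \<Longrightarrow> ?g t = c"
    using has_vector_derivative_zero_constant[of "{s..T}" ?g] by auto
  have "?g T = ?g s" using c[of T] c[of s] s by simp
  then show "x \<bullet> Z s = x \<bullet> Sadj (T - s) z"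
    using Z s by (simp add: S_zero Sadj solves_adjoint_system_def)
qed

end

section \<open>Finite Gaussian sums and their shifts\<close>

lemma power2_norm_add_le: "(norm (x + y))\<^sup>2 \<le> 2 * (norm x)\<^sup>2 + 2 * (norm y)\<^sup>2"
  for x y :: "'a::real_normed_vector"
proof -
  have "(norm (x + y))\<^sup>2 \<le> (norm x + norm y)\<^sup>2" by (intro power_mono norm_triangle_ineq norm_ge_zero)
  also have "\<dots> \<le> 2 * (norm x)\<^sup>2 + 2 * (norm y)\<^sup>2"
    using sum_squares_bound[of "norm x" "norm y"] by (simp add: power2_sum)
  finally show ?thesis .
qed

lemma ennreal_power2_norm_add_le:
  "ennreal ((norm (x + y))\<^sup>2) \<le> 2 * ennreal ((norm x)\<^sup>2) + 2 * ennreal ((norm y)\<^sup>2)"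
  for x y :: "'a::real_normed_vector"
proof -
  have "ennreal ((norm (x + y))\<^sup>2) \<le> ennreal (2 * (norm x)\<^sup>2 + 2 * (norm y)\<^sup>2)"
    by (intro ennreal_leI power2_norm_add_le)
  then show ?thesis by (simp add: ennreal_mult)
qed

text \<open>Working in \<open>ennreal\<close> lets this be integrated before any second moment is
  known to be finite.\<close>

lemma ennreal_power2_inner_le:
  "ennreal ((x \<bullet> z)\<^sup>2) \<le> 2 * ennreal ((y \<bullet> z)\<^sup>2) + ennreal (2 * (norm z)\<^sup>2) * ennreal ((norm (x - y))\<^sup>2)"
proof -
  have "ennreal ((norm (y \<bullet> z + (x - y) \<bullet> z))\<^sup>2) \<le>
      2 * ennreal ((norm (y \<bullet> z))\<^sup>2) + 2 * ennreal ((norm ((x - y) \<bullet> z))\<^sup>2)"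
    by (rule ennreal_power2_norm_add_le)
  also have "\<dots> \<le> 2 * ennreal ((y \<bullet> z)\<^sup>2) + 2 * ennreal ((norm z)\<^sup>2 * (norm (x - y))\<^sup>2)"
  proof -
    have "((x - y) \<bullet> z)\<^sup>2 \<le> (norm (x - y) * norm z)\<^sup>2"
      using Cauchy_Schwarz_ineq2 by (metis abs_ge_zero power2_abs power_mono)
    then show ?thesis by (intro add_mono mult_left_mono ennreal_leI) (auto simp: power_mult_distrib mult.commute)
  qed
  also have "2 * ennreal ((norm z)\<^sup>2 * (norm (x - y))\<^sup>2) = ennreal (2 * (norm z)\<^sup>2) * ennreal ((norm (x - y))\<^sup>2)"
    by (simp add: ennreal_mult mult.assoc)
  finally show ?thesis by (simp add: inner_diff_left)
qed

text \<open>The measure is left general: it is the probability measure for Gaussian sums and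
  Brownian increments, and Lebesgue measure for step functions with indicator coefficients. The two
  sides of the isometry thus become the same double sum.\<close>

lemma second_moment_sum:
  fixes v :: "'j \<Rightarrow> 'h::{real_inner,banach,second_countable_topology}" and \<xi> :: "'j \<Rightarrow> 'w \<Rightarrow> real"
  assumes int: "\<And>i j. i \<in> J \<Longrightarrow> j \<in> J \<Longrightarrow> integrable M (\<lambda>\<omega>. \<xi> i \<omega> * \<xi> j \<omega>)"
  shows "(\<integral>\<^sup>+\<omega>. ennreal ((norm (\<Sum>j\<in>J. \<xi> j \<omega> *\<^sub>R v j))\<^sup>2) \<partial>M)
    = ennreal (\<Sum>i\<in>J. \<Sum>j\<in>J. (\<integral>\<omega>. \<xi> i \<omega> * \<xi> j \<omega> \<partial>M) * (v i \<bullet> v j))"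
proof -
  have eq: "(norm (\<Sum>j\<in>J. \<xi> j \<omega> *\<^sub>R v j))\<^sup>2 = (\<Sum>i\<in>J. \<Sum>j\<in>J. (\<xi> i \<omega> * \<xi> j \<omega>) * (v i \<bullet> v j))" for \<omega>
    unfolding power2_norm_eq_inner inner_sum_left
    by (simp add: inner_sum_right sum_distrib_left ac_simps)
  have "integrable M (\<lambda>\<omega>. \<Sum>i\<in>J. \<Sum>j\<in>J. (\<xi> i \<omega> * \<xi> j \<omega>) * (v i \<bullet> v j))"
    using int by (intro Bochner_Integration.integrable_sum integrable_mult_left) auto
  moreover have "0 \<le> (\<Sum>i\<in>J. \<Sum>j\<in>J. (\<xi> i \<omega> * \<xi> j \<omega>) * (v i \<bullet> v j))" for \<omega>
    by (simp flip: eq)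
  ultimately show ?thesis
    unfolding eq using int
    by (subst nn_integral_eq_integral) (simp_all add: Bochner_Integration.integral_sum integrable_mult_left)
qed

abbreviation std_normal :: "real measure" where
  "std_normal \<equiv> density lborel (\<lambda>x. ennreal (std_normal_density x))"

lemma prob_space_std_normal: "prob_space std_normal"
  by (rule prob_space_normal_density) simp

text \<open>Cauchy--Schwarz against the density \<open>exp (a x - a\<^sup>2 / 2)\<close> of the shifted law.\<close>

lemma std_normal_shift:
  fixes F :: "real \<Rightarrow> ennreal"
  assumes [measurable]: "F \<in> borel_measurable borel"
  shows "(\<integral>\<^sup>+x. F (x + a) \<partial>std_normal)\<^sup>2 \<le> ennreal (exp (a\<^sup>2)) * (\<integral>\<^sup>+x. (F x)\<^sup>2 \<partial>std_normal)"
proof -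
  define \<rho> where "\<rho> b x = ennreal (exp (b * x - b\<^sup>2 / 2))" for b x :: real
  have [measurable]: "\<rho> b \<in> borel_measurable borel" for b unfolding \<rho>_def by measurable
  have shift: "(\<integral>\<^sup>+x. G (x + b) \<partial>std_normal) = (\<integral>\<^sup>+x. G x * \<rho> b x \<partial>std_normal)"
    if [measurable]: "G \<in> borel_measurable borel" for G b
  proof -
    have dens: "ennreal (std_normal_density (x - b)) = ennreal (std_normal_density x) * \<rho> b x" for x
    proof -
      have "- (x - b)\<^sup>2 / 2 = - x\<^sup>2 / 2 + (b * x - b\<^sup>2 / 2)"
        by (simp add: power2_eq_square field_simps)
      then have "std_normal_density (x - b) = std_normal_density x * exp (b * x - b\<^sup>2 / 2)"
        by (simp add: std_normal_density_def mult.assoc flip: exp_add)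
      then show ?thesis by (simp add: \<rho>_def ennreal_mult)
    qed
    have "(\<integral>\<^sup>+x. G (x + b) \<partial>std_normal) = (\<integral>\<^sup>+x. ennreal (std_normal_density x) * G (x + b) \<partial>lborel)"
      by (simp add: nn_integral_density)
    also have "\<dots> = (\<integral>\<^sup>+x. ennreal (std_normal_density (x - b)) * G x \<partial>lborel)"
      by (subst nn_integral_real_affine[of _ 1 "- b"]) (simp_all)
    also have "\<dots> = (\<integral>\<^sup>+x. G x * \<rho> b x \<partial>std_normal)"
      unfolding dens by (simp add: nn_integral_density ac_simps)
    finally show ?thesis .
  qed
  have "(\<integral>\<^sup>+x. F (x + a) \<partial>std_normal)\<^sup>2 \<le>
      (\<integral>\<^sup>+x. (F x)\<^sup>2 \<partial>std_normal) * (\<integral>\<^sup>+x. (\<rho> a x)\<^sup>2 \<partial>std_normal)"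
    unfolding shift[OF assms] by (rule Cauchy_Schwarz_nn_integral) auto
  \<comment> \<open>Completing the square turns the squared density into \<open>exp (a^2)\<close>
    times the density for the shift by \<open>2 * a\<close>, which integrates to 1.\<close>
  also have "(\<integral>\<^sup>+x. (\<rho> a x)\<^sup>2 \<partial>std_normal) = (\<integral>\<^sup>+x. ennreal (exp (a\<^sup>2)) * \<rho> (2 * a) x \<partial>std_normal)"
    by (intro nn_integral_cong)
       (simp add: \<rho>_def ennreal_power power2_eq_square algebra_simps flip: ennreal_mult exp_add)
  also have "\<dots> = ennreal (exp (a\<^sup>2)) * (\<integral>\<^sup>+x. 1 * \<rho> (2 * a) x \<partial>std_normal)"
    by (simp add: nn_integral_cmult)
  also have "\<dots> = ennreal (exp (a\<^sup>2))"
    using prob_space.emeasure_space_1[OF prob_space_std_normal]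
    by (subst shift[symmetric]) simp_all
  finally show ?thesis by (simp add: mult.commute)
qed

text \<open>The one-dimensional inequality tensorises: Fubini splits off one coordinate, and the
  exponents add up. The number of coordinates does not enter the constant.\<close>

lemma std_normal_PiM_shift:
  fixes F :: "('j \<Rightarrow> real) \<Rightarrow> ennreal"
  assumes "finite J" "F \<in> borel_measurable (\<Pi>\<^sub>M j\<in>J. std_normal)"
  shows "(\<integral>\<^sup>+x. F (\<lambda>j\<in>J. x j + a j) \<partial>(\<Pi>\<^sub>M j\<in>J. std_normal))\<^sup>2
    \<le> ennreal (exp (\<Sum>j\<in>J. (a j)\<^sup>2)) * (\<integral>\<^sup>+x. (F x)\<^sup>2 \<partial>(\<Pi>\<^sub>M j\<in>J. std_normal))"
  using assms
proof (induction J arbitrary: F rule: finite_induct)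
  case empty
  then show ?case by (simp add: PiM_empty nn_integral_count_space_finite)
next
  case (insert i J)
  interpret prob_space std_normal by (rule prob_space_std_normal)
  interpret product_sigma_finite "\<lambda>_::'j. std_normal" by standard
  let ?P = "\<Pi>\<^sub>M j\<in>J. std_normal"
  interpret P: prob_space ?P by (rule prob_space_PiM) (rule prob_space_std_normal)
  note [measurable] = insert.prems
  have [measurable]: "(\<lambda>x. \<lambda>j\<in>I. x j + a j) \<in> measurable (\<Pi>\<^sub>M j\<in>I. std_normal) (\<Pi>\<^sub>M j\<in>I. std_normal)" for I :: "'j set"
    by (rule measurable_restrict) measurable
  \<comment> \<open>The coordinates in \<open>J\<close> are integrated with their shift already
    applied, so \<open>std_normal_shift\<close> acts on the new coordinate alone; the induction
    hypothesis then bounds the square of \<open>H\<close>.\<close>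
  define H where "H y = (\<integral>\<^sup>+x. F ((\<lambda>j\<in>J. x j + a j)(i := y)) \<partial>?P)" for y
  have [measurable]: "H \<in> borel_measurable borel"
    unfolding H_def by measurable
  have eq: "(\<lambda>j\<in>insert i J. (x(i := y)) j + a j) = (\<lambda>j\<in>J. x j + a j)(i := y + a i)" for x y
    using insert.hyps by (auto simp: fun_eq_iff)
  have "(\<integral>\<^sup>+x. F (\<lambda>j\<in>insert i J. x j + a j) \<partial>(\<Pi>\<^sub>M j\<in>insert i J. std_normal))
      = (\<integral>\<^sup>+y. H (y + a i) \<partial>std_normal)"
    using insert.hyps by (subst product_nn_integral_insert_rev) (simp_all only: eq H_def, measurable)
  also have "\<dots>\<^sup>2 \<le> ennreal (exp ((a i)\<^sup>2)) * (\<integral>\<^sup>+y. (H y)\<^sup>2 \<partial>std_normal)"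
    by (rule std_normal_shift) measurable
  also have "\<dots> \<le> ennreal (exp ((a i)\<^sup>2)) *
      (\<integral>\<^sup>+y. ennreal (exp (\<Sum>j\<in>J. (a j)\<^sup>2)) * (\<integral>\<^sup>+x. (F (x(i := y)))\<^sup>2 \<partial>?P) \<partial>std_normal)"
  proof (unfold H_def, intro mult_left_mono nn_integral_mono insert.IH)
    fix y :: real
    have "(\<lambda>x. x(i := y)) \<in> measurable ?P (\<Pi>\<^sub>M j\<in>insert i J. std_normal)"
      by (rule measurable_fun_upd[where J = J]) auto
    from measurable_compose[OF this insert.prems]
    show "(\<lambda>x. F (x(i := y))) \<in> borel_measurable ?P" .
  qed auto
  also have "\<dots> = ennreal (exp (\<Sum>j\<in>insert i J. (a j)\<^sup>2)) *
      (\<integral>\<^sup>+y. (\<integral>\<^sup>+x. (F (x(i := y)))\<^sup>2 \<partial>?P) \<partial>std_normal)"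
    using insert.hyps by (subst nn_integral_cmult) (auto simp: exp_add ennreal_mult mult.assoc)
  also have "(\<integral>\<^sup>+y. (\<integral>\<^sup>+x. (F (x(i := y)))\<^sup>2 \<partial>?P) \<partial>std_normal)
      = (\<integral>\<^sup>+x. (F x)\<^sup>2 \<partial>(\<Pi>\<^sub>M j\<in>insert i J. std_normal))"
    using insert.hyps by (subst product_nn_integral_insert_rev) auto
  finally show ?case .
qed

definition std_normal_family :: "'w measure \<Rightarrow> 'j set \<Rightarrow> ('j \<Rightarrow> 'w \<Rightarrow> real) \<Rightarrow> bool" where
  "std_normal_family M J \<xi> \<longleftrightarrow> finite J \<and> prob_space.indep_vars M (\<lambda>_. borel) \<xi> J \<and>
     (\<forall>j\<in>J. distributed M lborel (\<xi> j) std_normal_density)"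

lemma std_normal_family_measurable:
  assumes "std_normal_family M J \<xi>" "j \<in> J"
  shows "\<xi> j \<in> borel_measurable M"
  using assms distributed_measurable[of M lborel "\<xi> j"] by (auto simp: std_normal_family_def)

text \<open>Independence identifies the joint law of the \<open>\<xi> j\<close> with the product of
  standard normal laws. The vectors \<open>v j\<close> are absorbed into the test function, so the
  constant depends on the coefficients \<open>a j\<close> only.\<close>

lemma gaussian_sum_shift:
  fixes f :: "'h::{real_inner,banach,second_countable_topology} \<Rightarrow> ennreal"
  assumes M: "prob_space M" and \<xi>: "std_normal_family M J \<xi>" and [measurable]: "f \<in> borel_measurable borel"
  shows "(\<integral>\<^sup>+\<omega>. f (\<Sum>j\<in>J. (\<xi> j \<omega> + a j) *\<^sub>R v j) \<partial>M)\<^sup>2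
    \<le> ennreal (exp (\<Sum>j\<in>J. (a j)\<^sup>2)) * (\<integral>\<^sup>+\<omega>. (f (\<Sum>j\<in>J. \<xi> j \<omega> *\<^sub>R v j))\<^sup>2 \<partial>M)"
proof (cases "J = {}")
  case True
  then show ?thesis using prob_space.emeasure_space_1[OF M] by simp
next
  case False
  interpret prob_space M by fact
  have J: "finite J" and ind: "indep_vars (\<lambda>_. borel) \<xi> J"
    and dist: "\<And>j. j \<in> J \<Longrightarrow> distributed M lborel (\<xi> j) std_normal_density"
    using \<xi> by (auto simp: std_normal_family_def)
  note [measurable] = std_normal_family_measurable[OF \<xi>]
  have dN: "distr M borel (\<xi> j) = std_normal" if "j \<in> J" for j
    using distributed_distr_eq_density[OF dist[OF that]]
    by (simp cong: distr_cong)
  have P: "distr M (\<Pi>\<^sub>M j\<in>J. borel) (\<lambda>\<omega>. \<lambda>j\<in>J. \<xi> j \<omega>) = (\<Pi>\<^sub>M j\<in>J. std_normal)"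
    using indep_vars_iff_distr_eq_PiM'[OF False, where M' = "\<lambda>_. borel" and X = \<xi>] ind dN
    by (simp cong: PiM_cong)
  define F where "F x = f (\<Sum>j\<in>J. x j *\<^sub>R v j)" for x
  have F [measurable]: "F \<in> borel_measurable (\<Pi>\<^sub>M j\<in>J. borel)" unfolding F_def by measurable
  have sets_P: "sets (\<Pi>\<^sub>M j\<in>J. std_normal) = sets (\<Pi>\<^sub>M j\<in>J. borel)" by (rule sets_PiM_cong) auto
  have [measurable]: "(\<lambda>\<omega>. \<lambda>j\<in>J. \<xi> j \<omega>) \<in> measurable M (\<Pi>\<^sub>M j\<in>J. borel)"
    by (rule measurable_restrict) measurable
  have [measurable]: "(\<lambda>x. \<lambda>j\<in>J. x j + a j) \<in> measurable (\<Pi>\<^sub>M j\<in>J. borel) (\<Pi>\<^sub>M j\<in>J. borel)"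
    by (rule measurable_restrict) measurable
  have "(\<integral>\<^sup>+x. F (\<lambda>j\<in>J. x j + a j) \<partial>(\<Pi>\<^sub>M j\<in>J. std_normal))\<^sup>2
    \<le> ennreal (exp (\<Sum>j\<in>J. (a j)\<^sup>2)) * (\<integral>\<^sup>+x. (F x)\<^sup>2 \<partial>(\<Pi>\<^sub>M j\<in>J. std_normal))"
    by (rule std_normal_PiM_shift[OF J]) (simp add: measurable_cong_sets[OF sets_P refl])
  then show ?thesis
    unfolding P[symmetric]
    by (subst (asm) (1 2) nn_integral_distr) (simp_all add: F_def)
qed

lemma gaussian_sum_second_moment:
  fixes v :: "'j \<Rightarrow> 'h::{real_inner,banach,second_countable_topology}"
  assumes M: "prob_space M" and \<xi>: "std_normal_family M J \<xi>"
  shows "(\<integral>\<^sup>+\<omega>. ennreal ((norm (\<Sum>j\<in>J. \<xi> j \<omega> *\<^sub>R v j))\<^sup>2) \<partial>M) = ennreal (\<Sum>j\<in>J. (norm (v j))\<^sup>2)"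
proof -
  interpret prob_space M by fact
  have J: "finite J" and ind: "indep_vars (\<lambda>_. borel) \<xi> J"
    and dist: "\<And>j. j \<in> J \<Longrightarrow> distributed M lborel (\<xi> j) std_normal_density"
    using \<xi> by (auto simp: std_normal_family_def)
  have mom: "integrable M (\<lambda>\<omega>. \<xi> j \<omega> ^ k)" "(\<integral>\<omega>. \<xi> j \<omega> ^ k \<partial>M) = (\<integral>x. std_normal_density x * x ^ k \<partial>lborel)"
    if "j \<in> J" for j k
    using distributed_integrable[OF dist[OF that], of "\<lambda>x. x ^ k"]
      distributed_integral[OF dist[OF that], of "\<lambda>x. x ^ k"] integrable_std_normal_moment[of k]
    by simp_all
  have mom1: "integrable M (\<xi> j)" "(\<integral>\<omega>. \<xi> j \<omega> \<partial>M) = 0" if "j \<in> J" for j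
    using mom[OF that, of 1] integral_std_normal_moment_odd[of 0] by simp_all
  have mom2: "integrable M (\<lambda>\<omega>. \<xi> j \<omega> * \<xi> j \<omega>)" "(\<integral>\<omega>. \<xi> j \<omega> * \<xi> j \<omega> \<partial>M) = 1" if "j \<in> J" for j
    using mom[OF that, of 2] integral_std_normal_moment_even[of 1] by (simp_all add: power2_eq_square)
  have cross: "integrable M (\<lambda>\<omega>. \<xi> i \<omega> * \<xi> j \<omega>) \<and> (\<integral>\<omega>. \<xi> i \<omega> * \<xi> j \<omega> \<partial>M) = 0"
    if "i \<in> J" "j \<in> J" "i \<noteq> j" for i j
  proof -
    have "indep_vars (\<lambda>_. borel) \<xi> {i, j}"
      using indep_vars_subset[OF ind] that by auto
    from indep_vars_integrable[OF _ this] indep_vars_lebesgue_integral[OF _ this] that mom1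
    show ?thesis by auto
  qed
  have int: "integrable M (\<lambda>\<omega>. \<xi> i \<omega> * \<xi> j \<omega>)" if "i \<in> J" "j \<in> J" for i j
    using cross mom2(1) that by (cases "i = j") auto
  have "(\<integral>\<omega>. \<xi> i \<omega> * \<xi> j \<omega> \<partial>M) = (if i = j then 1 else 0)" if "i \<in> J" "j \<in> J" for i j
    using cross mom2(2) that by (cases "i = j") auto
  then show ?thesis
    using J by (subst second_moment_sum[OF int])
      (auto simp: power2_norm_eq_inner if_distrib[of "\<lambda>x. x * _"] sum.delta cong: if_cong intro!: arg_cong[of _ _ ennreal] sum.cong)
qed

text \<open>Tikhonov regularisation: \<open>h\<close> is approximated by \<open>(\<Sum>j\<in>J. (v j \<bullet> z) *\<^sub>R v j)\<close>, where \<open>z\<close>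
  solves \<open>(\<Sum>j\<in>J. (v j \<bullet> z) *\<^sub>R v j) + \<delta> *\<^sub>R z = h\<close>.\<close>

lemma regularised_preimage:
  fixes v :: "'j \<Rightarrow> 'h::{real_inner,banach}"
  assumes J: "finite J" and "\<delta> > 0" "c \<ge> 0"
    and le: "\<And>z. (h \<bullet> z)\<^sup>2 \<le> c * ((\<Sum>j\<in>J. (v j \<bullet> z)\<^sup>2) + \<delta> * (norm z)\<^sup>2)"
  obtains a where "(\<Sum>j\<in>J. (a j)\<^sup>2) \<le> c" "(norm (h - (\<Sum>j\<in>J. a j *\<^sub>R v j)))\<^sup>2 \<le> \<delta> * c"
proof -
  \<comment> \<open>This is the covariance form of the Gaussian sum, made coercive by the multiple
    \<open>\<delta>\<close> of the inner product.\<close>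
  define b where "b x y = (\<Sum>j\<in>J. (v j \<bullet> x) * (v j \<bullet> y)) + \<delta> * (x \<bullet> y)" for x y
  have 1: "bounded_bilinear b"
  proof
    show "\<exists>K. \<forall>x y. norm (b x y) \<le> norm x * norm y * K"
    proof (intro exI allI)
      fix x y
      have "\<bar>b x y\<bar> \<le> (\<Sum>j\<in>J. \<bar>v j \<bullet> x\<bar> * \<bar>v j \<bullet> y\<bar>) + \<delta> * \<bar>x \<bullet> y\<bar>"
        unfolding b_def using \<open>\<delta> > 0\<close>
        by (intro order_trans[OF abs_triangle_ineq] add_mono order_trans[OF sum_abs]) (auto simp: abs_mult)
      also have "\<dots> \<le> (\<Sum>j\<in>J. (norm (v j) * norm x) * (norm (v j) * norm y)) + \<delta> * (norm x * norm y)"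
        using \<open>\<delta> > 0\<close> by (intro add_mono sum_mono mult_mono mult_left_mono Cauchy_Schwarz_ineq2) auto
      also have "\<dots> = norm x * norm y * ((\<Sum>j\<in>J. (norm (v j))\<^sup>2) + \<delta>)"
        by (simp add: sum_distrib_left power2_eq_square algebra_simps)
      finally show "norm (b x y) \<le> norm x * norm y * ((\<Sum>j\<in>J. (norm (v j))\<^sup>2) + \<delta>)" by simp
    qed
  qed (simp_all add: b_def inner_add_left inner_add_right sum.distrib algebra_simps sum_distrib_left)
  have 2: "b x y = b y x" for x y by (simp add: b_def inner_commute mult.commute)
  have 3: "\<delta> * (norm x)\<^sup>2 \<le> b x x" for x
    by (simp add: b_def power2_norm_eq_inner sum_nonneg)
  obtain z where z: "\<And>y. b z y = h \<bullet> y"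
    by (rule symmetric_lax_milgram[of b \<delta> "inner h" UNIV])
       (use 1 2 3 \<open>\<delta> > 0\<close> bounded_linear_inner_right in auto)
  let ?a = "\<lambda>j. v j \<bullet> z"
  have eq: "h - (\<Sum>j\<in>J. ?a j *\<^sub>R v j) = \<delta> *\<^sub>R z"
  proof -
    have "(h - (\<Sum>j\<in>J. ?a j *\<^sub>R v j) - \<delta> *\<^sub>R z) \<bullet> y = 0" for y
      using z[of y] by (simp add: b_def inner_diff_left inner_sum_left)
    from this[of "h - (\<Sum>j\<in>J. ?a j *\<^sub>R v j) - \<delta> *\<^sub>R z"] show ?thesis by simp
  qed
  \<comment> \<open>Testing the equation with its own solution expresses
    \<open>h \<bullet> z\<close> as the sum of both quantities to be bounded. The hypothesis at
    \<open>z\<close> then reads \<open>(h \<bullet> z)^2 \<le> c * (h \<bullet> z)\<close>, so both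
    are at most \<open>c\<close>.\<close>
  have bz: "h \<bullet> z = (\<Sum>j\<in>J. (?a j)\<^sup>2) + \<delta> * (norm z)\<^sup>2"
    using z[of z] by (simp add: b_def power2_eq_square dot_square_norm)
  have nonneg: "0 \<le> (\<Sum>j\<in>J. (?a j)\<^sup>2)" "0 \<le> \<delta> * (norm z)\<^sup>2"
    using \<open>\<delta> > 0\<close> by (auto intro: sum_nonneg)
  have "h \<bullet> z \<le> c"
  proof (cases "h \<bullet> z = 0")
    case False
    have "(h \<bullet> z) * (h \<bullet> z) \<le> c * (h \<bullet> z)" using le[of z] bz by (simp add: power2_eq_square)
    moreover have "h \<bullet> z > 0" using False bz nonneg by linarith
    ultimately show ?thesis by simp
  next
    case True
    with \<open>c \<ge> 0\<close> show ?thesis by simp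
  qed
  with bz nonneg have "(\<Sum>j\<in>J. (?a j)\<^sup>2) \<le> c" "\<delta> * (norm z)\<^sup>2 \<le> c" by auto
  moreover have "(norm (\<delta> *\<^sub>R z))\<^sup>2 = \<delta> * (\<delta> * (norm z)\<^sup>2)"
    using \<open>\<delta> > 0\<close> by (simp add: power_mult_distrib power2_eq_square)
  ultimately show thesis
    using that[of ?a] eq \<open>\<delta> > 0\<close> by simp
qed

section \<open>Mean-square limits of Gaussian sums\<close>

text \<open>The expectations are summable, so the series of the \<open>g n\<close> is almost surely
  finite and its terms tend to zero.\<close>

lemma AE_tendsto_0_geometric:
  fixes g :: "nat \<Rightarrow> 'w \<Rightarrow> real"
  assumes [measurable]: "\<And>n. g n \<in> borel_measurable M" and nonneg: "\<And>n \<omega>. 0 \<le> g n \<omega>"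
    and le: "\<And>n. (\<integral>\<^sup>+\<omega>. ennreal (g n \<omega>) \<partial>M) \<le> ennreal (c * (1/2) ^ n)"
  shows "AE \<omega> in M. (\<lambda>n. g n \<omega>) \<longlonglongrightarrow> 0"
proof -
  have "(\<Sum>n. ennreal (c * (1/2) ^ n)) \<noteq> \<top>"
  proof -
    have "(\<Sum>n. ennreal (c * (1/2) ^ n)) \<le> (\<Sum>n. ennreal (\<bar>c\<bar> * (1/2) ^ n))"
      by (intro suminf_le ennreal_leI mult_right_mono) auto
    also have "\<dots> = ennreal (\<Sum>n. \<bar>c\<bar> * (1/2) ^ n)"
      by (intro suminf_ennreal2 summable_mult summable_geometric) auto
    finally show ?thesis by (auto simp: top_unique)
  qed
  moreover have "(\<Sum>n. \<integral>\<^sup>+\<omega>. ennreal (g n \<omega>) \<partial>M) \<le> (\<Sum>n. ennreal (c * (1/2) ^ n))"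
    by (intro suminf_le le) auto
  ultimately have "(\<Sum>n. \<integral>\<^sup>+\<omega>. ennreal (g n \<omega>) \<partial>M) \<noteq> \<top>" by (auto simp: top_unique)
  then have "(\<integral>\<^sup>+\<omega>. (\<Sum>n. ennreal (g n \<omega>)) \<partial>M) \<noteq> \<infinity>"
    by (subst nn_integral_suminf) auto
  then have "AE \<omega> in M. (\<Sum>n. ennreal (g n \<omega>)) \<noteq> \<infinity>"
    by (intro nn_integral_PInf_AE) auto
  then show ?thesis
  proof eventually_elim
    case (elim \<omega>)
    then have "summable (\<lambda>n. g n \<omega>)" using nonneg by (intro summable_suminf_not_top) auto
    then show ?case by (rule summable_LIMSEQ_zero)
  qed
qed

text \<open>Inequalities for continuous functions are what almost sure convergence of random
  variables preserves. They extend to closed sets by continuous approximation of indicators, and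
  inner regularity by compact sets, available on a complete separable space, brings them to null
  sets.\<close>

lemma absolutely_continuous_by_continuous_functions:
  fixes \<mu> \<nu> :: "'a::{second_countable_topology, complete_space} measure"
  assumes \<mu>: "finite_measure \<mu>" "sets \<mu> = sets borel" and \<nu>: "finite_measure \<nu>" "sets \<nu> = sets borel"
    and le: "\<And>f :: 'a \<Rightarrow> real. continuous_on UNIV f \<Longrightarrow> (\<And>x. 0 \<le> f x) \<Longrightarrow> (\<And>x. f x \<le> 1) \<Longrightarrow>
      (\<integral>x. f x \<partial>\<nu>)\<^sup>2 \<le> k * (\<integral>x. f x \<partial>\<mu>)"
  shows "absolutely_continuous \<mu> \<nu>"
proof -
  have space: "space \<mu> = UNIV" "space \<nu> = UNIV"
    using \<mu> \<nu> sets_eq_imp_space_eq[of \<mu> borel] sets_eq_imp_space_eq[of \<nu> borel] by auto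
  interpret \<mu>: finite_measure \<mu> by fact
  interpret \<nu>: finite_measure \<nu> by fact
  have closed: "(measure \<nu> C)\<^sup>2 \<le> k * measure \<mu> C" if C: "closed C" "C \<noteq> {}" for C
  proof -
    \<comment> \<open>These functions equal 1 on \<open>C\<close> and decrease pointwise to its
      indicator; off \<open>C\<close> they eventually vanish because \<open>C\<close> is
      closed.\<close>
    define f where "f n x = max 0 (1 - real n * infdist x C)" for n x
    have cont: "continuous_on UNIV (f n)" for n
      unfolding f_def by (intro continuous_intros)
    have f01: "0 \<le> f n x" "f n x \<le> 1" for n x by (auto simp: f_def infdist_nonneg)
    have lim: "(\<lambda>n. f n x) \<longlonglongrightarrow> indicator C x" for x
    proof (cases "x \<in> C")
      case False
      then have pos: "infdist x C > 0" using C infdist_pos_not_in_closed by blast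
      obtain N where N: "1 / infdist x C \<le> real N" using real_arch_simple by blast
      have "f n x = 0" if "n \<ge> N" for n
      proof -
        have "1 / infdist x C \<le> real n" using N that by linarith
        then have "1 \<le> real n * infdist x C" using pos by (simp add: field_simps)
        then show ?thesis by (simp add: f_def)
      qed
      then have "\<forall>\<^sub>F n in sequentially. f n x = 0" by (auto simp: eventually_sequentially)
      then show ?thesis using False by (simp add: tendsto_eventually)
    qed (simp add: f_def)
    have int: "(\<lambda>n. \<integral>x. f n x \<partial>\<rho>) \<longlonglongrightarrow> measure \<rho> C"
      if "finite_measure \<rho>" "sets \<rho> = sets borel" for \<rho>
    proof -
      interpret finite_measure \<rho> by fact
      note [measurable_cong] = that(2)
      have [measurable]: "f n \<in> borel_measurable borel" for n
        using cont by (rule borel_measurable_continuous_onI)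
      have [measurable]: "C \<in> sets borel" using C by auto
      have "(\<lambda>n. \<integral>x. f n x \<partial>\<rho>) \<longlonglongrightarrow> (\<integral>x. indicator C x \<partial>\<rho>)"
      proof (rule integral_dominated_convergence[where w = "\<lambda>_. 1"])
        show "AE x in \<rho>. norm (f n x) \<le> 1" for n using f01 by auto
      qed (use lim in \<open>auto intro: borel_measurable_indicator simp: C\<close>)
      then show ?thesis
        using sets_eq_imp_space_eq[OF that(2)] by simp
    qed
    show ?thesis
      by (rule LIMSEQ_le[OF tendsto_power[OF int[OF \<nu>]] tendsto_mult[OF tendsto_const int[OF \<mu>]]])
         (use le[OF cont f01] in blast)
  qed
  show ?thesis
    unfolding absolutely_continuous_def
  proof
    fix A assume A: "A \<in> null_sets \<mu>"
    then have AB: "A \<in> sets borel" using \<mu>(2) by auto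
    have "emeasure \<nu> C = 0" if "C \<subseteq> A" "compact C" for C
    proof (cases "C = {}")
      case False
      have "C \<in> null_sets \<mu>"
        using A that \<mu>(2) by (intro null_sets_subset[OF A]) (auto intro: borel_compact)
      then have "measure \<mu> C = 0" by (simp add: measure_def null_setsD1)
      then have "(measure \<nu> C)\<^sup>2 \<le> 0" using closed[of C] compact_imp_closed[OF that(2)] False by simp
      then show ?thesis by (simp add: \<nu>.emeasure_eq_measure)
    qed simp
    then have "emeasure \<nu> A = 0"
      using inner_regular[OF \<nu>(2) _ AB] by (auto intro!: SUP_eq_const)
    then show "A \<in> null_sets \<nu>" using AB \<nu>(2) by auto
  qed
qed

text \<open>Mean-square limits are taken at a geometric rate, so that they are almost sure limits as well.\<close>

lemma gaussian_limit_shift_absolutely_continuous: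
  fixes Y :: "'w \<Rightarrow> 'h::{real_inner,banach,second_countable_topology}"
  assumes M: "prob_space M" and Y [measurable]: "Y \<in> borel_measurable M"
    and \<xi>: "\<And>n. std_normal_family M (J n) (\<xi> n)"
    and lim: "\<And>n. (\<integral>\<^sup>+\<omega>. ennreal ((norm (Y \<omega> - (\<Sum>j\<in>J n. \<xi> n j \<omega> *\<^sub>R v n j)))\<^sup>2) \<partial>M) \<le> ennreal ((1/2) ^ n)"
    and c: "c \<ge> 0"
    and h: "\<And>z. ennreal ((h \<bullet> z)\<^sup>2) \<le> ennreal c * (\<integral>\<^sup>+\<omega>. ennreal ((Y \<omega> \<bullet> z)\<^sup>2) \<partial>M)"
  shows "absolutely_continuous (distr M borel (\<lambda>\<omega>. u + Y \<omega>)) (distr M borel (\<lambda>\<omega>. u + h + Y \<omega>))"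
proof -
  interpret prob_space M by fact
  define G where "G n \<omega> = (\<Sum>j\<in>J n. \<xi> n j \<omega> *\<^sub>R v n j)" for n \<omega>
  note [measurable] = std_normal_family_measurable[OF \<xi>]
  have G [measurable]: "G n \<in> borel_measurable M" for n unfolding G_def by measurable
  have "AE \<omega> in M. (\<lambda>n. (norm (Y \<omega> - G n \<omega>))\<^sup>2) \<longlonglongrightarrow> 0"
    by (rule AE_tendsto_0_geometric[where c = 1]) (use lim in \<open>simp_all add: G_def\<close>)
  then have G_lim: "AE \<omega> in M. (\<lambda>n. G n \<omega>) \<longlonglongrightarrow> Y \<omega>"
  proof eventually_elim
    case (elim \<omega>)
    then have "(\<lambda>n. sqrt ((norm (Y \<omega> - G n \<omega>))\<^sup>2)) \<longlonglongrightarrow> sqrt 0" by (intro tendsto_intros)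
    then have "(\<lambda>n. Y \<omega> - (Y \<omega> - G n \<omega>)) \<longlonglongrightarrow> Y \<omega> - 0"
      by (intro tendsto_diff tendsto_const) (simp add: tendsto_norm_zero_iff)
    then show ?case by simp
  qed
  \<comment> \<open>Replacing \<open>Y\<close> by \<open>G n\<close> in the hypothesis costs a
    factor 2 and an error of \<open>2 * (norm z)^2 * (1/2) ^ n\<close>. The error becomes the
    regularising term with \<open>\<delta> = (1/2) ^ n\<close>, and \<open>2 * c\<close> is the
    resulting constant.\<close>
  have "\<exists>a. (\<Sum>j\<in>J n. (a j)\<^sup>2) \<le> 2 * c \<and> (norm (h - (\<Sum>j\<in>J n. a j *\<^sub>R v n j)))\<^sup>2 \<le> (1/2) ^ n * (2 * c)" for n
  proof -
    have "(h \<bullet> z)\<^sup>2 \<le> (2 * c) * ((\<Sum>j\<in>J n. (v n j \<bullet> z)\<^sup>2) + (1/2) ^ n * (norm z)\<^sup>2)" for z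
    proof -
      have "(\<integral>\<^sup>+\<omega>. ennreal ((Y \<omega> \<bullet> z)\<^sup>2) \<partial>M) \<le>
          (\<integral>\<^sup>+\<omega>. 2 * ennreal ((G n \<omega> \<bullet> z)\<^sup>2) + ennreal (2 * (norm z)\<^sup>2) * ennreal ((norm (Y \<omega> - G n \<omega>))\<^sup>2) \<partial>M)"
        by (intro nn_integral_mono ennreal_power2_inner_le)
      also have "\<dots> = 2 * (\<integral>\<^sup>+\<omega>. ennreal ((G n \<omega> \<bullet> z)\<^sup>2) \<partial>M) +
          ennreal (2 * (norm z)\<^sup>2) * (\<integral>\<^sup>+\<omega>. ennreal ((norm (Y \<omega> - G n \<omega>))\<^sup>2) \<partial>M)"
        by (simp add: nn_integral_add nn_integral_cmult)
      also have "(\<integral>\<^sup>+\<omega>. ennreal ((G n \<omega> \<bullet> z)\<^sup>2) \<partial>M) = ennreal (\<Sum>j\<in>J n. (v n j \<bullet> z)\<^sup>2)"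
        using gaussian_sum_second_moment[OF M \<xi>, of n "\<lambda>j. v n j \<bullet> z"]
        by (simp add: G_def inner_sum_left)
      also have "ennreal (2 * (norm z)\<^sup>2) * (\<integral>\<^sup>+\<omega>. ennreal ((norm (Y \<omega> - G n \<omega>))\<^sup>2) \<partial>M)
          \<le> ennreal (2 * (norm z)\<^sup>2) * ennreal ((1/2) ^ n)"
        unfolding G_def by (intro mult_left_mono lim) simp
      finally have "(\<integral>\<^sup>+\<omega>. ennreal ((Y \<omega> \<bullet> z)\<^sup>2) \<partial>M) \<le>
          ennreal (2 * ((\<Sum>j\<in>J n. (v n j \<bullet> z)\<^sup>2) + (1/2) ^ n * (norm z)\<^sup>2))"
        by (simp add: sum_nonneg distrib_left ac_simps flip: ennreal_mult ennreal_plus ennreal_numeral)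
      then have "ennreal ((h \<bullet> z)\<^sup>2) \<le>
          ennreal c * ennreal (2 * ((\<Sum>j\<in>J n. (v n j \<bullet> z)\<^sup>2) + (1/2) ^ n * (norm z)\<^sup>2))"
        by (intro order_trans[OF h] mult_left_mono) auto
      also have "\<dots> = ennreal (c * (2 * ((\<Sum>j\<in>J n. (v n j \<bullet> z)\<^sup>2) + (1/2) ^ n * (norm z)\<^sup>2)))"
        using c by (intro ennreal_mult[symmetric]) (auto intro!: sum_nonneg add_nonneg_nonneg)
      finally have "(h \<bullet> z)\<^sup>2 \<le> c * (2 * ((\<Sum>j\<in>J n. (v n j \<bullet> z)\<^sup>2) + (1/2) ^ n * (norm z)\<^sup>2))"
        using c by (subst (asm) ennreal_le_iff) (auto intro!: sum_nonneg add_nonneg_nonneg mult_nonneg_nonneg)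
      then show ?thesis by (simp only: ac_simps)
    qed
    then obtain a where "(\<Sum>j\<in>J n. (a j)\<^sup>2) \<le> 2 * c"
      "(norm (h - (\<Sum>j\<in>J n. a j *\<^sub>R v n j)))\<^sup>2 \<le> (1/2) ^ n * (2 * c)"
      using regularised_preimage[of "J n" "(1/2) ^ n" "2 * c" h "v n"] \<xi>[of n] c
      by (auto simp: std_normal_family_def)
    then show ?thesis by blast
  qed
  then obtain a where a: "\<And>n. (\<Sum>j\<in>J n. (a n j)\<^sup>2) \<le> 2 * c"
    and h_a: "\<And>n. (norm (h - (\<Sum>j\<in>J n. a n j *\<^sub>R v n j)))\<^sup>2 \<le> (1/2) ^ n * (2 * c)" by metis
  define H where "H n = (\<Sum>j\<in>J n. a n j *\<^sub>R v n j)" for n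
  have H_lim: "H \<longlonglongrightarrow> h"
  proof -
    have "(\<lambda>n. (1/2 :: real) ^ n * (2 * c)) \<longlonglongrightarrow> 0"
      by (intro tendsto_mult_left_zero LIMSEQ_realpow_zero) auto
    then have "(\<lambda>n. (norm (h - H n))\<^sup>2) \<longlonglongrightarrow> 0"
      by (rule tendsto_sandwich[OF _ _ tendsto_const, rotated 2]) (use h_a in \<open>auto simp: H_def\<close>)
    then have "(\<lambda>n. sqrt ((norm (h - H n))\<^sup>2)) \<longlonglongrightarrow> sqrt 0" by (intro tendsto_intros)
    then have "(\<lambda>n. h - (h - H n)) \<longlonglongrightarrow> h - 0"
      by (intro tendsto_diff tendsto_const) (simp add: tendsto_norm_zero_iff)
    then show ?thesis by simp
  qed
  have key: "(\<integral>\<omega>. f (u + h + Y \<omega>) \<partial>M)\<^sup>2 \<le> exp (2 * c) * (\<integral>\<omega>. f (u + Y \<omega>) \<partial>M)"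
    if cont: "continuous_on UNIV f" and f01: "\<And>x. 0 \<le> f x" "\<And>x. f x \<le> 1" for f :: "'h \<Rightarrow> real"
  proof -
    have [measurable]: "f \<in> borel_measurable borel" by (rule borel_measurable_continuous_onI[OF cont])
    have bound: "integrable M (\<lambda>\<omega>. f (g \<omega>))" if [measurable]: "g \<in> borel_measurable M" for g
      by (rule integrable_const_bound[where B = 1]) (use f01 in auto)
    have conv: "(\<lambda>n. \<integral>\<omega>. f (g n \<omega>) \<partial>M) \<longlonglongrightarrow> (\<integral>\<omega>. f (g' \<omega>) \<partial>M)"
      if [measurable]: "\<And>n. g n \<in> borel_measurable M" "g' \<in> borel_measurable M"
        and "AE \<omega> in M. (\<lambda>n. g n \<omega>) \<longlonglongrightarrow> g' \<omega>" for g g'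
    proof (rule integral_dominated_convergence[where w = "\<lambda>_. 1"])
      show "AE \<omega> in M. (\<lambda>n. f (g n \<omega>)) \<longlonglongrightarrow> f (g' \<omega>)"
        using that(3)
      proof eventually_elim
        case (elim \<omega>)
        then show ?case
          using cont by (auto intro: continuous_on_tendsto_compose[of UNIV f])
      qed
    qed (use f01 in auto)
    have le: "(\<integral>\<omega>. f (u + (H n + G n \<omega>)) \<partial>M)\<^sup>2 \<le> exp (2 * c) * (\<integral>\<omega>. f (u + G n \<omega>) \<partial>M)" for n
    proof -
      have eq: "H n + G n \<omega> = (\<Sum>j\<in>J n. (\<xi> n j \<omega> + a n j) *\<^sub>R v n j)" for \<omega>
        by (simp add: H_def G_def scaleR_add_left sum.distrib)
      have "(ennreal (\<integral>\<omega>. f (u + (H n + G n \<omega>)) \<partial>M))\<^sup>2 = (\<integral>\<^sup>+\<omega>. ennreal (f (u + (H n + G n \<omega>))) \<partial>M)\<^sup>2"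
        using bound f01 by (subst nn_integral_eq_integral) auto
      also have "\<dots> \<le> ennreal (exp (\<Sum>j\<in>J n. (a n j)\<^sup>2)) * (\<integral>\<^sup>+\<omega>. (ennreal (f (u + G n \<omega>)))\<^sup>2 \<partial>M)"
        unfolding eq unfolding G_def
        by (rule gaussian_sum_shift[OF M \<xi>, of "\<lambda>x. ennreal (f (u + x))"]) measurable
      \<comment> \<open>Since \<open>f\<close> takes values in \<open>[0, 1]\<close>, its square is
        at most \<open>f\<close>; the right side becomes linear in \<open>f\<close>, as needed for
        comparing measures.\<close>
      also have "\<dots> \<le> ennreal (exp (2 * c)) * (\<integral>\<^sup>+\<omega>. ennreal (f (u + G n \<omega>)) \<partial>M)"
        using a[of n] f01
        by (intro mult_mono nn_integral_mono ennreal_leI)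
           (auto simp: ennreal_power power2_eq_square mult_left_le intro!: ennreal_leI)
      also have "\<dots> = ennreal (exp (2 * c)) * ennreal (\<integral>\<omega>. f (u + G n \<omega>) \<partial>M)"
        using bound f01 by (subst nn_integral_eq_integral) auto
      finally show ?thesis
        using f01 by (simp add: ennreal_power integral_nonneg_AE flip: ennreal_mult)
    qed
    have 1: "(\<lambda>n. \<integral>\<omega>. f (u + (H n + G n \<omega>)) \<partial>M) \<longlonglongrightarrow> (\<integral>\<omega>. f (u + (h + Y \<omega>)) \<partial>M)"
    proof (rule conv)
      show "AE \<omega> in M. (\<lambda>n. u + (H n + G n \<omega>)) \<longlonglongrightarrow> u + (h + Y \<omega>)"
        using G_lim by eventually_elim (intro tendsto_intros H_lim)
    qed measurable
    have 2: "(\<lambda>n. \<integral>\<omega>. f (u + G n \<omega>) \<partial>M) \<longlonglongrightarrow> (\<integral>\<omega>. f (u + Y \<omega>) \<partial>M)"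
    proof (rule conv)
      show "AE \<omega> in M. (\<lambda>n. u + G n \<omega>) \<longlonglongrightarrow> u + Y \<omega>"
        using G_lim by eventually_elim (intro tendsto_intros)
    qed measurable
    show ?thesis
      unfolding add.assoc
      by (rule LIMSEQ_le[OF tendsto_power[OF 1] tendsto_mult[OF tendsto_const 2]]) (use le in blast)
  qed
  show ?thesis
  proof (rule absolutely_continuous_by_continuous_functions[where k = "exp (2 * c)"])
    fix f :: "'h \<Rightarrow> real"
    assume f: "continuous_on UNIV f" "\<And>x. 0 \<le> f x" "\<And>x. f x \<le> 1"
    have [measurable]: "f \<in> borel_measurable borel" by (rule borel_measurable_continuous_onI[OF f(1)])
    show "(\<integral>x. f x \<partial>distr M borel (\<lambda>\<omega>. u + h + Y \<omega>))\<^sup>2 \<le>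
        exp (2 * c) * (\<integral>x. f x \<partial>distr M borel (\<lambda>\<omega>. u + Y \<omega>))"
      using key[OF f] by (simp add: integral_distr)
  qed (auto intro!: finite_measure_distr)
qed

section \<open>Brownian increments\<close>

locale brownian_noise = prob_space M
  for M :: "'w measure" and F :: "real \<Rightarrow> 'w measure" and K :: "nat set" and \<beta> :: "nat \<Rightarrow> real \<Rightarrow> 'w \<Rightarrow> real" +
  assumes filtration: "time_filtration M F"
    and motions: "independent_brownian_motions M F K \<beta>"
begin

lemma motion: "k \<in> K \<Longrightarrow> brownian_motion M F (\<beta> k)"
  using motions by (simp add: independent_brownian_motions_def)

lemma F_subalgebra: "t \<ge> 0 \<Longrightarrow> subalgebra M (F t)"
  and F_mono: "0 \<le> s \<Longrightarrow> s \<le> t \<Longrightarrow> sets (F s) \<subseteq> sets (F t)"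
  using filtration by (auto simp: time_filtration_def)

lemma F_space: "t \<ge> 0 \<Longrightarrow> space (F t) = space M"
  using F_subalgebra by (simp add: subalgebra_def)

lemma \<beta>_F: "k \<in> K \<Longrightarrow> 0 \<le> s \<Longrightarrow> s \<le> t \<Longrightarrow> \<beta> k s \<in> borel_measurable (F t)"
proof -
  assume *: "k \<in> K" "0 \<le> s" "s \<le> t"
  then have "\<beta> k s \<in> borel_measurable (F s)" using motion[of k] by (simp add: brownian_motion_def)
  then show ?thesis
    using F_mono[OF *(2,3)] F_space[of s] F_space[of t] * by (fastforce simp: measurable_def)
qed

lemma \<beta>_measurable: "k \<in> K \<Longrightarrow> 0 \<le> t \<Longrightarrow> \<beta> k t \<in> borel_measurable M"
  using measurable_from_subalg[OF F_subalgebra \<beta>_F] by blast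

lemma increment_distributed:
  "k \<in> K \<Longrightarrow> 0 \<le> s \<Longrightarrow> s < t \<Longrightarrow>
    distributed M lborel (\<lambda>\<omega>. \<beta> k t \<omega> - \<beta> k s \<omega>) (normal_density 0 (sqrt (t - s)))"
  using motion[of k] by (simp add: brownian_motion_def)

lemma increment_normalised_distributed:
  assumes "k \<in> K" "0 \<le> s" "s < t"
  shows "distributed M lborel (\<lambda>\<omega>. (\<beta> k t \<omega> - \<beta> k s \<omega>) / sqrt (t - s)) std_normal_density"
  using increment_distributed[OF assms] normal_standard_normal_convert[of "sqrt (t - s)" _ 0] assms by simp

lemma increment_indep:
  assumes "k \<in> K" "0 \<le> s" "s < t" "E \<in> sets (F s)" "B \<in> sets borel"
  shows "prob (E \<inter> {\<omega> \<in> space M. \<beta> k t \<omega> - \<beta> k s \<omega> \<in> B}) = prob E * prob {\<omega> \<in> space M. \<beta> k t \<omega> - \<beta> k s \<omega> \<in> B}"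
proof (rule indep_setD)
  show "indep_set (sets (F s)) (sets (vimage_algebra (space M) (\<lambda>\<omega>. \<beta> k t \<omega> - \<beta> k s \<omega>) borel))"
    using motion[of k] assms by (simp add: brownian_motion_def)
  have "{\<omega> \<in> space M. \<beta> k t \<omega> - \<beta> k s \<omega> \<in> B} = (\<lambda>\<omega>. \<beta> k t \<omega> - \<beta> k s \<omega>) -` B \<inter> space M" by auto
  then show "{\<omega> \<in> space M. \<beta> k t \<omega> - \<beta> k s \<omega> \<in> B}
      \<in> sets (vimage_algebra (space M) (\<lambda>\<omega>. \<beta> k t \<omega> - \<beta> k s \<omega>) borel)"
    using in_vimage_algebra[OF assms(5)] by simp
qed (use assms in auto)

lemma increment_indep_var:
  assumes "k \<in> K" "0 \<le> s" "s < t" and X: "X \<in> borel_measurable (F s)"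
  shows "indep_var borel X borel (\<lambda>\<omega>. \<beta> k t \<omega> - \<beta> k s \<omega>)"
  unfolding indep_var_eq
proof (intro conjI)
  show "random_variable borel X" using measurable_from_subalg[OF F_subalgebra X] assms by simp
  show "random_variable borel (\<lambda>\<omega>. \<beta> k t \<omega> - \<beta> k s \<omega>)"
    using \<beta>_measurable assms by (intro borel_measurable_diff) auto
  have ind: "indep_set (sets (F s)) (sets (vimage_algebra (space M) (\<lambda>\<omega>. \<beta> k t \<omega> - \<beta> k s \<omega>) borel))"
    using motion[of k] assms by (simp add: brownian_motion_def)
  have "sigma_sets (space M) {X -` A \<inter> space M |A. A \<in> sets borel} \<subseteq> sets (F s)"
    using X F_space[of s] assms(2) by (auto intro!: sets.sigma_sets_subset dest: measurable_sets simp flip: F_space)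
  then show "indep_set (sigma_sets (space M) {X -` A \<inter> space M |A. A \<in> sets borel})
     (sigma_sets (space M) {(\<lambda>\<omega>. \<beta> k t \<omega> - \<beta> k s \<omega>) -` A \<inter> space M |A. A \<in> sets borel})"
    using ind unfolding indep_set_def sets_vimage_algebra
    by (elim indep_sets_mono_sets) (auto split: bool.split)
qed

lemma increment_moments:
  assumes "k \<in> K" "0 \<le> s" "s \<le> t"
  shows "integrable M (\<lambda>\<omega>. \<beta> k t \<omega> - \<beta> k s \<omega>)" "(\<integral>\<omega>. \<beta> k t \<omega> - \<beta> k s \<omega> \<partial>M) = 0"
    and "integrable M (\<lambda>\<omega>. (\<beta> k t \<omega> - \<beta> k s \<omega>)\<^sup>2)" "(\<integral>\<omega>. (\<beta> k t \<omega> - \<beta> k s \<omega>)\<^sup>2 \<partial>M) = t - s"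
proof -
  have "integrable M (\<lambda>\<omega>. \<beta> k t \<omega> - \<beta> k s \<omega>) \<and> (\<integral>\<omega>. \<beta> k t \<omega> - \<beta> k s \<omega> \<partial>M) = 0 \<and>
    integrable M (\<lambda>\<omega>. (\<beta> k t \<omega> - \<beta> k s \<omega>)\<^sup>2) \<and> (\<integral>\<omega>. (\<beta> k t \<omega> - \<beta> k s \<omega>)\<^sup>2 \<partial>M) = t - s"
  proof (cases "s = t")
    case False
    let ?X = "\<lambda>\<omega>. (\<beta> k t \<omega> - \<beta> k s \<omega>) / sqrt (t - s)"
    note d = increment_normalised_distributed[OF assms(1,2), of t]
    have st: "s < t" using False assms by simp
    have mom: "integrable M (\<lambda>\<omega>. ?X \<omega> ^ n)" "(\<integral>\<omega>. ?X \<omega> ^ n \<partial>M) = (\<integral>x. std_normal_density x * x ^ n \<partial>lborel)" for n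
      using distributed_integrable[OF d[OF st], of "\<lambda>x. x ^ n"]
        distributed_integral[OF d[OF st], of "\<lambda>x. x ^ n"] integrable_std_normal_moment[of n]
      by simp_all
    have 1: "integrable M (\<lambda>\<omega>. sqrt (t - s) * ?X \<omega> ^ 1)" "(\<integral>\<omega>. sqrt (t - s) * ?X \<omega> ^ 1 \<partial>M) = 0"
      using mom[of 1] integral_std_normal_moment_odd[of 0] by (simp_all del: times_divide_eq_right)
    have 2: "integrable M (\<lambda>\<omega>. (t - s) * ?X \<omega> ^ 2)" "(\<integral>\<omega>. (t - s) * ?X \<omega> ^ 2 \<partial>M) = t - s"
      using mom[of 2] integral_std_normal_moment_even[of 1] by (simp_all del: times_divide_eq_right)
    have "sqrt (t - s) * ?X \<omega> ^ 1 = \<beta> k t \<omega> - \<beta> k s \<omega>" "(t - s) * ?X \<omega> ^ 2 = (\<beta> k t \<omega> - \<beta> k s \<omega>)\<^sup>2" for \<omega>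
      using st by (simp_all add: power_divide)
    then show ?thesis using 1 2 by simp
  qed simp
  then show "integrable M (\<lambda>\<omega>. \<beta> k t \<omega> - \<beta> k s \<omega>)" "(\<integral>\<omega>. \<beta> k t \<omega> - \<beta> k s \<omega> \<partial>M) = 0"
    "integrable M (\<lambda>\<omega>. (\<beta> k t \<omega> - \<beta> k s \<omega>)\<^sup>2)" "(\<integral>\<omega>. (\<beta> k t \<omega> - \<beta> k s \<omega>)\<^sup>2 \<partial>M) = t - s"
    by auto
qed

lemma motion_zero: "k \<in> K \<Longrightarrow> AE \<omega> in M. \<beta> k 0 \<omega> = 0"
  using motion[of k] by (simp add: brownian_motion_def)

lemma motion_moments:
  assumes "k \<in> K" "0 \<le> t"
  shows "integrable M (\<beta> k t)" "(\<integral>\<omega>. \<beta> k t \<omega> \<partial>M) = 0"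
    and "integrable M (\<lambda>\<omega>. (\<beta> k t \<omega>)\<^sup>2)" "(\<integral>\<omega>. (\<beta> k t \<omega>)\<^sup>2 \<partial>M) = t"
proof -
  note inc = increment_moments[OF assms(1) order_refl assms(2)]
  note [measurable] = \<beta>_measurable[OF assms] \<beta>_measurable[OF assms(1) order_refl]
  have ae: "AE \<omega> in M. \<beta> k t \<omega> - \<beta> k 0 \<omega> = \<beta> k t \<omega>"
    and ae2: "AE \<omega> in M. (\<beta> k t \<omega> - \<beta> k 0 \<omega>)\<^sup>2 = (\<beta> k t \<omega>)\<^sup>2"
    using motion_zero[OF assms(1)] by auto
  show "integrable M (\<beta> k t)" using inc(1) ae by (subst integrable_cong_AE[OF _ _ ae, symmetric]) auto
  show "(\<integral>\<omega>. \<beta> k t \<omega> \<partial>M) = 0" using inc(2) ae by (subst integral_cong_AE[OF _ _ ae, symmetric]) auto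
  show "integrable M (\<lambda>\<omega>. (\<beta> k t \<omega>)\<^sup>2)" using inc(3) by (subst integrable_cong_AE[OF _ _ ae2, symmetric]) auto
  show "(\<integral>\<omega>. (\<beta> k t \<omega>)\<^sup>2 \<partial>M) = t" using inc(4) by (subst integral_cong_AE[OF _ _ ae2, symmetric]) auto
qed

text \<open>The value at the later time is the value at the earlier time plus an independent
  increment of mean zero.\<close>

lemma motion_covariance:
  assumes k: "k \<in> K" and "0 \<le> s" "0 \<le> t"
  shows "integrable M (\<lambda>\<omega>. \<beta> k s \<omega> * \<beta> k t \<omega>)" "(\<integral>\<omega>. \<beta> k s \<omega> * \<beta> k t \<omega> \<partial>M) = min s t"
proof -
  have "integrable M (\<lambda>\<omega>. \<beta> k s \<omega> * \<beta> k t \<omega>) \<and> (\<integral>\<omega>. \<beta> k s \<omega> * \<beta> k t \<omega> \<partial>M) = s"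
    if "0 \<le> s" "s < t" for s t
  proof -
    note ind = increment_indep_var[OF k that \<beta>_F[OF k that(1) order_refl]]
    note s = motion_moments[OF k that(1)] and inc = increment_moments[OF k that(1), of t]
    have "integrable M (\<lambda>\<omega>. \<beta> k s \<omega> * (\<beta> k t \<omega> - \<beta> k s \<omega>))"
      "(\<integral>\<omega>. \<beta> k s \<omega> * (\<beta> k t \<omega> - \<beta> k s \<omega>) \<partial>M) = 0"
      using indep_var_integrable[OF ind] indep_var_lebesgue_integral[OF ind] s inc that by auto
    moreover have "\<beta> k s \<omega> * \<beta> k t \<omega> = \<beta> k s \<omega> * (\<beta> k t \<omega> - \<beta> k s \<omega>) + (\<beta> k s \<omega>)\<^sup>2" for \<omega>
      by (simp add: power2_eq_square algebra_simps)
    ultimately show ?thesis using s by simp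
  qed
  from this[of s t] this[of t s] motion_moments[OF k \<open>0 \<le> s\<close>] assms
  have "integrable M (\<lambda>\<omega>. \<beta> k s \<omega> * \<beta> k t \<omega>) \<and> (\<integral>\<omega>. \<beta> k s \<omega> * \<beta> k t \<omega> \<partial>M) = min s t"
    by (cases s t rule: linorder_cases) (auto simp: mult.commute power2_eq_square)
  then show "integrable M (\<lambda>\<omega>. \<beta> k s \<omega> * \<beta> k t \<omega>)" "(\<integral>\<omega>. \<beta> k s \<omega> * \<beta> k t \<omega> \<partial>M) = min s t"
    by auto
qed

lemma motion_cross:
  assumes k: "k \<in> K" "l \<in> K" "k \<noteq> l" and "0 \<le> s" "0 \<le> t"
  shows "integrable M (\<lambda>\<omega>. \<beta> k s \<omega> * \<beta> l t \<omega>)" "(\<integral>\<omega>. \<beta> k s \<omega> * \<beta> l t \<omega> \<partial>M) = 0"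
proof -
  \<comment> \<open>Independence is given for whole paths; \<open>r\<close> evaluates path
    \<open>k\<close> at \<open>s\<close> and path \<open>l\<close> at \<open>t\<close>.\<close>
  define r where "r j = (if j = k then s else t)" for j
  have ind: "indep_vars (\<lambda>_. \<Pi>\<^sub>M t\<in>{0..}. borel) (\<lambda>k \<omega>. \<lambda>t\<in>{0..}. \<beta> k t \<omega>) {k, l}"
    using motions k by (auto simp: independent_brownian_motions_def intro: indep_vars_subset)
  have "indep_vars (\<lambda>_. borel) (\<lambda>j \<omega>. (\<lambda>x. x (r j)) (\<lambda>t\<in>{0..}. \<beta> j t \<omega>)) {k, l}"
    by (rule indep_vars_compose2[OF ind])
       (use assms in \<open>auto simp: r_def intro!: measurable_component_singleton\<close>)
  then have "indep_vars (\<lambda>_. borel) (\<lambda>j. \<beta> j (r j)) {k, l}"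
    by (rule indep_vars_cong[THEN iffD1, rotated -1]) (use assms in \<open>auto simp: r_def\<close>)
  note * = indep_vars_integrable[OF _ this] indep_vars_lebesgue_integral[OF _ this]
  have "integrable M (\<lambda>\<omega>. \<Prod>j\<in>{k, l}. \<beta> j (r j) \<omega>)"
    "(\<integral>\<omega>. (\<Prod>j\<in>{k, l}. \<beta> j (r j) \<omega>) \<partial>M) = (\<Prod>j\<in>{k, l}. \<integral>\<omega>. \<beta> j (r j) \<omega> \<partial>M)"
    by (rule *; use motion_moments(1) assms in \<open>auto simp: r_def\<close>)+
  then show "integrable M (\<lambda>\<omega>. \<beta> k s \<omega> * \<beta> l t \<omega>)" "(\<integral>\<omega>. \<beta> k s \<omega> * \<beta> l t \<omega> \<partial>M) = 0"
    using assms motion_moments(2) by (auto simp: r_def)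
qed

text \<open>For \<open>k = l\<close> the covariance is the length of the overlap of the two
  intervals. It is written as an L2 inner product of indicators so that it matches the double sum on
  the Lebesgue side of the isometry.\<close>

lemma increment_covariance:
  assumes k: "k \<in> K" "l \<in> K" and s: "0 \<le> s" "s \<le> t" "0 \<le> s'" "s' \<le> t'"
  shows "integrable M (\<lambda>\<omega>. (\<beta> k t \<omega> - \<beta> k s \<omega>) * (\<beta> l t' \<omega> - \<beta> l s' \<omega>))"
    and "(\<integral>\<omega>. (\<beta> k t \<omega> - \<beta> k s \<omega>) * (\<beta> l t' \<omega> - \<beta> l s' \<omega>) \<partial>M) =
      (if k = l then \<integral>x. indicator {s<..t} x * indicator {s'<..t'} x \<partial>lborel else 0)"
proof -
  let ?c = "\<lambda>s t. if k = l then min s t else 0"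
  have prod: "integrable M (\<lambda>\<omega>. \<beta> k s \<omega> * \<beta> l t \<omega>) \<and> (\<integral>\<omega>. \<beta> k s \<omega> * \<beta> l t \<omega> \<partial>M) = ?c s t"
    if "0 \<le> s" "0 \<le> t" for s t
    using motion_covariance[OF k(1) that] motion_cross[OF k _ that] by (cases "k = l") auto
  have eq: "(\<lambda>\<omega>. (\<beta> k t \<omega> - \<beta> k s \<omega>) * (\<beta> l t' \<omega> - \<beta> l s' \<omega>)) =
      (\<lambda>\<omega>. \<beta> k t \<omega> * \<beta> l t' \<omega> - \<beta> k t \<omega> * \<beta> l s' \<omega> - (\<beta> k s \<omega> * \<beta> l t' \<omega> - \<beta> k s \<omega> * \<beta> l s' \<omega>))"
    by (simp add: fun_eq_iff algebra_simps)
  have int: "integrable M (\<lambda>\<omega>. \<beta> k t \<omega> * \<beta> l t' \<omega>)" "integrable M (\<lambda>\<omega>. \<beta> k t \<omega> * \<beta> l s' \<omega>)"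
    "integrable M (\<lambda>\<omega>. \<beta> k s \<omega> * \<beta> l t' \<omega>)" "integrable M (\<lambda>\<omega>. \<beta> k s \<omega> * \<beta> l s' \<omega>)"
    using prod s by auto
  then show "integrable M (\<lambda>\<omega>. (\<beta> k t \<omega> - \<beta> k s \<omega>) * (\<beta> l t' \<omega> - \<beta> l s' \<omega>))"
    unfolding eq by (intro Bochner_Integration.integrable_diff)
  have "(\<integral>\<omega>. (\<beta> k t \<omega> - \<beta> k s \<omega>) * (\<beta> l t' \<omega> - \<beta> l s' \<omega>) \<partial>M) = ?c t t' - ?c t s' - (?c s t' - ?c s s')"
    unfolding eq using prod s int by simp
  also have "\<dots> = (if k = l then max 0 (min t t' - max s s') else 0)"
    using s by (auto simp: min_def max_def)
  also have "max 0 (min t t' - max s s') = (\<integral>x. indicator {s<..t} x * indicator {s'<..t'} x \<partial>lborel)"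
  proof -
    have "(\<integral>x. indicator {s<..t} x * indicator {s'<..t'} x \<partial>lborel) = measure lborel {max s s' <.. min t t'}"
      by (simp flip: indicator_inter_arith add: Int_greaterThanAtMost)
    also have "\<dots> = max 0 (min t t' - max s s')"
    proof (cases "max s s' \<le> min t t'")
      case False
      then have "{max s s' <.. min t t'} = {}" by (intro greaterThanAtMost_empty) linarith
      with False show ?thesis by (simp only: measure_empty)
    qed simp
    finally show ?thesis by simp
  qed
  finally show "(\<integral>\<omega>. (\<beta> k t \<omega> - \<beta> k s \<omega>) * (\<beta> l t' \<omega> - \<beta> l s' \<omega>) \<partial>M) =
      (if k = l then \<integral>x. indicator {s<..t} x * indicator {s'<..t'} x \<partial>lborel else 0)" .
qed

text \<open>The intervals may overlap, which allows sums over two different partitions to be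
  compared without a common refinement. Distinct modes are uncorrelated, so only the diagonal in
  \<open>k\<close> survives.\<close>

lemma increment_isometry:
  fixes v :: "nat \<Rightarrow> 'j \<Rightarrow> 'h::{real_inner,banach,second_countable_topology}"
  assumes K': "finite K'" "K' \<subseteq> K" and J: "finite J" and st: "\<And>j. j \<in> J \<Longrightarrow> 0 \<le> s j \<and> s j \<le> t j"
  shows "(\<integral>\<^sup>+\<omega>. ennreal ((norm (\<Sum>k\<in>K'. \<Sum>j\<in>J. (\<beta> k (t j) \<omega> - \<beta> k (s j) \<omega>) *\<^sub>R v k j))\<^sup>2) \<partial>M)
    = (\<Sum>k\<in>K'. \<integral>\<^sup>+x. ennreal ((norm (\<Sum>j\<in>J. indicator {s j <.. t j} x *\<^sub>R v k j))\<^sup>2) \<partial>lborel)"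
proof -
  let ?\<xi> = "\<lambda>(k, j) \<omega>. \<beta> k (t j) \<omega> - \<beta> k (s j) \<omega>" and ?v = "\<lambda>(k, j). v k j"
  let ?I = "\<lambda>i j. \<integral>x. indicator {s i<..t i} x * indicator {s j<..t j} x \<partial>lborel :: real"
  have cov: "integrable M (\<lambda>\<omega>. ?\<xi> a \<omega> * ?\<xi> b \<omega>)"
    "(\<integral>\<omega>. ?\<xi> a \<omega> * ?\<xi> b \<omega> \<partial>M) = (if fst a = fst b then ?I (snd a) (snd b) else 0)"
    if "a \<in> K' \<times> J" "b \<in> K' \<times> J" for a b
  proof -
    have "fst a \<in> K" "fst b \<in> K" "snd a \<in> J" "snd b \<in> J" using that K' by auto
    then show "integrable M (\<lambda>\<omega>. ?\<xi> a \<omega> * ?\<xi> b \<omega>)"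
      "(\<integral>\<omega>. ?\<xi> a \<omega> * ?\<xi> b \<omega> \<partial>M) = (if fst a = fst b then ?I (snd a) (snd b) else 0)"
      unfolding case_prod_beta by (intro increment_covariance; use st in blast)+
  qed
  have int: "integrable lborel (\<lambda>x. indicator {s i<..t i} x * indicator {s j<..t j} x :: real)" for i j
  proof -
    have "integrable lborel (indicator {max (s i) (s j)<..min (t i) (t j)} :: real \<Rightarrow> real)"
      by (intro integrable_real_indicator emeasure_bounded_finite) auto
    then show ?thesis by (simp flip: indicator_inter_arith add: Int_greaterThanAtMost)
  qed
  have "(\<integral>\<^sup>+\<omega>. ennreal ((norm (\<Sum>k\<in>K'. \<Sum>j\<in>J. (\<beta> k (t j) \<omega> - \<beta> k (s j) \<omega>) *\<^sub>R v k j))\<^sup>2) \<partial>M)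
      = (\<integral>\<^sup>+\<omega>. ennreal ((norm (\<Sum>a\<in>K' \<times> J. ?\<xi> a \<omega> *\<^sub>R ?v a))\<^sup>2) \<partial>M)"
    by (simp add: sum.cartesian_product case_prod_beta)
  also have "\<dots> = ennreal (\<Sum>a\<in>K' \<times> J. \<Sum>b\<in>K' \<times> J. (if fst a = fst b then ?I (snd a) (snd b) else 0) * (?v a \<bullet> ?v b))"
    using cov by (subst second_moment_sum) auto
  also have "(\<Sum>a\<in>K' \<times> J. \<Sum>b\<in>K' \<times> J. (if fst a = fst b then ?I (snd a) (snd b) else 0) * (?v a \<bullet> ?v b))
      = (\<Sum>k\<in>K'. \<Sum>i\<in>J. \<Sum>l\<in>K'. \<Sum>j\<in>J. (if k = l then ?I i j else 0) * (v k i \<bullet> v l j))"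
    by (simp add: sum.cartesian_product' case_prod_beta cong: if_cong)
  also have "\<dots> = (\<Sum>k\<in>K'. \<Sum>i\<in>J. \<Sum>j\<in>J. ?I i j * (v k i \<bullet> v k j))"
  proof (intro sum.cong refl)
    fix k i assume "k \<in> K'"
    have "(\<Sum>l\<in>K'. \<Sum>j\<in>J. (if k = l then ?I i j else 0) * (v k i \<bullet> v l j))
        = (\<Sum>l\<in>K'. if k = l then \<Sum>j\<in>J. ?I i j * (v k i \<bullet> v l j) else 0)"
      by (intro sum.cong) auto
    then show "(\<Sum>l\<in>K'. \<Sum>j\<in>J. (if k = l then ?I i j else 0) * (v k i \<bullet> v l j)) = (\<Sum>j\<in>J. ?I i j * (v k i \<bullet> v k j))"
      using K'(1) \<open>k \<in> K'\<close> by simp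
  qed
  also have "ennreal \<dots> = (\<Sum>k\<in>K'. ennreal (\<Sum>i\<in>J. \<Sum>j\<in>J. ?I i j * (v k i \<bullet> v k j)))"
  proof (rule sum_ennreal[symmetric])
    fix k
    have "(\<Sum>i\<in>J. \<Sum>j\<in>J. ?I i j * (v k i \<bullet> v k j)) =
        (\<integral>x. (norm (\<Sum>j\<in>J. indicator {s j <.. t j} x *\<^sub>R v k j))\<^sup>2 \<partial>lborel)"
      using int by (simp add: power2_norm_eq_inner inner_sum_left inner_sum_right sum_distrib_left mult.assoc[symmetric])
        (subst sum.swap, simp add: mult.commute inner_commute)
    also have "\<dots> \<ge> 0" by (intro integral_nonneg_AE) auto
    finally show "0 \<le> (\<Sum>i\<in>J. \<Sum>j\<in>J. ?I i j * (v k i \<bullet> v k j))" .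
  qed
  also have "\<dots> = (\<Sum>k\<in>K'. \<integral>\<^sup>+x. ennreal ((norm (\<Sum>j\<in>J. indicator {s j <.. t j} x *\<^sub>R v k j))\<^sup>2) \<partial>lborel)"
    by (intro sum.cong refl, subst second_moment_sum) (use int in auto)
  finally show ?thesis .
qed

end

section \<open>Joint independence and normality of Brownian increments\<close>

context brownian_noise
begin

text \<open>Increments are added one at a time: the event about the first \<open>m\<close> of them
  lies in \<open>F (p m)\<close>, of which the next one is independent. Steps of length zero are
  left out because \<open>brownian_motion\<close> describes increments for
  \<open>s < t\<close>.\<close>

lemma increments_prob:
  assumes k: "k \<in> K" and p0: "0 \<le> p 0" and p: "\<And>i. i < n \<Longrightarrow> p i \<le> p (Suc i)"
    and B: "\<And>i. B i \<in> sets borel"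
  defines "I \<equiv> {i. i < n \<and> p i < p (Suc i)}"
  shows "prob {\<omega> \<in> space M. \<forall>i\<in>I. \<beta> k (p (Suc i)) \<omega> - \<beta> k (p i) \<omega> \<in> B i} =
    (\<Prod>i\<in>I. prob {\<omega> \<in> space M. \<beta> k (p (Suc i)) \<omega> - \<beta> k (p i) \<omega> \<in> B i})"
proof -
  let ?D = "\<lambda>i \<omega>. \<beta> k (p (Suc i)) \<omega> - \<beta> k (p i) \<omega>"
  let ?I = "\<lambda>m. {i. i < m \<and> p i < p (Suc i)}"
  let ?E = "\<lambda>m. {\<omega> \<in> space M. \<forall>i\<in>?I m. ?D i \<omega> \<in> B i}"
  have pos: "0 \<le> p i" if "i \<le> n" for i
    using that by (induction i) (use p0 p in \<open>auto intro: order_trans simp: Suc_le_eq\<close>)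
  have "?E m \<in> sets (F (p m)) \<and> prob (?E m) = (\<Prod>i\<in>?I m. prob {\<omega> \<in> space M. ?D i \<omega> \<in> B i})"
    if "m \<le> n" for m
    using that
  proof (induction m)
    case 0
    then show ?case using F_space[OF p0] sets.top[of "F (p 0)"] by (simp add: prob_space)
  next
    case (Suc m)
    have m: "0 \<le> p m" "p m \<le> p (Suc m)" using Suc.prems pos p by (simp_all add: Suc_le_eq)
    have IH: "?E m \<in> sets (F (p m))" "prob (?E m) = (\<Prod>i\<in>?I m. prob {\<omega> \<in> space M. ?D i \<omega> \<in> B i})"
      using Suc.IH[OF Suc_leD[OF Suc.prems]] by blast+
    have E_Suc: "?E m \<in> sets (F (p (Suc m)))" using IH(1) F_mono[OF m] by blast
    show ?case
    proof (cases "p m < p (Suc m)")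
      case False
      then have "i < Suc m \<and> p i < p (Suc i) \<longleftrightarrow> i < m \<and> p i < p (Suc i)" for i
        by (metis less_Suc_eq)
      then have "?I (Suc m) = ?I m" by (rule Collect_cong)
      then show ?thesis unfolding \<open>?I (Suc m) = ?I m\<close> using IH(2) E_Suc by blast
    next
      case True
      then have "i < Suc m \<and> p i < p (Suc i) \<longleftrightarrow> i = m \<or> i < m \<and> p i < p (Suc i)" for i
        by (metis less_Suc_eq)
      then have I: "?I (Suc m) = insert m (?I m)" by blast
      let ?A = "{\<omega> \<in> space M. ?D m \<omega> \<in> B m}"
      have E: "?E (Suc m) = ?E m \<inter> ?A" unfolding I by auto
      have "?D m \<in> borel_measurable (F (p (Suc m)))"
        using \<beta>_F[OF k] m by (intro borel_measurable_diff) auto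
      then have "?A \<in> sets (F (p (Suc m)))"
        using measurable_sets[OF _ B[of m], of "?D m" "F (p (Suc m))"] F_space[of "p (Suc m)"] m
        by (auto simp: vimage_def Int_def conj_commute)
      then have E_sets: "?E (Suc m) \<in> sets (F (p (Suc m)))" unfolding E using E_Suc by (rule sets.Int[rotated])
      have fin: "finite (?I m)" "m \<notin> ?I m" by simp_all
      have "prob (?E (Suc m)) = prob (?E m) * prob ?A"
        unfolding E by (rule increment_indep[OF k m(1) True IH(1) B])
      also have "\<dots> = prob ?A * (\<Prod>i\<in>?I m. prob {\<omega> \<in> space M. ?D i \<omega> \<in> B i})"
        unfolding IH(2) by (rule mult.commute)
      also have "\<dots> = (\<Prod>i\<in>?I (Suc m). prob {\<omega> \<in> space M. ?D i \<omega> \<in> B i})"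
        unfolding I by (rule prod.insert[OF fin, symmetric])
      finally show ?thesis using E_sets by blast
    qed
  qed
  from this[of n] show ?thesis unfolding I_def by blast
qed

lemma increments_indep_vars:
  assumes K': "finite K'" "K' \<subseteq> K" and p0: "0 \<le> p 0" and p: "\<And>i. i < n \<Longrightarrow> p i \<le> p (Suc i)"
  defines "I \<equiv> {i. i < n \<and> p i < p (Suc i)}"
  shows "indep_vars (\<lambda>_. borel) (\<lambda>(k, i) \<omega>. \<beta> k (p (Suc i)) \<omega> - \<beta> k (p i) \<omega>) (K' \<times> I)"
proof -
  let ?D = "\<lambda>k i \<omega>. \<beta> k (p (Suc i)) \<omega> - \<beta> k (p i) \<omega>"
  have pos: "0 \<le> p i" if "i \<le> n" for i
    using that by (induction i) (use p0 p in \<open>auto intro: order_trans simp: Suc_le_eq\<close>)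
  have I: "finite I" "\<And>i. i \<in> I \<Longrightarrow> 0 \<le> p i \<and> 0 \<le> p (Suc i)" using pos by (auto simp: I_def)
  have meas: "?D k i \<in> borel_measurable M" if "k \<in> K'" "i \<in> I" for k i
    using \<beta>_measurable K' I that by (intro borel_measurable_diff) auto
  \<comment> \<open>Path independence factors the probability over the modes, and
    \<open>increments_prob\<close> factors each mode over time.\<close>
  have joint: "prob {\<omega> \<in> space M. \<forall>k\<in>K'. \<forall>i\<in>I. ?D k i \<omega> \<in> B k i} =
      (\<Prod>k\<in>K'. \<Prod>i\<in>I. prob {\<omega> \<in> space M. ?D k i \<omega> \<in> B k i})"
    if B: "\<And>k i. B k i \<in> sets borel" for B
  proof (cases "K' = {}")
    case True
    then show ?thesis by (simp add: prob_space)
  next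
    case False
    let ?R = "\<lambda>k \<omega>. \<lambda>i\<in>I. ?D k i \<omega>"
    have ind: "indep_vars (\<lambda>_. \<Pi>\<^sub>M t\<in>{0..}. borel) (\<lambda>k \<omega>. \<lambda>t\<in>{0..}. \<beta> k t \<omega>) K'"
      using motions K' by (auto simp: independent_brownian_motions_def intro: indep_vars_subset)
    have "indep_vars (\<lambda>_. \<Pi>\<^sub>M i\<in>I. borel) (\<lambda>k \<omega>. (\<lambda>x. \<lambda>i\<in>I. x (p (Suc i)) - x (p i)) (\<lambda>t\<in>{0..}. \<beta> k t \<omega>)) K'"
    proof (rule indep_vars_compose2[OF ind], rule measurable_restrict, rule borel_measurable_diff)
      fix i assume "i \<in> I"
      then have "p (Suc i) \<in> {0..}" "p i \<in> {0..}" using I by auto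
      then show "(\<lambda>x. x (p (Suc i))) \<in> borel_measurable (\<Pi>\<^sub>M t\<in>{0..}. borel)"
        "(\<lambda>x. x (p i)) \<in> borel_measurable (\<Pi>\<^sub>M t\<in>{0..}. borel)"
        by (auto intro: measurable_component_singleton)
    qed
    then have "indep_vars (\<lambda>_. \<Pi>\<^sub>M i\<in>I. borel) ?R K'"
      by (rule indep_vars_cong[THEN iffD1, rotated -1]) (use I in \<open>auto simp: fun_eq_iff\<close>)
    then have "prob (\<Inter>k\<in>K'. ?R k -` (\<Pi>\<^sub>E i\<in>I. B k i) \<inter> space M) = (\<Prod>k\<in>K'. prob (?R k -` (\<Pi>\<^sub>E i\<in>I. B k i) \<inter> space M))"
      using False K' I B by (intro indep_varsD_finite) (auto intro!: sets_PiM_I_finite)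
    moreover have "?R k -` (\<Pi>\<^sub>E i\<in>I. B k i) \<inter> space M = {\<omega> \<in> space M. \<forall>i\<in>I. ?D k i \<omega> \<in> B k i}" for k
      by (auto simp: PiE_iff)
    moreover have "(\<Inter>k\<in>K'. {\<omega> \<in> space M. \<forall>i\<in>I. ?D k i \<omega> \<in> B k i}) = {\<omega> \<in> space M. \<forall>k\<in>K'. \<forall>i\<in>I. ?D k i \<omega> \<in> B k i}"
      using False by auto
    moreover have "prob {\<omega> \<in> space M. \<forall>i\<in>I. ?D k i \<omega> \<in> B k i} = (\<Prod>i\<in>I. prob {\<omega> \<in> space M. ?D k i \<omega> \<in> B k i})"
      if "k \<in> K'" for k
      unfolding I_def by (rule increments_prob) (use that K' p0 p B in auto)
    ultimately show ?thesis by simp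
  qed
  show ?thesis
    unfolding indep_vars_def2
  proof (intro conjI ballI indep_setsI)
    fix a assume "a \<in> K' \<times> I"
    then show "random_variable borel (case a of (k, i) \<Rightarrow> ?D k i)" using meas by auto
    then show "{(case a of (k, i) \<Rightarrow> ?D k i) -` A \<inter> space M |A. A \<in> sets borel} \<subseteq> events"
      by (auto dest: measurable_sets)
  next
    fix A J assume J: "J \<subseteq> K' \<times> I" and A: "\<forall>j\<in>J. A j \<in> {(case j of (k, i) \<Rightarrow> ?D k i) -` A \<inter> space M |A. A \<in> sets borel}"
      and "J \<noteq> {}"
    have "\<forall>j\<in>J. \<exists>C. A j = (case j of (k, i) \<Rightarrow> ?D k i) -` C \<inter> space M \<and> C \<in> sets borel"
      using A unfolding mem_Collect_eq .
    then obtain C where "\<forall>j\<in>J. A j = (case j of (k, i) \<Rightarrow> ?D k i) -` C j \<inter> space M \<and> C j \<in> sets borel"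
      by (rule bchoice[THEN exE])
    then have C: "A (k, i) = ?D k i -` C (k, i) \<inter> space M" "C (k, i) \<in> sets borel" if "(k, i) \<in> J" for k i
      using that by fastforce+
    \<comment> \<open>Indices outside \<open>J\<close> receive the whole line. An intersection over
      a subfamily thus becomes an event about all increments, and the additional factors are
      1.\<close>
    define B where "B k i = (if (k, i) \<in> J then C (k, i) else UNIV)" for k i
    have B: "B k i \<in> sets borel" for k i using C by (auto simp: B_def)
    have A_eq: "A (k, i) = {\<omega> \<in> space M. ?D k i \<omega> \<in> B k i}" if "(k, i) \<in> J" for k i
      using C[OF that] that by (auto simp: B_def)
    have "(\<Inter>j\<in>J. A j) = {\<omega> \<in> space M. \<forall>k\<in>K'. \<forall>i\<in>I. ?D k i \<omega> \<in> B k i}"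
    proof (intro set_eqI iffI)
      fix \<omega> assume "\<omega> \<in> (\<Inter>j\<in>J. A j)"
      then have *: "\<And>k i. (k, i) \<in> J \<Longrightarrow> \<omega> \<in> space M \<and> ?D k i \<omega> \<in> B k i" using A_eq by auto
      then have "\<omega> \<in> space M" using \<open>J \<noteq> {}\<close> by auto
      with * show "\<omega> \<in> {\<omega> \<in> space M. \<forall>k\<in>K'. \<forall>i\<in>I. ?D k i \<omega> \<in> B k i}" by (auto simp: B_def)
    next
      fix \<omega> assume "\<omega> \<in> {\<omega> \<in> space M. \<forall>k\<in>K'. \<forall>i\<in>I. ?D k i \<omega> \<in> B k i}"
      then show "\<omega> \<in> (\<Inter>j\<in>J. A j)" using A_eq J by auto
    qed
    then have "prob (\<Inter>j\<in>J. A j) = (\<Prod>k\<in>K'. \<Prod>i\<in>I. prob {\<omega> \<in> space M. ?D k i \<omega> \<in> B k i})"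
      using joint[OF B] by simp
    also have "\<dots> = (\<Prod>j\<in>K' \<times> I. case j of (k, i) \<Rightarrow> prob {\<omega> \<in> space M. ?D k i \<omega> \<in> B k i})"
      by (rule prod.cartesian_product)
    also have "\<dots> = (\<Prod>j\<in>J. case j of (k, i) \<Rightarrow> prob {\<omega> \<in> space M. ?D k i \<omega> \<in> B k i})"
      using J K' I by (intro prod.mono_neutral_right) (auto simp: B_def prob_space)
    also have "\<dots> = (\<Prod>j\<in>J. prob (A j))"
      using A_eq by (intro prod.cong) auto
    finally show "prob (\<Inter>j\<in>J. A j) = (\<Prod>j\<in>J. prob (A j))" .
  qed
qed

lemma increments_std_normal_family:
  assumes K': "finite K'" "K' \<subseteq> K" and p0: "0 \<le> p 0" and p: "\<And>i. i < n \<Longrightarrow> p i \<le> p (Suc i)"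
  shows "std_normal_family M (K' \<times> {i. i < n \<and> p i < p (Suc i)})
    (\<lambda>(k, i) \<omega>. (\<beta> k (p (Suc i)) \<omega> - \<beta> k (p i) \<omega>) / sqrt (p (Suc i) - p i))"
proof -
  have pos: "0 \<le> p i" if "i \<le> n" for i
    using that by (induction i) (use p0 p in \<open>auto intro: order_trans simp: Suc_le_eq\<close>)
  let ?J = "K' \<times> {i. i < n \<and> p i < p (Suc i)}"
  have "indep_vars (\<lambda>_. borel) (\<lambda>j \<omega>. (\<lambda>x. x / sqrt (p (Suc (snd j)) - p (snd j)))
      ((\<lambda>(k, i) \<omega>. \<beta> k (p (Suc i)) \<omega> - \<beta> k (p i) \<omega>) j \<omega>)) ?J"
    by (rule indep_vars_compose2[OF increments_indep_vars[OF K' p0 p]]) auto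
  then have "indep_vars (\<lambda>_. borel) (\<lambda>(k, i) \<omega>. (\<beta> k (p (Suc i)) \<omega> - \<beta> k (p i) \<omega>) / sqrt (p (Suc i) - p i)) ?J"
    by (rule indep_vars_cong[THEN iffD1, rotated -1]) auto
  moreover have "distributed M lborel (\<lambda>\<omega>. (\<beta> k (p (Suc i)) \<omega> - \<beta> k (p i) \<omega>) / sqrt (p (Suc i) - p i)) std_normal_density"
    if "k \<in> K'" "i < n" "p i < p (Suc i)" for k i
    using increment_normalised_distributed pos K' that by auto
  ultimately show ?thesis using K' by (auto simp: std_normal_family_def)
qed

end

section \<open>Orthonormal expansions and the eigenvalues of the covariance\<close>

lemma orthonormal_projection:
  fixes e :: "nat \<Rightarrow> 'l::real_inner"
  assumes e: "orthonormal_basis K e" and F: "finite F" "F \<subseteq> K"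
  shows "j \<in> F \<Longrightarrow> (v - (\<Sum>k\<in>F. (v \<bullet> e k) *\<^sub>R e k)) \<bullet> e j = 0"
    and "(norm (v - (\<Sum>k\<in>F. (v \<bullet> e k) *\<^sub>R e k)))\<^sup>2 = (norm v)\<^sup>2 - (\<Sum>k\<in>F. (v \<bullet> e k)\<^sup>2)"
proof -
  let ?P = "\<Sum>k\<in>F. (v \<bullet> e k) *\<^sub>R e k"
  have ij: "e i \<bullet> e j = (if i = j then 1 else 0)" if "i \<in> F" "j \<in> F" for i j
    using e that[THEN subsetD[OF F(2)]] unfolding orthonormal_basis_def by blast
  have orth: "(v - ?P) \<bullet> e j = 0" if "j \<in> F" for j
  proof -
    have "?P \<bullet> e j = (\<Sum>k\<in>F. if k = j then v \<bullet> e k else 0)"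
      unfolding inner_sum_left using ij that by (intro sum.cong) auto
    then show ?thesis using F that by (simp add: inner_diff_left)
  qed
  then show "j \<in> F \<Longrightarrow> (v - ?P) \<bullet> e j = 0" .
  have "(v - ?P) \<bullet> ?P = 0" using orth by (simp add: inner_sum_right)
  then have "(norm (v - ?P))\<^sup>2 = (v - ?P) \<bullet> v" by (simp add: power2_norm_eq_inner inner_diff_right)
  also have "\<dots> = (norm v)\<^sup>2 - (\<Sum>k\<in>F. (v \<bullet> e k)\<^sup>2)"
    by (simp add: inner_diff_left inner_sum_left inner_commute[of "e _" v] flip: power2_norm_eq_inner power2_eq_square)
  finally show "(norm (v - ?P))\<^sup>2 = (norm v)\<^sup>2 - (\<Sum>k\<in>F. (v \<bullet> e k)\<^sup>2)" .
qed

lemma bessel: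
  fixes e :: "nat \<Rightarrow> 'l::real_inner"
  assumes "orthonormal_basis K e" "finite F" "F \<subseteq> K"
  shows "(\<Sum>k\<in>F. (v \<bullet> e k)\<^sup>2) \<le> (norm v)\<^sup>2"
  using orthonormal_projection(2)[OF assms, of v] zero_le_power2 by (metis diff_ge_0_iff_ge)

text \<open>Bessel gives one direction. For the other, \<open>v\<close> is approximated by a finite
  combination of basis vectors, and by Pythagoras the projection onto the same finite set is at
  least as close.\<close>

lemma parseval:
  fixes e :: "nat \<Rightarrow> 'l::real_inner"
  assumes e: "orthonormal_basis K e"
  shows "(\<Sum>k. if k \<in> K then ennreal ((v \<bullet> e k)\<^sup>2) else 0) = ennreal ((norm v)\<^sup>2)"
proof (rule antisym)
  let ?f = "\<lambda>k. if k \<in> K then ennreal ((v \<bullet> e k)\<^sup>2) else 0"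
  have partial: "sum ?f {..<N} = ennreal (\<Sum>k\<in>K \<inter> {..<N}. (v \<bullet> e k)\<^sup>2)" for N
    by (simp add: sum.inter_restrict[symmetric] Int_commute flip: sum_ennreal)
  show "suminf ?f \<le> ennreal ((norm v)\<^sup>2)"
    by (rule suminf_le_const) (auto simp: partial intro!: ennreal_leI bessel[OF e])
  show "ennreal ((norm v)\<^sup>2) \<le> suminf ?f"
  proof (rule ennreal_le_epsilon)
    fix \<epsilon> :: real assume "\<epsilon> > 0"
    have "v \<in> closure (span (e ` K))" using e by (simp add: orthonormal_basis_def)
    then obtain w where w: "w \<in> span (e ` K)" "dist w v < sqrt \<epsilon>"
      using real_sqrt_gt_zero[OF \<open>\<epsilon> > 0\<close>] unfolding closure_approachable by blast
    from w(1) obtain t r where t: "finite t" "t \<subseteq> e ` K" "w = (\<Sum>a\<in>t. r a *\<^sub>R a)"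
      unfolding span_explicit by blast
    from finite_subset_image[OF t(1,2)] obtain F where F: "F \<subseteq> K" "finite F" "t = e ` F" by blast
    let ?P = "\<Sum>k\<in>F. (v \<bullet> e k) *\<^sub>R e k"
    note proj = orthonormal_projection[OF e F(2,1), where v = v]
    have "(v - ?P) \<bullet> w = 0" using proj(1) t(3) F(3) by (auto simp: inner_sum_right intro!: sum.neutral)
    moreover have "(v - ?P) \<bullet> ?P = 0" using proj(1) by (simp add: inner_sum_right)
    ultimately have "(norm (v - w))\<^sup>2 = (norm (v - ?P))\<^sup>2 + (norm (?P - w))\<^sup>2"
      by (simp add: power2_norm_eq_inner inner_diff_left inner_diff_right inner_commute)
    moreover have "(norm (v - w))\<^sup>2 \<le> \<epsilon>"
    proof -
      have "norm (v - w) \<le> sqrt \<epsilon>" using w(2) by (simp add: dist_norm norm_minus_commute)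
      then have "(norm (v - w))\<^sup>2 \<le> (sqrt \<epsilon>)\<^sup>2" by (intro power_mono) auto
      with \<open>\<epsilon> > 0\<close> show ?thesis by simp
    qed
    ultimately have "(norm v)\<^sup>2 \<le> (\<Sum>k\<in>F. (v \<bullet> e k)\<^sup>2) + \<epsilon>"
      using proj(2) zero_le_power2[of "norm (?P - w)"] by linarith
    then have "ennreal ((norm v)\<^sup>2) \<le> ennreal (\<Sum>k\<in>F. (v \<bullet> e k)\<^sup>2) + ennreal \<epsilon>"
      using \<open>\<epsilon> > 0\<close> by (simp add: sum_nonneg ennreal_leI flip: ennreal_plus)
    also have "ennreal (\<Sum>k\<in>F. (v \<bullet> e k)\<^sup>2) = (\<Sum>k\<in>F. ?f k)"
    proof -
      have "(\<Sum>k\<in>F. ?f k) = (\<Sum>k\<in>F. ennreal ((v \<bullet> e k)\<^sup>2))"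
        using F(1) by (intro sum.cong) auto
      then show ?thesis by simp
    qed
    also have "\<dots> \<le> suminf ?f" using F(2) by (intro sum_le_suminf) auto
    finally show "ennreal ((norm v)\<^sup>2) \<le> suminf ?f + ennreal \<epsilon>" by (simp add: add_right_mono)
  qed
qed

text \<open>Mode \<open>k\<close> of \<open>W t\<close> has variance
  \<open>t * (\<gamma> k)^2\<close>, so this sum controls the truncation of the noise. Each
  \<open>\<gamma> k\<close> is a diagonal entry of the nuclear expansion; Cauchy-Schwarz and Bessel
  bound their sum by the sum of \<open>norm (a j) * norm (b j)\<close>, and boundedness of the
  eigenvalues passes to squares.\<close>

lemma trace_class_eigenvalues_square_summable:
  fixes e :: "nat \<Rightarrow> 'l::real_inner"
  assumes Q: "noise_covariance Q K e \<gamma>"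
  shows "summable (\<lambda>k. if k \<in> K then (\<gamma> k)\<^sup>2 else 0)"
proof -
  have e: "orthonormal_basis K e" and \<gamma>: "\<And>k. k \<in> K \<Longrightarrow> 0 \<le> \<gamma> k" "\<And>k. k \<in> K \<Longrightarrow> Q (e k) = \<gamma> k *\<^sub>R e k"
    and "bdd_above (\<gamma> ` K)" "trace_class Q"
    using Q by (auto simp: noise_covariance_def)
  then obtain G where G: "\<And>k. k \<in> K \<Longrightarrow> \<gamma> k \<le> G" by (auto simp: bdd_above_def)
  obtain a b where ab: "summable (\<lambda>j. norm (a j) * norm (b j))" "\<And>x. (\<lambda>j. (x \<bullet> a j) *\<^sub>R b j) sums Q x"
    using \<open>trace_class Q\<close> by (auto simp: trace_class_def)
  define A where "A = (\<Sum>j. norm (a j) * norm (b j))"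
  have trace: "(\<Sum>k\<in>F. \<gamma> k) \<le> A" if F: "finite F" "F \<subseteq> K" for F
  proof (rule sums_le)
    have "(\<lambda>j. (e k \<bullet> a j) * (b j \<bullet> e k)) sums \<gamma> k" if "k \<in> F" for k
    proof -
      have "e k \<bullet> e k = 1" using e F that by (auto simp: orthonormal_basis_def)
      then have "Q (e k) \<bullet> e k = \<gamma> k" using \<gamma>(2)[of k] F that by auto
      then show ?thesis
        using bounded_linear.sums[OF bounded_linear_inner_left ab(2), of "e k" "e k"] by simp
    qed
    then show "(\<lambda>j. \<Sum>k\<in>F. (e k \<bullet> a j) * (b j \<bullet> e k)) sums (\<Sum>k\<in>F. \<gamma> k)" by (intro sums_sum)
    show "(\<lambda>j. norm (a j) * norm (b j)) sums A" unfolding A_def by (intro summable_sums ab(1))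
    fix j
    have L2: "L2_set (\<lambda>k. u \<bullet> e k) F \<le> norm u" for u
      unfolding L2_set_def using bessel[OF e F, of u] by (intro real_le_lsqrt) (auto intro: sum_nonneg)
    have "(\<Sum>k\<in>F. (e k \<bullet> a j) * (b j \<bullet> e k)) \<le> (\<Sum>k\<in>F. \<bar>a j \<bullet> e k\<bar> * \<bar>b j \<bullet> e k\<bar>)"
      by (intro sum_mono) (metis abs_ge_self abs_mult inner_commute)
    also have "\<dots> \<le> L2_set (\<lambda>k. a j \<bullet> e k) F * L2_set (\<lambda>k. b j \<bullet> e k) F" by (rule L2_set_mult_ineq)
    also have "\<dots> \<le> norm (a j) * norm (b j)" by (intro mult_mono L2 L2_set_nonneg norm_ge_zero)
    finally show "(\<Sum>k\<in>F. (e k \<bullet> a j) * (b j \<bullet> e k)) \<le> norm (a j) * norm (b j)" .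
  qed
  have sq: "(\<gamma> k)\<^sup>2 \<le> \<bar>G\<bar> * \<gamma> k" if "k \<in> K" for k
    using G[OF that] \<gamma>(1)[OF that] by (simp add: power2_eq_square mult_right_mono)
  have "(\<Sum>k<N. if k \<in> K then (\<gamma> k)\<^sup>2 else 0) \<le> \<bar>G\<bar> * A" for N
  proof -
    have "(\<Sum>k<N. if k \<in> K then (\<gamma> k)\<^sup>2 else 0) = (\<Sum>k\<in>{..<N} \<inter> K. (\<gamma> k)\<^sup>2)"
      by (simp add: sum.inter_restrict)
    also have "\<dots> \<le> (\<Sum>k\<in>{..<N} \<inter> K. \<bar>G\<bar> * \<gamma> k)" using sq by (intro sum_mono) auto
    also have "\<dots> \<le> \<bar>G\<bar> * A" unfolding sum_distrib_left[symmetric] by (intro mult_left_mono trace) auto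
    finally show ?thesis .
  qed
  then show ?thesis by (intro summableI_nonneg_bounded) auto
qed

section \<open>Approximation of the stochastic integral\<close>

lemma nn_integral_power2_norm_add_le:
  fixes f g :: "'w \<Rightarrow> 'a::{real_normed_vector, second_countable_topology}"
  assumes [measurable]: "f \<in> borel_measurable M" "g \<in> borel_measurable M"
  shows "(\<integral>\<^sup>+\<omega>. ennreal ((norm (f \<omega> + g \<omega>))\<^sup>2) \<partial>M) \<le>
    2 * (\<integral>\<^sup>+\<omega>. ennreal ((norm (f \<omega>))\<^sup>2) \<partial>M) + 2 * (\<integral>\<^sup>+\<omega>. ennreal ((norm (g \<omega>))\<^sup>2) \<partial>M)"
proof -
  have "(\<integral>\<^sup>+\<omega>. ennreal ((norm (f \<omega> + g \<omega>))\<^sup>2) \<partial>M) \<le>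
      (\<integral>\<^sup>+\<omega>. 2 * ennreal ((norm (f \<omega>))\<^sup>2) + 2 * ennreal ((norm (g \<omega>))\<^sup>2) \<partial>M)"
    by (intro nn_integral_mono ennreal_power2_norm_add_le)
  then show ?thesis by (simp add: nn_integral_add nn_integral_cmult)
qed

lemma power2_norm_sum_le:
  fixes x :: "'i \<Rightarrow> 'a::real_normed_vector"
  shows "(norm (\<Sum>i\<in>I. x i))\<^sup>2 \<le> real (card I) * (\<Sum>i\<in>I. (norm (x i))\<^sup>2)"
proof -
  have "(norm (\<Sum>i\<in>I. x i))\<^sup>2 \<le> (\<Sum>i\<in>I. norm (x i))\<^sup>2" by (intro power_mono norm_sum norm_ge_zero)
  also have "\<dots> \<le> real (card I) * (\<Sum>i\<in>I. (norm (x i))\<^sup>2)"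
    using sum_squared_le_sum_of_squares[of "\<lambda>i. norm (x i)" I] by (cases "finite I") (auto simp: mult.commute)
  finally show ?thesis .
qed

definition step_vec :: "nat \<Rightarrow> (nat \<Rightarrow> real) \<Rightarrow> (nat \<Rightarrow> 'h::real_vector) \<Rightarrow> real \<Rightarrow> 'h" where
  "step_vec n p w s = (\<Sum>i<n. indicator {p i <.. p (Suc i)} s *\<^sub>R w i)"

text \<open>The integral of a step function against finitely many modes. In applications
  \<open>v k i\<close> is \<open>\<Psi> i (Q (e k))\<close>, so the weight \<open>\<gamma> k\<close>
  sits in \<open>v\<close> and the driving motions are unweighted.\<close>

definition step_sum :: "(nat \<Rightarrow> real \<Rightarrow> 'w \<Rightarrow> real) \<Rightarrow> nat set \<Rightarrow> nat \<Rightarrow> (nat \<Rightarrow> real) \<Rightarrow>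
    (nat \<Rightarrow> nat \<Rightarrow> 'h::real_vector) \<Rightarrow> 'w \<Rightarrow> 'h" where
  "step_sum \<beta> K' n p v \<omega> = (\<Sum>k\<in>K'. \<Sum>i<n. (\<beta> k (p (Suc i)) \<omega> - \<beta> k (p i) \<omega>) *\<^sub>R v k i)"

lemma step_vec_measurable [measurable]:
  fixes w :: "nat \<Rightarrow> 'h::{real_normed_vector, second_countable_topology}"
  shows "step_vec n p w \<in> borel_measurable borel"
  unfolding step_vec_def by measurable

lemma step_vec_inner: "step_vec n p w s \<bullet> z = step_vec n p (\<lambda>i. w i \<bullet> z) s"
  by (simp add: step_vec_def inner_sum_left)

lemma step_sum_inner: "step_sum \<beta> K' n p v \<omega> \<bullet> z = step_sum \<beta> K' n p (\<lambda>k i. v k i \<bullet> z) \<omega>"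
  by (simp add: step_sum_def inner_sum_left)

lemma partition_bounds:
  assumes "partition T n p" "i \<le> n"
  shows "0 \<le> p i" "p i \<le> T"
proof -
  have p: "p 0 = 0" "p n = T" "\<And>i. i < n \<Longrightarrow> p i \<le> p (Suc i)" using assms(1) by (auto simp: partition_def)
  have mono: "p i \<le> p j" if "i \<le> j" "j \<le> n" for i j
    using that
  proof (induction rule: dec_induct)
    case (step m)
    then show ?case using p(3)[of m] by simp
  qed simp
  show "0 \<le> p i" "p i \<le> T" using mono[of 0 i] mono[of i n] p assms(2) by auto
qed

lemma step_vec_outside:
  assumes "partition T n p" "s \<notin> {0..T}"
  shows "step_vec n p w s = 0"
  unfolding step_vec_def
proof (rule sum.neutral, rule ballI)
  fix i assume "i \<in> {..<n}"
  then have "s \<notin> {p i <.. p (Suc i)}"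
    using partition_bounds[OF assms(1), of i] partition_bounds[OF assms(1), of "Suc i"] assms(2) by auto
  then show "indicator {p i <.. p (Suc i)} s *\<^sub>R w i = 0" by simp
qed

section \<open>Step integrals against the truncated noise and uniqueness of their limits\<close>

context brownian_noise
begin

lemma step_sum_measurable:
  fixes v :: "nat \<Rightarrow> nat \<Rightarrow> 'h::{real_normed_vector, second_countable_topology}"
  assumes "K' \<subseteq> K" "partition T n p"
  shows "step_sum \<beta> K' n p v \<in> borel_measurable M"
  unfolding step_sum_def
proof (intro borel_measurable_sum borel_measurable_scaleR borel_measurable_diff borel_measurable_const)
  fix k i assume "k \<in> K'" "i \<in> {..<n}"
  then show "\<beta> k (p (Suc i)) \<in> borel_measurable M" "\<beta> k (p i) \<in> borel_measurable M"
    using assms partition_bounds[OF assms(2), of i] partition_bounds[OF assms(2), of "Suc i"]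
    by (auto intro!: \<beta>_measurable)
qed

lemma step_sum_isometry:
  fixes v :: "nat \<Rightarrow> nat \<Rightarrow> 'h::{real_inner,banach,second_countable_topology}"
  assumes "finite K'" "K' \<subseteq> K" "partition T n p"
  shows "(\<integral>\<^sup>+\<omega>. ennreal ((norm (step_sum \<beta> K' n p v \<omega>))\<^sup>2) \<partial>M)
    = (\<Sum>k\<in>K'. \<integral>\<^sup>+x. ennreal ((norm (step_vec n p (v k) x))\<^sup>2) \<partial>lborel)"
  unfolding step_sum_def step_vec_def
  using partition_bounds(1)[OF assms(3)] assms
  by (intro increment_isometry) (auto simp: partition_def)

text \<open>The disjoint union of both index sets, with a sign on the second, makes the difference a
  single sum of increments over overlapping intervals.\<close>

lemma step_sum_diff_isometry:
  fixes v v' :: "nat \<Rightarrow> nat \<Rightarrow> 'h::{real_inner,banach,second_countable_topology}"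
  assumes K': "finite K'" "K' \<subseteq> K" and p: "partition T n p" and p': "partition T n' p'"
  shows "(\<integral>\<^sup>+\<omega>. ennreal ((norm (step_sum \<beta> K' n p v \<omega> - step_sum \<beta> K' n' p' v' \<omega>))\<^sup>2) \<partial>M)
    = (\<Sum>k\<in>K'. \<integral>\<^sup>+x. ennreal ((norm (step_vec n p (v k) x - step_vec n' p' (v' k) x))\<^sup>2) \<partial>lborel)"
proof -
  let ?J = "{..<n} <+> {..<n'}"
  let ?s = "case_sum p p'" and ?t = "case_sum (\<lambda>i. p (Suc i)) (\<lambda>i. p' (Suc i))"
  let ?v = "\<lambda>k. case_sum (v k) (\<lambda>i. - v' k i)"
  have st: "0 \<le> ?s j \<and> ?s j \<le> ?t j" if "j \<in> ?J" for j
    using that partition_bounds(1)[OF p] partition_bounds(1)[OF p'] p p' by (auto simp: partition_def)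
  have "(\<integral>\<^sup>+\<omega>. ennreal ((norm (\<Sum>k\<in>K'. \<Sum>j\<in>?J. (\<beta> k (?t j) \<omega> - \<beta> k (?s j) \<omega>) *\<^sub>R ?v k j))\<^sup>2) \<partial>M)
    = (\<Sum>k\<in>K'. \<integral>\<^sup>+x. ennreal ((norm (\<Sum>j\<in>?J. indicator {?s j <.. ?t j} x *\<^sub>R ?v k j))\<^sup>2) \<partial>lborel)"
    by (rule increment_isometry[OF K' _ st]) auto
  moreover have "(\<Sum>k\<in>K'. \<Sum>j\<in>?J. (\<beta> k (?t j) \<omega> - \<beta> k (?s j) \<omega>) *\<^sub>R ?v k j)
      = step_sum \<beta> K' n p v \<omega> - step_sum \<beta> K' n' p' v' \<omega>" for \<omega>
    by (simp add: step_sum_def sum.Plus sum_negf sum_subtractf)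
  moreover have "(\<Sum>j\<in>?J. indicator {?s j <.. ?t j} x *\<^sub>R ?v k j)
      = step_vec n p (v k) x - step_vec n' p' (v' k) x" for k x
    unfolding step_vec_def by (subst sum.Plus) (simp_all add: sum_negf del: sum_indicator_scaleR)
  ultimately show ?thesis by (simp only:)
qed

text \<open>\<open>\<phi> k s\<close> stands for the integrand \<open>\<Phi> s (Q (e k))\<close>, extended by zero to \<open>k \<notin> K\<close> and \<open>s \<notin> {0..T}\<close>.
  Truncating the noise to its first \<open>N\<close> modes turns integrals of step functions into finite sums of
  independent Gaussian variables.\<close>

definition step_approximable :: "real \<Rightarrow> (nat \<Rightarrow> real \<Rightarrow> 'h::{real_inner,banach,second_countable_topology}) \<Rightarrow>
    ('w \<Rightarrow> 'h) \<Rightarrow> bool" where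
  "step_approximable T \<phi> Y \<longleftrightarrow> Y \<in> borel_measurable M \<and> (\<forall>\<epsilon>>0. \<exists>n p v. partition T n p \<and> (\<forall>k i. k \<notin> K \<longrightarrow> v k i = 0) \<and>
     (\<integral>\<^sup>+s. (\<Sum>k. ennreal ((norm (\<phi> k s - step_vec n p (v k) s))\<^sup>2)) \<partial>lborel) \<le> ennreal \<epsilon> \<and>
     (\<forall>\<^sub>F N in sequentially.
        (\<integral>\<^sup>+\<omega>. ennreal ((norm (Y \<omega> - step_sum \<beta> (K \<inter> {..<N}) n p v \<omega>))\<^sup>2) \<partial>M) \<le> ennreal \<epsilon>))"

lemma step_approximable_measurable: "step_approximable T \<phi> Y \<Longrightarrow> Y \<in> borel_measurable M"
  by (simp add: step_approximable_def)

lemma step_approximableD: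
  assumes "step_approximable T \<phi> Y" "\<epsilon> > 0"
  obtains n p v where "partition T n p" "\<forall>k i. k \<notin> K \<longrightarrow> v k i = 0"
    "(\<integral>\<^sup>+s. (\<Sum>k. ennreal ((norm (\<phi> k s - step_vec n p (v k) s))\<^sup>2)) \<partial>lborel) \<le> ennreal \<epsilon>"
    "\<forall>\<^sub>F N in sequentially.
        (\<integral>\<^sup>+\<omega>. ennreal ((norm (Y \<omega> - step_sum \<beta> (K \<inter> {..<N}) n p v \<omega>))\<^sup>2) \<partial>M) \<le> ennreal \<epsilon>"
proof -
  have "\<exists>n p v. partition T n p \<and> (\<forall>k i. k \<notin> K \<longrightarrow> v k i = 0) \<and>
     (\<integral>\<^sup>+s. (\<Sum>k. ennreal ((norm (\<phi> k s - step_vec n p (v k) s))\<^sup>2)) \<partial>lborel) \<le> ennreal \<epsilon> \<and>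
     (\<forall>\<^sub>F N in sequentially.
        (\<integral>\<^sup>+\<omega>. ennreal ((norm (Y \<omega> - step_sum \<beta> (K \<inter> {..<N}) n p v \<omega>))\<^sup>2) \<partial>M) \<le> ennreal \<epsilon>)"
    using assms unfolding step_approximable_def by blast
  then show thesis
    by (elim exE conjE, intro that) simp_all
qed

lemma sum_nn_integral_le_suminf:
  fixes f :: "nat \<Rightarrow> real \<Rightarrow> ennreal"
  assumes "\<And>k. f k \<in> borel_measurable borel" "finite K'"
  shows "(\<Sum>k\<in>K'. \<integral>\<^sup>+x. f k x \<partial>lborel) \<le> (\<integral>\<^sup>+x. (\<Sum>k. f k x) \<partial>lborel)"
proof -
  have "(\<Sum>k\<in>K'. \<integral>\<^sup>+x. f k x \<partial>lborel) = (\<integral>\<^sup>+x. (\<Sum>k\<in>K'. f k x) \<partial>lborel)"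
    using assms by (intro nn_integral_sum[symmetric]) auto
  also have "\<dots> \<le> (\<integral>\<^sup>+x. (\<Sum>k. f k x) \<partial>lborel)"
    using assms by (intro nn_integral_mono sum_le_suminf) auto
  finally show ?thesis .
qed

text \<open>Each initial state comes with its own version of the integral; this shows that all of
  them agree almost surely, so one random variable can serve every state. Two approximations of the
  same integrand are close as step functions, hence by the isometry close as integrals.\<close>

lemma step_approximable_unique:
  fixes \<phi> :: "nat \<Rightarrow> real \<Rightarrow> 'h::{real_inner,banach,second_countable_topology}"
  assumes Y: "step_approximable T \<phi> Y" and Y': "step_approximable T \<phi> Y'"
    and \<phi> [measurable]: "\<And>k. \<phi> k \<in> borel_measurable borel"
  shows "AE \<omega> in M. Y \<omega> = Y' \<omega>"
proof -
  note [measurable] = step_approximable_measurable[OF Y] step_approximable_measurable[OF Y']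
  have "(\<integral>\<^sup>+\<omega>. ennreal ((norm (Y \<omega> - Y' \<omega>))\<^sup>2) \<partial>M) \<le> 0 + ennreal \<epsilon>" if "\<epsilon> > 0" for \<epsilon>
  proof -
    \<comment> \<open>The three triangle inequalities below add up to
      \<open>2 + 2 * (2 * 4 + 2) = 22\<close> times \<open>\<delta>\<close>.\<close>
    define \<delta> where "\<delta> = \<epsilon> / 22"
    have "\<delta> > 0" using that by (simp add: \<delta>_def)
    obtain n p v where p: "partition T n p" and v: "\<forall>k i. k \<notin> K \<longrightarrow> v k i = 0"
      and D: "(\<integral>\<^sup>+s. (\<Sum>k. ennreal ((norm (\<phi> k s - step_vec n p (v k) s))\<^sup>2)) \<partial>lborel) \<le> ennreal \<delta>"
      and L: "\<forall>\<^sub>F N in sequentially.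
        (\<integral>\<^sup>+\<omega>. ennreal ((norm (Y \<omega> - step_sum \<beta> (K \<inter> {..<N}) n p v \<omega>))\<^sup>2) \<partial>M) \<le> ennreal \<delta>"
      by (rule step_approximableD[OF Y \<open>\<delta> > 0\<close>])
    obtain n' p' v' where p': "partition T n' p'" and v': "\<forall>k i. k \<notin> K \<longrightarrow> v' k i = 0"
      and D': "(\<integral>\<^sup>+s. (\<Sum>k. ennreal ((norm (\<phi> k s - step_vec n' p' (v' k) s))\<^sup>2)) \<partial>lborel) \<le> ennreal \<delta>"
      and L': "\<forall>\<^sub>F N in sequentially.
        (\<integral>\<^sup>+\<omega>. ennreal ((norm (Y' \<omega> - step_sum \<beta> (K \<inter> {..<N}) n' p' v' \<omega>))\<^sup>2) \<partial>M) \<le> ennreal \<delta>"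
      by (rule step_approximableD[OF Y' \<open>\<delta> > 0\<close>])
    \<comment> \<open>Both estimates hold for all large \<open>N\<close>, so both integrals can be
      truncated at the same level, as the isometry for differences requires.\<close>
    obtain N where N: "(\<integral>\<^sup>+\<omega>. ennreal ((norm (Y \<omega> - step_sum \<beta> (K \<inter> {..<N}) n p v \<omega>))\<^sup>2) \<partial>M) \<le> ennreal \<delta>"
      "(\<integral>\<^sup>+\<omega>. ennreal ((norm (Y' \<omega> - step_sum \<beta> (K \<inter> {..<N}) n' p' v' \<omega>))\<^sup>2) \<partial>M) \<le> ennreal \<delta>"
      using eventually_conj[OF L L'] by (auto simp: eventually_sequentially)
    let ?K = "K \<inter> {..<N}"
    let ?G = "step_sum \<beta> ?K n p v" and ?G' = "step_sum \<beta> ?K n' p' v'"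
    have [measurable]: "?G \<in> borel_measurable M" "?G' \<in> borel_measurable M"
      by (rule step_sum_measurable[OF _ p] step_sum_measurable[OF _ p'], simp)+
    let ?d = "\<lambda>k x. ennreal ((norm (\<phi> k x - step_vec n p (v k) x))\<^sup>2)"
    let ?d' = "\<lambda>k x. ennreal ((norm (\<phi> k x - step_vec n' p' (v' k) x))\<^sup>2)"
    have "(\<integral>\<^sup>+\<omega>. ennreal ((norm (?G \<omega> - ?G' \<omega>))\<^sup>2) \<partial>M)
        = (\<Sum>k\<in>?K. \<integral>\<^sup>+x. ennreal ((norm (step_vec n p (v k) x - step_vec n' p' (v' k) x))\<^sup>2) \<partial>lborel)"
      by (rule step_sum_diff_isometry[OF _ _ p p']) auto
    also have "\<dots> \<le> (\<Sum>k\<in>?K. 2 * (\<integral>\<^sup>+x. ?d' k x \<partial>lborel) + 2 * (\<integral>\<^sup>+x. ?d k x \<partial>lborel))"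
    proof (rule sum_mono)
      fix k
      show "(\<integral>\<^sup>+x. ennreal ((norm (step_vec n p (v k) x - step_vec n' p' (v' k) x))\<^sup>2) \<partial>lborel)
          \<le> 2 * (\<integral>\<^sup>+x. ?d' k x \<partial>lborel) + 2 * (\<integral>\<^sup>+x. ?d k x \<partial>lborel)"
        using nn_integral_power2_norm_add_le[of "\<lambda>x. \<phi> k x - step_vec n' p' (v' k) x" lborel "\<lambda>x. step_vec n p (v k) x - \<phi> k x"]
        by (simp add: norm_minus_commute)
    qed
    also have "\<dots> = 2 * (\<Sum>k\<in>?K. \<integral>\<^sup>+x. ?d' k x \<partial>lborel) + 2 * (\<Sum>k\<in>?K. \<integral>\<^sup>+x. ?d k x \<partial>lborel)"
      by (simp add: sum.distrib sum_distrib_left)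
    also have "\<dots> \<le> 2 * ennreal \<delta> + 2 * ennreal \<delta>"
      by (intro add_mono mult_left_mono order_trans[OF sum_nn_integral_le_suminf D] order_trans[OF sum_nn_integral_le_suminf D']) auto
    finally have GG: "(\<integral>\<^sup>+\<omega>. ennreal ((norm (?G \<omega> - ?G' \<omega>))\<^sup>2) \<partial>M) \<le> 2 * ennreal \<delta> + 2 * ennreal \<delta>" .
    have "(\<integral>\<^sup>+\<omega>. ennreal ((norm (?G \<omega> - Y' \<omega>))\<^sup>2) \<partial>M) \<le>
        2 * (\<integral>\<^sup>+\<omega>. ennreal ((norm (?G \<omega> - ?G' \<omega>))\<^sup>2) \<partial>M) + 2 * (\<integral>\<^sup>+\<omega>. ennreal ((norm (Y' \<omega> - ?G' \<omega>))\<^sup>2) \<partial>M)"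
      using nn_integral_power2_norm_add_le[of "\<lambda>\<omega>. ?G \<omega> - ?G' \<omega>" M "\<lambda>\<omega>. ?G' \<omega> - Y' \<omega>"] by (simp add: norm_minus_commute)
    also have "\<dots> \<le> 2 * (2 * ennreal \<delta> + 2 * ennreal \<delta>) + 2 * ennreal \<delta>"
      by (rule add_mono[OF mult_left_mono[OF GG] mult_left_mono[OF N(2)]]) simp_all
    finally have GY: "(\<integral>\<^sup>+\<omega>. ennreal ((norm (?G \<omega> - Y' \<omega>))\<^sup>2) \<partial>M) \<le>
      2 * (2 * ennreal \<delta> + 2 * ennreal \<delta>) + 2 * ennreal \<delta>" .
    have "(\<integral>\<^sup>+\<omega>. ennreal ((norm (Y \<omega> - Y' \<omega>))\<^sup>2) \<partial>M) \<le>
        2 * (\<integral>\<^sup>+\<omega>. ennreal ((norm (Y \<omega> - ?G \<omega>))\<^sup>2) \<partial>M) + 2 * (\<integral>\<^sup>+\<omega>. ennreal ((norm (?G \<omega> - Y' \<omega>))\<^sup>2) \<partial>M)"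
      using nn_integral_power2_norm_add_le[of "\<lambda>\<omega>. Y \<omega> - ?G \<omega>" M "\<lambda>\<omega>. ?G \<omega> - Y' \<omega>"] by simp
    also have "\<dots> \<le> 2 * ennreal \<delta> + 2 * (2 * (2 * ennreal \<delta> + 2 * ennreal \<delta>) + 2 * ennreal \<delta>)"
      by (rule add_mono[OF mult_left_mono[OF N(1)] mult_left_mono[OF GY]]) simp_all
    also have "\<dots> = ennreal \<epsilon>"
    proof -
      have "2 * ennreal x = ennreal (2 * x)" if "x \<ge> 0" for x
        using that by (simp add: ennreal_mult)
      then show ?thesis using \<open>\<delta> > 0\<close> by (simp add: \<delta>_def flip: ennreal_plus)
    qed
    finally show ?thesis by simp
  qed
  then have "(\<integral>\<^sup>+\<omega>. ennreal ((norm (Y \<omega> - Y' \<omega>))\<^sup>2) \<partial>M) \<le> 0"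
    by (rule ennreal_le_epsilon)
  then have "AE \<omega> in M. ennreal ((norm (Y \<omega> - Y' \<omega>))\<^sup>2) = 0"
    by (subst (asm) le_zero_eq, subst (asm) nn_integral_0_iff_AE) auto
  then show ?thesis by eventually_elim simp
qed

end

text \<open>If no such constant exists, there are \<open>u n\<close> with \<open>h \<bullet> u n = 1\<close> along which \<open>Y \<bullet> u n\<close> tends to zero almost
  surely; convergence to zero then separates the law of \<open>Y\<close> from that of \<open>h + Y\<close>.\<close>

lemma shift_absolutely_continuous_imp_dominated:
  fixes Y :: "'w \<Rightarrow> 'h::{real_inner,banach,second_countable_topology}"
  assumes M: "prob_space M" and Y [measurable]: "Y \<in> borel_measurable M"
    and ac: "absolutely_continuous (distr M borel Y) (distr M borel (\<lambda>\<omega>. h + Y \<omega>))"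
  obtains c where "c \<ge> 0" "\<And>z. ennreal ((h \<bullet> z)\<^sup>2) \<le> ennreal c * (\<integral>\<^sup>+\<omega>. ennreal ((Y \<omega> \<bullet> z)\<^sup>2) \<partial>M)"
proof -
  interpret prob_space M by fact
  let ?q = "\<lambda>z. \<integral>\<^sup>+\<omega>. ennreal ((Y \<omega> \<bullet> z)\<^sup>2) \<partial>M"
  have "\<exists>n::nat. \<forall>z. ennreal ((h \<bullet> z)\<^sup>2) \<le> ennreal (2 ^ n) * ?q z"
  proof (rule ccontr)
    assume "\<not> ?thesis"
    then have "\<forall>n::nat. \<exists>z. ennreal (2 ^ n) * ?q z < ennreal ((h \<bullet> z)\<^sup>2)" by (auto simp: not_le)
    then obtain z where z: "\<And>n::nat. ennreal (2 ^ n) * ?q (z n) < ennreal ((h \<bullet> z n)\<^sup>2)" by metis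
    have hz: "h \<bullet> z n \<noteq> 0" for n using z[of n] by auto
    \<comment> \<open>Normalising to \<open>h \<bullet> u n = 1\<close> keeps the shift visible,
      while the second moments of \<open>Y \<bullet> u n\<close> decay like
      \<open>(1/2) ^ n\<close>.\<close>
    define u where "u n = z n /\<^sub>R (h \<bullet> z n)" for n
    have hu: "h \<bullet> u n = 1" for n using hz by (simp add: u_def)
    have qu: "?q (u n) \<le> ennreal (1 * (1/2) ^ n)" for n
    proof -
      have Yu: "ennreal ((Y \<omega> \<bullet> z n)\<^sup>2) = ennreal ((h \<bullet> z n)\<^sup>2) * ennreal ((Y \<omega> \<bullet> u n)\<^sup>2)" for \<omega>
      proof -
        have "Y \<omega> \<bullet> z n = (h \<bullet> z n) * (Y \<omega> \<bullet> u n)" using hz[of n] by (simp add: u_def)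
        then show ?thesis by (simp only: power_mult_distrib ennreal_mult zero_le_power2)
      qed
      have "?q (z n) = ennreal ((h \<bullet> z n)\<^sup>2) * ?q (u n)"
        unfolding Yu by (rule nn_integral_cmult) measurable
      then have "ennreal (2 ^ n) * (ennreal ((h \<bullet> z n)\<^sup>2) * ?q (u n)) \<le> ennreal ((h \<bullet> z n)\<^sup>2)"
        using z[of n] by simp
      then have "ennreal ((1/2) ^ n * inverse ((h \<bullet> z n)\<^sup>2)) * (ennreal (2 ^ n) * (ennreal ((h \<bullet> z n)\<^sup>2) * ?q (u n)))
          \<le> ennreal ((1/2) ^ n * inverse ((h \<bullet> z n)\<^sup>2)) * ennreal ((h \<bullet> z n)\<^sup>2)"
        by (rule mult_left_mono) simp
      moreover have "ennreal ((1/2) ^ n * inverse ((h \<bullet> z n)\<^sup>2)) * (ennreal (2 ^ n) * (ennreal ((h \<bullet> z n)\<^sup>2) * ?q (u n)))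
          = ennreal ((1/2) ^ n * inverse ((h \<bullet> z n)\<^sup>2) * 2 ^ n * (h \<bullet> z n)\<^sup>2) * ?q (u n)"
        by (simp add: ennreal_mult mult.assoc)
      moreover have "(1/2) ^ n * inverse ((h \<bullet> z n)\<^sup>2) * 2 ^ n * (h \<bullet> z n)\<^sup>2 = 1"
        using hz[of n] by (simp add: field_simps)
      moreover have "ennreal ((1/2) ^ n * inverse ((h \<bullet> z n)\<^sup>2)) * ennreal ((h \<bullet> z n)\<^sup>2) = ennreal ((1/2) ^ n)"
        using hz[of n] by (simp add: ennreal_mult[symmetric])
      ultimately show ?thesis by simp
    qed
    \<comment> \<open>Finiteness of \<open>g\<close> is a Borel event that forces
      \<open>y \<bullet> u n\<close> to tend to 0. It has full measure for \<open>Y\<close> and, by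
      absolute continuity, for \<open>h + Y\<close>; at a common point the difference
      \<open>h \<bullet> u n = 1\<close> would tend to 0.\<close>
    define g where "g y = (\<Sum>n. ennreal ((y \<bullet> u n)\<^sup>2))" for y
    have g [measurable]: "g \<in> borel_measurable borel" unfolding g_def by measurable
    have lim: "(\<lambda>n. y \<bullet> u n) \<longlonglongrightarrow> 0" if "g y \<noteq> \<infinity>" for y
    proof -
      have "summable (\<lambda>n. (y \<bullet> u n)\<^sup>2)"
        using that unfolding g_def by (intro summable_suminf_not_top) auto
      then have "(\<lambda>n. (y \<bullet> u n)\<^sup>2) \<longlonglongrightarrow> 0" by (rule summable_LIMSEQ_zero)
      then have "(\<lambda>n. sqrt ((y \<bullet> u n)\<^sup>2)) \<longlonglongrightarrow> sqrt 0" by (intro tendsto_intros)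
      then show ?thesis by (simp add: tendsto_rabs_zero_iff)
    qed
    have "(\<integral>\<^sup>+\<omega>. g (Y \<omega>) \<partial>M) = (\<Sum>n. ?q (u n))"
      unfolding g_def by (rule nn_integral_suminf) measurable
    also have "\<dots> \<le> (\<Sum>n. ennreal (1 * (1/2) ^ n))" by (intro suminf_le qu) auto
    also have "\<dots> = ennreal (\<Sum>n. 1 * (1/2) ^ n)"
      by (intro suminf_ennreal2 summable_mult summable_geometric) auto
    finally have "(\<integral>\<^sup>+\<omega>. g (Y \<omega>) \<partial>M) \<noteq> \<infinity>" by (auto simp: top_unique)
    then have ae: "AE \<omega> in M. g (Y \<omega>) \<noteq> \<infinity>" by (intro nn_integral_PInf_AE) auto
    then have "AE y in distr M borel Y. g y \<noteq> \<infinity>" by (subst AE_distr_iff) auto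
    then have "{y. g y = \<infinity>} \<in> null_sets (distr M borel Y)"
      by (auto simp: AE_iff_null)
    then have "{y. g y = \<infinity>} \<in> null_sets (distr M borel (\<lambda>\<omega>. h + Y \<omega>))"
      using ac by (auto simp: absolutely_continuous_def)
    then have "AE y in distr M borel (\<lambda>\<omega>. h + Y \<omega>). g y \<noteq> \<infinity>"
      by (auto simp: AE_iff_null)
    then have "AE \<omega> in M. g (h + Y \<omega>) \<noteq> \<infinity>" by (subst (asm) AE_distr_iff) auto
    with ae have "AE \<omega> in M. False"
    proof eventually_elim
      case (elim \<omega>)
      from tendsto_diff[OF lim[OF elim(2)] lim[OF elim(1)]]
      have "(\<lambda>n. 1 :: real) \<longlonglongrightarrow> 0" by (simp add: inner_add_left hu)
      then show False by (simp add: LIMSEQ_const_iff)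
    qed
    then show False by simp
  qed
  then obtain n where "\<And>z. ennreal ((h \<bullet> z)\<^sup>2) \<le> ennreal (2 ^ n) * ?q z" by blast
  then show thesis by (intro that[of "2 ^ n"]) auto
qed

context brownian_noise
begin

text \<open>The Ito isometry up to a constant, which is all that is needed: each of the two passages to the limit
  costs a factor 2 from \<open>(a + b)\<^sup>2 \<le> 2 a\<^sup>2 + 2 b\<^sup>2\<close>.\<close>

lemma step_approximable_second_moment:
  fixes \<phi> :: "nat \<Rightarrow> real \<Rightarrow> 'h::{real_inner,banach,second_countable_topology}"
  assumes Y: "step_approximable T \<phi> Y" and \<phi> [measurable]: "\<And>k. \<phi> k \<in> borel_measurable borel"
  shows "(\<integral>\<^sup>+\<omega>. ennreal ((Y \<omega> \<bullet> z)\<^sup>2) \<partial>M) \<le> 4 * (\<integral>\<^sup>+s. (\<Sum>k. ennreal ((\<phi> k s \<bullet> z)\<^sup>2)) \<partial>lborel)" (is "?q \<le> 4 * ?I")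
    and "(\<integral>\<^sup>+s. (\<Sum>k. ennreal ((\<phi> k s \<bullet> z)\<^sup>2)) \<partial>lborel) \<le> 4 * (\<integral>\<^sup>+\<omega>. ennreal ((Y \<omega> \<bullet> z)\<^sup>2) \<partial>M)"
proof -
  note [measurable] = step_approximable_measurable[OF Y]
  let ?c = "ennreal (2 * (norm z)\<^sup>2)"
  have "?q \<le> 4 * ?I + ennreal \<epsilon> \<and> ?I \<le> 4 * ?q + ennreal \<epsilon>" if "\<epsilon> > 0" for \<epsilon>
  proof -
    \<comment> \<open>Each direction passes to the limit twice, with total error
      \<open>6 * (norm z)^2 * \<delta>\<close>; the added 1 covers \<open>z = 0\<close>.\<close>
    define \<delta> where "\<delta> = \<epsilon> / (6 * (norm z)\<^sup>2 + 1)"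
    have \<delta>: "\<delta> > 0" "6 * (norm z)\<^sup>2 * \<delta> \<le> \<epsilon>"
    proof -
      have pos: "6 * (norm z)\<^sup>2 + 1 > 0" by (intro add_nonneg_pos) auto
      then show "\<delta> > 0" using that by (simp add: \<delta>_def)
      have "6 * (norm z)\<^sup>2 * \<delta> \<le> (6 * (norm z)\<^sup>2 + 1) * \<delta>" using \<open>\<delta> > 0\<close> by simp
      also have "\<dots> = \<epsilon>" using pos by (simp add: \<delta>_def)
      finally show "6 * (norm z)\<^sup>2 * \<delta> \<le> \<epsilon>" .
    qed
    have c\<delta>: "2 * (?c * ennreal \<delta>) + ?c * ennreal \<delta> \<le> ennreal \<epsilon>"
    proof -
      have "2 * (?c * ennreal \<delta>) + ?c * ennreal \<delta> = ennreal (6 * (norm z)\<^sup>2 * \<delta>)"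
      proof -
        have "2 * ennreal x = ennreal (2 * x)" if "x \<ge> 0" for x
          using that by (simp add: ennreal_mult)
        then show ?thesis using \<delta>(1) by (simp flip: ennreal_plus ennreal_mult)
      qed
      then show ?thesis using \<delta>(2) by (simp add: ennreal_leI)
    qed
    obtain n p v where p: "partition T n p" and v: "\<forall>k i. k \<notin> K \<longrightarrow> v k i = 0"
      and D: "(\<integral>\<^sup>+s. (\<Sum>k. ennreal ((norm (\<phi> k s - step_vec n p (v k) s))\<^sup>2)) \<partial>lborel) \<le> ennreal \<delta>"
      and L: "\<forall>\<^sub>F N in sequentially.
        (\<integral>\<^sup>+\<omega>. ennreal ((norm (Y \<omega> - step_sum \<beta> (K \<inter> {..<N}) n p v \<omega>))\<^sup>2) \<partial>M) \<le> ennreal \<delta>"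
      by (rule step_approximableD[OF Y \<delta>(1)])
    from L obtain N0 where N0: "\<And>N. N \<ge> N0 \<Longrightarrow>
        (\<integral>\<^sup>+\<omega>. ennreal ((norm (Y \<omega> - step_sum \<beta> (K \<inter> {..<N}) n p v \<omega>))\<^sup>2) \<partial>M) \<le> ennreal \<delta>"
      by (auto simp: eventually_sequentially)
    let ?\<psi> = "\<lambda>k. step_vec n p (v k)" and ?G = "\<lambda>N. step_sum \<beta> (K \<inter> {..<N}) n p v"
    have [measurable]: "?G N \<in> borel_measurable M" for N
      by (rule step_sum_measurable[OF _ p]) simp
    have \<psi>0: "?\<psi> k s = 0" if "k \<notin> K" for k s using v that by (simp add: step_vec_def)
    have isometry: "(\<integral>\<^sup>+\<omega>. ennreal ((?G N \<omega> \<bullet> z)\<^sup>2) \<partial>M) = (\<Sum>k<N. \<integral>\<^sup>+s. ennreal ((?\<psi> k s \<bullet> z)\<^sup>2) \<partial>lborel)" for N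
    proof -
      have "(\<integral>\<^sup>+\<omega>. ennreal ((?G N \<omega> \<bullet> z)\<^sup>2) \<partial>M) = (\<Sum>k\<in>K \<inter> {..<N}. \<integral>\<^sup>+s. ennreal ((?\<psi> k s \<bullet> z)\<^sup>2) \<partial>lborel)"
        using step_sum_isometry[OF _ _ p, of "K \<inter> {..<N}" "\<lambda>k i. v k i \<bullet> z"]
        by (simp add: step_sum_inner step_vec_inner)
      also have "\<dots> = (\<Sum>k<N. \<integral>\<^sup>+s. ennreal ((?\<psi> k s \<bullet> z)\<^sup>2) \<partial>lborel)"
      proof (rule sum.mono_neutral_left)
        show "\<forall>k\<in>{..<N} - K \<inter> {..<N}. (\<integral>\<^sup>+s. ennreal ((?\<psi> k s \<bullet> z)\<^sup>2) \<partial>lborel) = 0"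
        proof
          fix k assume "k \<in> {..<N} - K \<inter> {..<N}"
          then have "k \<notin> K" by blast
          then show "(\<integral>\<^sup>+s. ennreal ((?\<psi> k s \<bullet> z)\<^sup>2) \<partial>lborel) = 0" by (simp add: \<psi>0)
        qed
      qed auto
      finally show ?thesis .
    qed
    have \<psi>_sum: "(\<Sum>k<N. \<integral>\<^sup>+s. ennreal ((?\<psi> k s \<bullet> z)\<^sup>2) \<partial>lborel) \<le> 2 * ?I + ?c * ennreal \<delta>" for N
    proof -
      have "(\<Sum>k<N. \<integral>\<^sup>+s. ennreal ((?\<psi> k s \<bullet> z)\<^sup>2) \<partial>lborel) \<le>
          (\<Sum>k<N. \<integral>\<^sup>+s. 2 * ennreal ((\<phi> k s \<bullet> z)\<^sup>2) + ?c * ennreal ((norm (?\<psi> k s - \<phi> k s))\<^sup>2) \<partial>lborel)"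
        by (intro sum_mono nn_integral_mono ennreal_power2_inner_le)
      also have "\<dots> = 2 * (\<Sum>k<N. \<integral>\<^sup>+s. ennreal ((\<phi> k s \<bullet> z)\<^sup>2) \<partial>lborel) +
          ?c * (\<Sum>k<N. \<integral>\<^sup>+s. ennreal ((norm (\<phi> k s - ?\<psi> k s))\<^sup>2) \<partial>lborel)"
        by (simp add: nn_integral_add nn_integral_cmult sum.distrib sum_distrib_left norm_minus_commute)
      also have "\<dots> \<le> 2 * ?I + ?c * ennreal \<delta>"
        by (intro add_mono mult_left_mono order_trans[OF sum_nn_integral_le_suminf D] sum_nn_integral_le_suminf) auto
      finally show ?thesis .
    qed
    have q: "?q \<le> 4 * ?I + ennreal \<epsilon>"
    proof -
      have "?q \<le> (\<integral>\<^sup>+\<omega>. 2 * ennreal ((?G N0 \<omega> \<bullet> z)\<^sup>2) + ?c * ennreal ((norm (Y \<omega> - ?G N0 \<omega>))\<^sup>2) \<partial>M)"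
        by (intro nn_integral_mono ennreal_power2_inner_le)
      also have "\<dots> = 2 * (\<integral>\<^sup>+\<omega>. ennreal ((?G N0 \<omega> \<bullet> z)\<^sup>2) \<partial>M) + ?c * (\<integral>\<^sup>+\<omega>. ennreal ((norm (Y \<omega> - ?G N0 \<omega>))\<^sup>2) \<partial>M)"
        by (simp add: nn_integral_add nn_integral_cmult)
      also have "\<dots> \<le> 2 * (2 * ?I + ?c * ennreal \<delta>) + ?c * ennreal \<delta>"
        unfolding isometry by (rule add_mono[OF mult_left_mono[OF \<psi>_sum] mult_left_mono[OF N0]]) auto
      also have "\<dots> = 4 * ?I + (2 * (?c * ennreal \<delta>) + ?c * ennreal \<delta>)"
        by (simp add: distrib_left mult.assoc[symmetric] add.assoc)
      also have "\<dots> \<le> 4 * ?I + ennreal \<epsilon>" by (intro add_left_mono c\<delta>)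
      finally show ?thesis .
    qed
    have G_le: "(\<Sum>k<N. \<integral>\<^sup>+s. ennreal ((?\<psi> k s \<bullet> z)\<^sup>2) \<partial>lborel) \<le> 2 * ?q + ?c * ennreal \<delta>" for N
    proof -
      \<comment> \<open>The partial sums increase with the truncation level, so it may be raised to
        one at which the approximation of \<open>Y\<close> is valid.\<close>
      let ?N = "max N N0"
      have "(\<Sum>k<N. \<integral>\<^sup>+s. ennreal ((?\<psi> k s \<bullet> z)\<^sup>2) \<partial>lborel) \<le> (\<Sum>k<?N. \<integral>\<^sup>+s. ennreal ((?\<psi> k s \<bullet> z)\<^sup>2) \<partial>lborel)"
        by (intro sum_mono2) auto
      also have "\<dots> = (\<integral>\<^sup>+\<omega>. ennreal ((?G ?N \<omega> \<bullet> z)\<^sup>2) \<partial>M)" by (simp only: isometry)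
      also have "\<dots> \<le> (\<integral>\<^sup>+\<omega>. 2 * ennreal ((Y \<omega> \<bullet> z)\<^sup>2) + ?c * ennreal ((norm (?G ?N \<omega> - Y \<omega>))\<^sup>2) \<partial>M)"
        by (intro nn_integral_mono ennreal_power2_inner_le)
      also have "\<dots> = 2 * ?q + ?c * (\<integral>\<^sup>+\<omega>. ennreal ((norm (Y \<omega> - ?G ?N \<omega>))\<^sup>2) \<partial>M)"
        by (simp add: nn_integral_add nn_integral_cmult norm_minus_commute)
      also have "\<dots> \<le> 2 * ?q + ?c * ennreal \<delta>"
        by (intro add_left_mono mult_left_mono N0) auto
      finally show ?thesis .
    qed
    have "(\<integral>\<^sup>+s. (\<Sum>k. ennreal ((?\<psi> k s \<bullet> z)\<^sup>2)) \<partial>lborel) = (\<Sum>k. \<integral>\<^sup>+s. ennreal ((?\<psi> k s \<bullet> z)\<^sup>2) \<partial>lborel)"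
      by (intro nn_integral_suminf) measurable
    also have "\<dots> \<le> 2 * ?q + ?c * ennreal \<delta>"
      by (rule suminf_le_const) (auto intro: G_le)
    finally have \<psi>_int: "(\<integral>\<^sup>+s. (\<Sum>k. ennreal ((?\<psi> k s \<bullet> z)\<^sup>2)) \<partial>lborel) \<le> 2 * ?q + ?c * ennreal \<delta>" .
    have "?I \<le> (\<integral>\<^sup>+s. (\<Sum>k. 2 * ennreal ((?\<psi> k s \<bullet> z)\<^sup>2) + ?c * ennreal ((norm (\<phi> k s - ?\<psi> k s))\<^sup>2)) \<partial>lborel)"
      by (intro nn_integral_mono suminf_le ennreal_power2_inner_le) auto
    also have "\<dots> = 2 * (\<integral>\<^sup>+s. (\<Sum>k. ennreal ((?\<psi> k s \<bullet> z)\<^sup>2)) \<partial>lborel) +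
        ?c * (\<integral>\<^sup>+s. (\<Sum>k. ennreal ((norm (\<phi> k s - ?\<psi> k s))\<^sup>2)) \<partial>lborel)"
      by (simp add: suminf_add[symmetric] nn_integral_add nn_integral_cmult)
    also have "\<dots> \<le> 2 * (2 * ?q + ?c * ennreal \<delta>) + ?c * ennreal \<delta>"
      by (rule add_mono[OF mult_left_mono[OF \<psi>_int] mult_left_mono[OF D]]) auto
    also have "\<dots> = 4 * ?q + (2 * (?c * ennreal \<delta>) + ?c * ennreal \<delta>)"
      by (simp add: distrib_left mult.assoc[symmetric] add.assoc)
    also have "\<dots> \<le> 4 * ?q + ennreal \<epsilon>" by (intro add_left_mono c\<delta>)
    finally show ?thesis using q by blast
  qed
  then show "?q \<le> 4 * ?I" "?I \<le> 4 * ?q" by (auto intro: ennreal_le_epsilon)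
qed

text \<open>Each increment is divided by its standard deviation, which is moved into the vector.
  Intervals of length zero contribute nothing and are dropped before dividing.\<close>

lemma step_sum_std_normal:
  assumes p: "partition T n p"
  shows "step_sum \<beta> K' n p v \<omega> =
    (\<Sum>j\<in>K' \<times> {i. i < n \<and> p i < p (Suc i)}.
      (case j of (k, i) \<Rightarrow> \<lambda>\<omega>. (\<beta> k (p (Suc i)) \<omega> - \<beta> k (p i) \<omega>) / sqrt (p (Suc i) - p i)) \<omega>
        *\<^sub>R (case j of (k, i) \<Rightarrow> sqrt (p (Suc i) - p i) *\<^sub>R v k i))"
proof -
  have "(\<Sum>i<n. (\<beta> k (p (Suc i)) \<omega> - \<beta> k (p i) \<omega>) *\<^sub>R v k i) =
      (\<Sum>i | i < n \<and> p i < p (Suc i). ((\<beta> k (p (Suc i)) \<omega> - \<beta> k (p i) \<omega>) / sqrt (p (Suc i) - p i)) *\<^sub>R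
        (sqrt (p (Suc i) - p i) *\<^sub>R v k i))" for k
  proof (rule sum.mono_neutral_cong_right)
    show "\<forall>i\<in>{..<n} - {i. i < n \<and> p i < p (Suc i)}. (\<beta> k (p (Suc i)) \<omega> - \<beta> k (p i) \<omega>) *\<^sub>R v k i = 0"
    proof
      fix i assume "i \<in> {..<n} - {i. i < n \<and> p i < p (Suc i)}"
      then have "p i = p (Suc i)" using p unfolding partition_def by (metis DiffD1 DiffD2 lessThan_iff mem_Collect_eq order_le_less)
      then show "(\<beta> k (p (Suc i)) \<omega> - \<beta> k (p i) \<omega>) *\<^sub>R v k i = 0" by simp
    qed
  qed auto
  then show ?thesis
    unfolding step_sum_def by (simp only: sum.cartesian_product) (intro sum.cong refl; auto)
qed

text \<open>Accuracy \<open>(1/2) ^ m\<close> for the \<open>m\<close>-th approximation gives the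
  geometric rate asked for by the Gaussian limit lemma; the factor 4 in \<open>c * 4\<close> comes
  from the isometry up to a constant.\<close>

lemma step_approximable_shift_absolutely_continuous:
  fixes \<phi> :: "nat \<Rightarrow> real \<Rightarrow> 'h::{real_inner,banach,second_countable_topology}"
  assumes Y: "step_approximable T \<phi> Y" and \<phi>: "\<And>k. \<phi> k \<in> borel_measurable borel"
    and "c \<ge> 0" and h: "\<And>z. ennreal ((h \<bullet> z)\<^sup>2) \<le> ennreal c * (\<integral>\<^sup>+s. (\<Sum>k. ennreal ((\<phi> k s \<bullet> z)\<^sup>2)) \<partial>lborel)"
  shows "absolutely_continuous (distr M borel (\<lambda>\<omega>. u + Y \<omega>)) (distr M borel (\<lambda>\<omega>. u + h + Y \<omega>))"
proof -
  have "\<exists>J \<xi> (w :: nat \<times> nat \<Rightarrow> 'h). std_normal_family M J \<xi> \<and>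
      (\<integral>\<^sup>+\<omega>. ennreal ((norm (Y \<omega> - (\<Sum>j\<in>J. \<xi> j \<omega> *\<^sub>R w j)))\<^sup>2) \<partial>M) \<le> ennreal ((1/2) ^ m)" for m :: nat
  proof -
    have pos: "(1/2 :: real) ^ m > 0" by simp
    obtain n p v where p: "partition T n p" and "\<forall>k i. k \<notin> K \<longrightarrow> v k i = 0"
      and "(\<integral>\<^sup>+s. (\<Sum>k. ennreal ((norm (\<phi> k s - step_vec n p (v k) s))\<^sup>2)) \<partial>lborel) \<le> ennreal ((1/2) ^ m)"
      and L: "\<forall>\<^sub>F N in sequentially.
        (\<integral>\<^sup>+\<omega>. ennreal ((norm (Y \<omega> - step_sum \<beta> (K \<inter> {..<N}) n p v \<omega>))\<^sup>2) \<partial>M) \<le> ennreal ((1/2) ^ m)"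
      by (rule step_approximableD[OF Y pos])
    from L obtain N where N: "(\<integral>\<^sup>+\<omega>. ennreal ((norm (Y \<omega> - step_sum \<beta> (K \<inter> {..<N}) n p v \<omega>))\<^sup>2) \<partial>M) \<le> ennreal ((1/2) ^ m)"
      by (auto simp: eventually_sequentially)
    let ?J = "(K \<inter> {..<N}) \<times> {i. i < n \<and> p i < p (Suc i)}"
    let ?\<xi> = "\<lambda>(k, i) \<omega>. (\<beta> k (p (Suc i)) \<omega> - \<beta> k (p i) \<omega>) / sqrt (p (Suc i) - p i)"
    have "std_normal_family M ?J ?\<xi>"
      by (rule increments_std_normal_family) (use p in \<open>auto simp: partition_def\<close>)
    then show ?thesis
      by (intro exI[of _ ?J] exI[of _ ?\<xi>] exI[of _ "\<lambda>(k, i). sqrt (p (Suc i) - p i) *\<^sub>R v k i"] conjI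
          N[unfolded step_sum_std_normal[OF p]])
  qed
  then have "\<forall>m :: nat. \<exists>J \<xi> (w :: nat \<times> nat \<Rightarrow> 'h). std_normal_family M J \<xi> \<and>
      (\<integral>\<^sup>+\<omega>. ennreal ((norm (Y \<omega> - (\<Sum>j\<in>J. \<xi> j \<omega> *\<^sub>R w j)))\<^sup>2) \<partial>M) \<le> ennreal ((1/2) ^ m)" by (rule allI)
  then obtain J \<xi> and w :: "nat \<Rightarrow> nat \<times> nat \<Rightarrow> 'h" where rep:
    "\<forall>m. std_normal_family M (J m) (\<xi> m) \<and>
    (\<integral>\<^sup>+\<omega>. ennreal ((norm (Y \<omega> - (\<Sum>j\<in>J m. \<xi> m j \<omega> *\<^sub>R w m j)))\<^sup>2) \<partial>M) \<le> ennreal ((1/2) ^ m)"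
    unfolding choice_iff by (elim exE)
  have "\<And>m. std_normal_family M (J m) (\<xi> m)"
    "\<And>m. (\<integral>\<^sup>+\<omega>. ennreal ((norm (Y \<omega> - (\<Sum>j\<in>J m. \<xi> m j \<omega> *\<^sub>R w m j)))\<^sup>2) \<partial>M) \<le> ennreal ((1/2) ^ m)"
    using rep[THEN spec] by (rule conjunct1, rule conjunct2)
  then show ?thesis
  proof (rule gaussian_limit_shift_absolutely_continuous[OF prob_space_axioms step_approximable_measurable[OF Y]])
    show "0 \<le> c * 4" using \<open>c \<ge> 0\<close> by simp
    fix z
    have "ennreal ((h \<bullet> z)\<^sup>2) \<le> ennreal c * (4 * (\<integral>\<^sup>+\<omega>. ennreal ((Y \<omega> \<bullet> z)\<^sup>2) \<partial>M))"
      by (rule order_trans[OF h mult_left_mono[OF step_approximable_second_moment(2)[OF Y \<phi>]]]) simp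
    then show "ennreal ((h \<bullet> z)\<^sup>2) \<le> ennreal (c * 4) * (\<integral>\<^sup>+\<omega>. ennreal ((Y \<omega> \<bullet> z)\<^sup>2) \<partial>M)"
      using \<open>c \<ge> 0\<close> by (simp add: ennreal_mult mult.assoc)
  qed
qed

end

lemma has_sum_nat_LIMSEQ:
  fixes f :: "nat \<Rightarrow> 'a::{comm_monoid_add, topological_space}"
  assumes "(f has_sum S) K"
  shows "(\<lambda>N. \<Sum>k\<in>K \<inter> {..<N}. f k) \<longlonglongrightarrow> S"
proof -
  have "(f has_sum S) K \<longleftrightarrow> ((\<lambda>k. if k \<in> K then f k else 0) has_sum S) UNIV"
    by (rule has_sum_cong_neutral) auto
  with assms have "((\<lambda>k. if k \<in> K then f k else 0) has_sum S) UNIV" by blast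
  from has_sum_imp_sums[OF this]
  have "(\<lambda>N. \<Sum>k<N. if k \<in> K then f k else 0) \<longlonglongrightarrow> S" by (simp add: sums_def)
  then show ?thesis by (simp add: sum.inter_restrict[symmetric] Int_commute)
qed

lemma infsum_ennreal_nat:
  fixes f :: "nat \<Rightarrow> ennreal"
  shows "infsum f K = (\<Sum>k. if k \<in> K then f k else 0)"
proof -
  have "(f has_sum infsum f K) K"
    by (intro has_sum_infsum nonneg_summable_on_complete) simp
  moreover have "(f has_sum infsum f K) K \<longleftrightarrow> ((\<lambda>k. if k \<in> K then f k else 0) has_sum infsum f K) UNIV"
    by (rule has_sum_cong_neutral) auto
  ultimately have "((\<lambda>k. if k \<in> K then f k else 0) has_sum infsum f K) UNIV" by blast
  from has_sum_imp_sums[OF this] show ?thesis by (rule sums_unique)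
qed

section \<open>Truncating the Wiener process and its integrals to finitely many modes\<close>

context brownian_noise
begin

context
  fixes e :: "nat \<Rightarrow> 'l::{real_inner,banach,second_countable_topology}" and \<gamma> :: "nat \<Rightarrow> real"
    and W :: "real \<Rightarrow> 'w \<Rightarrow> 'l" and Q :: "'l \<Rightarrow> 'l"
  assumes W: "wiener_process M F K e \<gamma> \<beta> W" and Q: "noise_covariance Q K e \<gamma>"
begin

lemma W_measurable: "t \<ge> 0 \<Longrightarrow> W t \<in> borel_measurable M"
  using W measurable_from_subalg[OF F_subalgebra] by (auto simp: wiener_process_def)

lemma Q_basis: "k \<in> K \<Longrightarrow> Q (e k) = \<gamma> k *\<^sub>R e k"
  using Q by (auto simp: noise_covariance_def)

lemma norm_basis: "k \<in> K \<Longrightarrow> norm (e k) = 1"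
  using Q by (auto simp: noise_covariance_def orthonormal_basis_def norm_eq_sqrt_inner)

lemma W_partial_sums:
  assumes "0 \<le> s" "0 \<le> t"
  shows "AE \<omega> in M. (\<lambda>N. \<Sum>k\<in>K \<inter> {..<N}. (\<gamma> k * (\<beta> k t \<omega> - \<beta> k s \<omega>)) *\<^sub>R e k) \<longlonglongrightarrow> W t \<omega> - W s \<omega>"
proof -
  have "AE \<omega> in M. ((\<lambda>k. (\<gamma> k * \<beta> k r \<omega>) *\<^sub>R e k) has_sum W r \<omega>) K" if "0 \<le> r" for r
    using W that by (auto simp: wiener_process_def)
  from this[OF assms(2)] this[OF assms(1)] show ?thesis
  proof eventually_elim
    case (elim \<omega>)
    from tendsto_diff[OF has_sum_nat_LIMSEQ[OF elim(1)] has_sum_nat_LIMSEQ[OF elim(2)]]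
    show ?case by (simp add: sum_subtractf[symmetric] right_diff_distrib scaleR_diff_left)
  qed
qed

abbreviation eigenvalue_tail :: "nat \<Rightarrow> real" where
  "eigenvalue_tail N \<equiv> \<Sum>k. (if k + N \<in> K then (\<gamma> (k + N))\<^sup>2 else 0)"

text \<open>The series for \<open>W\<close> is known to converge almost surely, not in mean square.
  Finite blocks of modes have second moments given by the isometry, and Fatou's lemma carries the
  bound to the whole tail.\<close>

lemma W_increment_tail:
  assumes st: "0 \<le> s" "s \<le> t"
  shows "(\<integral>\<^sup>+\<omega>. ennreal ((norm (W t \<omega> - W s \<omega> - (\<Sum>k\<in>K \<inter> {..<N}. (\<gamma> k * (\<beta> k t \<omega> - \<beta> k s \<omega>)) *\<^sub>R e k)))\<^sup>2) \<partial>M)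
    \<le> ennreal ((t - s) * eigenvalue_tail N)"
proof -
  define g where "g k = (if k \<in> K then (\<gamma> k)\<^sup>2 else 0)" for k
  have summable_g: "summable (\<lambda>k. g (k + N))"
    using trace_class_eigenvalues_square_summable[OF Q] unfolding g_def by (rule summable_ignore_initial_segment)
  define D where "D N \<omega> = (\<Sum>k\<in>K \<inter> {..<N}. (\<gamma> k * (\<beta> k t \<omega> - \<beta> k s \<omega>)) *\<^sub>R e k)" for N \<omega>
  have [measurable]: "D N \<in> borel_measurable M" for N
    unfolding D_def
    by (intro borel_measurable_sum borel_measurable_scaleR borel_measurable_times borel_measurable_diff borel_measurable_const)
       (use st in \<open>auto intro!: \<beta>_measurable\<close>)
  note [measurable] = W_measurable
  define u where "u m \<omega> = ennreal ((norm (D (N + m) \<omega> - D N \<omega>))\<^sup>2)" for m \<omega>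
  have [measurable]: "u m \<in> borel_measurable M" for m unfolding u_def by measurable
  have u_le: "(\<integral>\<^sup>+\<omega>. u m \<omega> \<partial>M) \<le> ennreal ((t - s) * eigenvalue_tail N)" for m
  proof -
    let ?K = "K \<inter> {N..<N + m}"
    have "D (N + m) \<omega> - D N \<omega> = (\<Sum>k\<in>?K. (\<gamma> k * (\<beta> k t \<omega> - \<beta> k s \<omega>)) *\<^sub>R e k)" for \<omega>
    proof -
      have "K \<inter> {..<N + m} = (K \<inter> {..<N}) \<union> ?K" by auto
      then have "D (N + m) \<omega> = (\<Sum>k\<in>(K \<inter> {..<N}) \<union> ?K. (\<gamma> k * (\<beta> k t \<omega> - \<beta> k s \<omega>)) *\<^sub>R e k)"
        by (simp only: D_def)
      also have "\<dots> = D N \<omega> + (\<Sum>k\<in>?K. (\<gamma> k * (\<beta> k t \<omega> - \<beta> k s \<omega>)) *\<^sub>R e k)"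
        unfolding D_def by (rule sum.union_disjoint) auto
      finally show ?thesis by simp
    qed
    \<comment> \<open>The one-point index set \<open>{0}\<close> puts a single increment into the
      form of \<open>increment_isometry\<close>.\<close>
    then have "(\<integral>\<^sup>+\<omega>. u m \<omega> \<partial>M) =
        (\<integral>\<^sup>+\<omega>. ennreal ((norm (\<Sum>k\<in>?K. \<Sum>j\<in>{0::nat}. (\<beta> k t \<omega> - \<beta> k s \<omega>) *\<^sub>R (\<gamma> k *\<^sub>R e k)))\<^sup>2) \<partial>M)"
      by (simp add: u_def mult.commute)
    also have "\<dots> = (\<Sum>k\<in>?K. \<integral>\<^sup>+x. ennreal ((norm (\<Sum>j\<in>{0::nat}. indicator {s <.. t} x *\<^sub>R (\<gamma> k *\<^sub>R e k)))\<^sup>2) \<partial>lborel)"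
      using st by (intro increment_isometry) auto
    also have "\<dots> = (\<Sum>k\<in>?K. ennreal ((t - s) * g k))"
    proof (intro sum.cong refl)
      fix k assume "k \<in> ?K"
      then have k: "k \<in> K" by simp
      have "(\<integral>\<^sup>+x. ennreal ((norm (\<Sum>j\<in>{0::nat}. indicator {s <.. t} x *\<^sub>R (\<gamma> k *\<^sub>R e k)))\<^sup>2) \<partial>lborel)
          = (\<integral>\<^sup>+x. ennreal (g k) * indicator {s <.. t} x \<partial>lborel)"
        using k by (intro nn_integral_cong) (auto simp: g_def norm_basis indicator_def)
      also have "\<dots> = ennreal (g k) * ennreal (t - s)"
        using st by (subst nn_integral_cmult_indicator) auto
      also have "\<dots> = ennreal ((t - s) * g k)"
        using st by (simp add: g_def mult.commute flip: ennreal_mult)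
      finally show "(\<integral>\<^sup>+x. ennreal ((norm (\<Sum>j\<in>{0::nat}. indicator {s <.. t} x *\<^sub>R (\<gamma> k *\<^sub>R e k)))\<^sup>2) \<partial>lborel)
          = ennreal ((t - s) * g k)" .
    qed
    also have "\<dots> = ennreal ((t - s) * (\<Sum>k\<in>?K. g k))"
      using st by (subst sum_ennreal) (auto simp: g_def sum_distrib_left)
    also have "(\<Sum>k\<in>?K. g k) = (\<Sum>k\<in>{N..<N + m}. g k)"
      by (intro sum.mono_neutral_left) (auto simp: g_def)
    also have "\<dots> = (\<Sum>i<m. g (i + N))"
      using sum.shift_bounds_nat_ivl[of g 0 N m] by (simp add: add.commute atLeast0LessThan)
    also have "ennreal ((t - s) * (\<Sum>i<m. g (i + N))) \<le> ennreal ((t - s) * (\<Sum>i. g (i + N)))"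
      using st summable_g by (intro ennreal_leI mult_left_mono sum_le_suminf) (auto simp: g_def)
    finally show ?thesis by (simp add: g_def)
  qed
  have "AE \<omega> in M. liminf (\<lambda>m. u m \<omega>) = ennreal ((norm (W t \<omega> - W s \<omega> - D N \<omega>))\<^sup>2)"
    using W_partial_sums[OF st(1) order_trans[OF st]]
  proof eventually_elim
    case (elim \<omega>)
    then have "(\<lambda>m. D (N + m) \<omega>) \<longlonglongrightarrow> W t \<omega> - W s \<omega>"
      using LIMSEQ_ignore_initial_segment[of "\<lambda>m. D m \<omega>" _ N] by (simp add: D_def add.commute)
    then have "(\<lambda>m. u m \<omega>) \<longlonglongrightarrow> ennreal ((norm (W t \<omega> - W s \<omega> - D N \<omega>))\<^sup>2)"
      unfolding u_def by (intro tendsto_ennrealI tendsto_intros)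
    then show ?case by (intro lim_imp_Liminf) auto
  qed
  then have "(\<integral>\<^sup>+\<omega>. ennreal ((norm (W t \<omega> - W s \<omega> - D N \<omega>))\<^sup>2) \<partial>M) = (\<integral>\<^sup>+\<omega>. liminf (\<lambda>m. u m \<omega>) \<partial>M)"
    by (intro nn_integral_cong_AE) auto
  also have "\<dots> \<le> liminf (\<lambda>m. \<integral>\<^sup>+\<omega>. u m \<omega> \<partial>M)" by (rule nn_integral_liminf) measurable
  also have "\<dots> \<le> limsup (\<lambda>m. \<integral>\<^sup>+\<omega>. u m \<omega> \<partial>M)" by (intro Liminf_le_Limsup) auto
  also have "\<dots> \<le> ennreal ((t - s) * eigenvalue_tail N)" by (intro Limsup_bounded always_eventually allI u_le)
  finally show ?thesis by (simp add: D_def)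
qed

text \<open>A fixed step function involves finitely many bounded operators, so its truncation error
  is at most a constant times the tail of the squared eigenvalues. The factor \<open>n\<close> in
  that constant is the Cauchy-Schwarz loss in bounding a sum of \<open>n\<close> terms.\<close>

lemma step_integral_truncation:
  fixes \<Psi> :: "nat \<Rightarrow> 'l \<Rightarrow> 'h::{real_inner,banach,second_countable_topology}"
  assumes p: "partition T n p" and \<Psi>: "\<And>i. i < n \<Longrightarrow> bounded_linear (\<Psi> i)" and "\<epsilon> > 0"
  defines "v \<equiv> \<lambda>k i. if k \<in> K then \<gamma> k *\<^sub>R \<Psi> i (e k) else 0"
  shows "\<forall>\<^sub>F N in sequentially. (\<integral>\<^sup>+\<omega>. ennreal ((norm (step_integral n p \<Psi> W \<omega> - step_sum \<beta> (K \<inter> {..<N}) n p v \<omega>))\<^sup>2) \<partial>M) \<le> ennreal \<epsilon>"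
proof -
  define D where "D N i \<omega> = W (p (Suc i)) \<omega> - W (p i) \<omega> - (\<Sum>k\<in>K \<inter> {..<N}. (\<gamma> k * (\<beta> k (p (Suc i)) \<omega> - \<beta> k (p i) \<omega>)) *\<^sub>R e k)" for N i \<omega>
  have pi: "0 \<le> p i" "p i \<le> p (Suc i)" "0 \<le> p (Suc i)" if "i < n" for i
    using partition_bounds(1)[OF p, of i] partition_bounds(1)[OF p, of "Suc i"] p that by (auto simp: partition_def)
  have D_meas: "D N i \<in> borel_measurable M" if "i < n" for N i
    unfolding D_def
    by (intro borel_measurable_sum borel_measurable_scaleR borel_measurable_times borel_measurable_diff borel_measurable_const)
       (use pi[OF that] in \<open>auto intro!: \<beta>_measurable W_measurable\<close>)
  define C where "C = (\<Sum>i<n. real n * (onorm (\<Psi> i))\<^sup>2 * (p (Suc i) - p i))"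
  have C: "C \<ge> 0" unfolding C_def using pi by (intro sum_nonneg mult_nonneg_nonneg) auto
  have tail_nonneg: "0 \<le> eigenvalue_tail N" for N
    using trace_class_eigenvalues_square_summable[OF Q]
    by (intro suminf_nonneg summable_ignore_initial_segment[of "\<lambda>k. if k \<in> K then (\<gamma> k)\<^sup>2 else 0"]) auto
  have eq: "step_integral n p \<Psi> W \<omega> - step_sum \<beta> (K \<inter> {..<N}) n p v \<omega> = (\<Sum>i<n. \<Psi> i (D N i \<omega>))" for N \<omega>
  proof -
    have "\<Psi> i (D N i \<omega>) = \<Psi> i (W (p (Suc i)) \<omega> - W (p i) \<omega>) -
        (\<Sum>k\<in>K \<inter> {..<N}. (\<beta> k (p (Suc i)) \<omega> - \<beta> k (p i) \<omega>) *\<^sub>R v k i)" if "i < n" for i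
    proof -
      interpret bounded_linear "\<Psi> i" using \<Psi>[OF that] .
      show ?thesis unfolding D_def diff sum scaleR v_def
        by (simp add: mult.commute)
    qed
    then show ?thesis
      unfolding step_integral_def step_sum_def
      by (subst sum.swap) (simp add: sum_subtractf)
  qed
  have bound: "(\<integral>\<^sup>+\<omega>. ennreal ((norm (\<Sum>i<n. \<Psi> i (D N i \<omega>)))\<^sup>2) \<partial>M) \<le> ennreal (C * eigenvalue_tail N)" for N
  proof -
    have "ennreal ((norm (\<Sum>i<n. \<Psi> i (D N i \<omega>)))\<^sup>2) \<le> (\<Sum>i<n. ennreal (real n * (onorm (\<Psi> i))\<^sup>2) * ennreal ((norm (D N i \<omega>))\<^sup>2))" for \<omega>
    proof -
      have "(norm (\<Sum>i<n. \<Psi> i (D N i \<omega>)))\<^sup>2 \<le> real n * (\<Sum>i<n. (norm (\<Psi> i (D N i \<omega>)))\<^sup>2)"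
        using power2_norm_sum_le[of "\<lambda>i. \<Psi> i (D N i \<omega>)" "{..<n}"] by simp
      also have "\<dots> \<le> real n * (\<Sum>i<n. (onorm (\<Psi> i) * norm (D N i \<omega>))\<^sup>2)"
        by (intro mult_left_mono sum_mono power_mono onorm \<Psi>) auto
      also have "\<dots> = (\<Sum>i<n. real n * (onorm (\<Psi> i))\<^sup>2 * (norm (D N i \<omega>))\<^sup>2)"
        by (simp add: sum_distrib_left power_mult_distrib mult.assoc)
      finally have "ennreal ((norm (\<Sum>i<n. \<Psi> i (D N i \<omega>)))\<^sup>2) \<le> ennreal (\<Sum>i<n. real n * (onorm (\<Psi> i))\<^sup>2 * (norm (D N i \<omega>))\<^sup>2)"
        by (rule ennreal_leI)
      also have "\<dots> = (\<Sum>i<n. ennreal (real n * (onorm (\<Psi> i))\<^sup>2) * ennreal ((norm (D N i \<omega>))\<^sup>2))"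
        by (subst sum_ennreal[symmetric]) (auto simp: ennreal_mult)
      finally show ?thesis .
    qed
    then have "(\<integral>\<^sup>+\<omega>. ennreal ((norm (\<Sum>i<n. \<Psi> i (D N i \<omega>)))\<^sup>2) \<partial>M) \<le>
        (\<integral>\<^sup>+\<omega>. (\<Sum>i<n. ennreal (real n * (onorm (\<Psi> i))\<^sup>2) * ennreal ((norm (D N i \<omega>))\<^sup>2)) \<partial>M)"
      by (intro nn_integral_mono)
    also have "\<dots> = (\<Sum>i<n. ennreal (real n * (onorm (\<Psi> i))\<^sup>2) * (\<integral>\<^sup>+\<omega>. ennreal ((norm (D N i \<omega>))\<^sup>2) \<partial>M))"
      using D_meas by (subst nn_integral_sum) (auto intro!: sum.cong nn_integral_cmult)
    also have "\<dots> \<le> (\<Sum>i<n. ennreal (real n * (onorm (\<Psi> i))\<^sup>2) * ennreal ((p (Suc i) - p i) * eigenvalue_tail N))"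
      unfolding D_def using pi by (intro sum_mono mult_left_mono W_increment_tail) auto
    also have "\<dots> = (\<Sum>i<n. ennreal (real n * (onorm (\<Psi> i))\<^sup>2 * (p (Suc i) - p i) * eigenvalue_tail N))"
      using pi tail_nonneg by (intro sum.cong) (auto simp: mult.assoc simp flip: ennreal_mult)
    also have "\<dots> = ennreal (C * eigenvalue_tail N)"
      using pi tail_nonneg unfolding C_def sum_distrib_right
      by (intro sum_ennreal mult_nonneg_nonneg) auto
    finally show ?thesis .
  qed
  obtain N0 where N0: "\<And>N. N \<ge> N0 \<Longrightarrow> norm (eigenvalue_tail N) < \<epsilon> / (C + 1)"
    using suminf_exist_split[OF _ trace_class_eigenvalues_square_summable[OF Q], of "\<epsilon> / (C + 1)"] \<open>\<epsilon> > 0\<close> C by auto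
  have "(\<integral>\<^sup>+\<omega>. ennreal ((norm (step_integral n p \<Psi> W \<omega> - step_sum \<beta> (K \<inter> {..<N}) n p v \<omega>))\<^sup>2) \<partial>M) \<le> ennreal \<epsilon>" if "N \<ge> N0" for N
  proof -
    have "C * eigenvalue_tail N \<le> C * (\<epsilon> / (C + 1))"
      using N0[OF that] C by (intro mult_left_mono) auto
    also have "\<dots> \<le> \<epsilon>" using C \<open>\<epsilon> > 0\<close> by (simp add: field_simps)
    finally show ?thesis unfolding eq by (intro order_trans[OF bound] ennreal_leI)
  qed
  then show ?thesis by (auto simp: eventually_sequentially)
qed

text \<open>The order of the two limits matters: the step function is fixed first and the truncation
  level is sent to infinity afterwards, because the truncation constant depends on the step
  function.\<close>

lemma stochastic_integral_step_approximable:
  fixes \<Phi> :: "real \<Rightarrow> 'l \<Rightarrow> 'h::{real_inner,banach,second_countable_topology}"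
  assumes Y: "stochastic_integral M K e Q W T \<Phi> Y"
  shows "step_approximable T (\<lambda>k s. if k \<in> K then indicator {0..T} s *\<^sub>R \<Phi> s (Q (e k)) else 0) Y"
  unfolding step_approximable_def
proof (intro conjI allI impI)
  have [measurable]: "Y \<in> borel_measurable M" using Y by (simp add: stochastic_integral_def)
  then show "Y \<in> borel_measurable M" .
  fix \<epsilon> :: real assume "\<epsilon> > 0"
  obtain n p \<Psi> where part: "\<And>m. partition T (n m) (p m)" and \<Psi>: "\<And>m i. i < n m \<Longrightarrow> bounded_linear (\<Psi> m i)"
    and lim1: "(\<lambda>m. \<integral>\<^sup>+s\<in>{0..T}. hilbert_schmidt_norm2 K e
            (\<lambda>u. \<Phi> s (Q u) - step_function (n m) (p m) (\<Psi> m) s (Q u)) \<partial>lborel) \<longlonglongrightarrow> 0"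
    and lim2: "(\<lambda>m. \<integral>\<^sup>+\<omega>. ennreal ((norm (Y \<omega> - step_integral (n m) (p m) (\<Psi> m) W \<omega>))\<^sup>2) \<partial>M) \<longlonglongrightarrow> 0"
    using Y unfolding stochastic_integral_def by blast
  have pos: "0 < ennreal (\<epsilon> / 4)" using \<open>\<epsilon> > 0\<close> by simp
  from eventually_conj[OF order_tendstoD(2)[OF lim1 pos] order_tendstoD(2)[OF lim2 pos]]
  obtain m where m1: "(\<integral>\<^sup>+s\<in>{0..T}. hilbert_schmidt_norm2 K e
            (\<lambda>u. \<Phi> s (Q u) - step_function (n m) (p m) (\<Psi> m) s (Q u)) \<partial>lborel) < ennreal (\<epsilon> / 4)"
    and m2: "(\<integral>\<^sup>+\<omega>. ennreal ((norm (Y \<omega> - step_integral (n m) (p m) (\<Psi> m) W \<omega>))\<^sup>2) \<partial>M) < ennreal (\<epsilon> / 4)"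
    by (auto simp: eventually_sequentially)
  define v where "v k i = (if k \<in> K then \<gamma> k *\<^sub>R \<Psi> m i (e k) else 0)" for k i
  let ?G = "\<lambda>N. step_sum \<beta> (K \<inter> {..<N}) (n m) (p m) v"
  let ?SI = "step_integral (n m) (p m) (\<Psi> m) W"
  have [measurable]: "?G N \<in> borel_measurable M" for N by (rule step_sum_measurable[OF _ part]) simp
  have [measurable]: "?SI \<in> borel_measurable M"
    unfolding step_integral_def
  proof (rule borel_measurable_sum)
    fix i assume "i \<in> {..<n m}"
    then have i: "i < n m" by simp
    then have "W (p m (Suc i)) \<in> borel_measurable M" "W (p m i) \<in> borel_measurable M"
      using partition_bounds(1)[OF part[of m], of i] partition_bounds(1)[OF part[of m], of "Suc i"] by (auto intro!: W_measurable)
    moreover have "\<Psi> m i \<in> borel_measurable borel"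
      using \<Psi>[OF i] by (intro borel_measurable_continuous_onI linear_continuous_on)
    ultimately show "(\<lambda>\<omega>. \<Psi> m i (W (p m (Suc i)) \<omega> - W (p m i) \<omega>)) \<in> borel_measurable M"
      by (intro measurable_compose[of _ M borel "\<Psi> m i"] borel_measurable_diff) auto
  qed
  have step: "step_function (n m) (p m) (\<Psi> m) s (Q (e k)) = step_vec (n m) (p m) (v k) s" if "k \<in> K" for k s
    unfolding step_function_def step_vec_def using \<Psi> that
    by (intro sum.cong refl) (simp add: v_def Q_basis linear_simps)
  \<comment> \<open>The Ito norm is expanded into modes. Terms with \<open>k\<close> outside
    \<open>K\<close> are zero, and outside \<open>[0, T]\<close> the step function vanishes along
    with the extended integrand.\<close>
  have "(\<Sum>k. ennreal ((norm ((if k \<in> K then indicator {0..T} s *\<^sub>R \<Phi> s (Q (e k)) else 0) - step_vec (n m) (p m) (v k) s))\<^sup>2))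
     = hilbert_schmidt_norm2 K e (\<lambda>u. \<Phi> s (Q u) - step_function (n m) (p m) (\<Psi> m) s (Q u)) * indicator {0..T} s" for s
  proof (cases "s \<in> {0..T}")
    case True
    have "step_vec (n m) (p m) (v k) s = 0" if "k \<notin> K" for k
      using that by (simp add: step_vec_def v_def)
    then show ?thesis
      using True unfolding hilbert_schmidt_norm2_def infsum_ennreal_nat
      by (auto intro!: suminf_cong simp: step)
  next
    case False
    then have ind: "indicator {0..T} s = (0 :: real)" "indicator {0..T} s = (0 :: ennreal)" by (simp_all add: indicator_def)
    have "(if k \<in> K then indicator {0..T} s *\<^sub>R \<Phi> s (Q (e k)) else 0) - step_vec (n m) (p m) (v k) s = 0" for k
      unfolding ind step_vec_outside[OF part False] by simp
    then show ?thesis unfolding ind by simp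
  qed
  then have D: "(\<integral>\<^sup>+s. (\<Sum>k. ennreal ((norm ((if k \<in> K then indicator {0..T} s *\<^sub>R \<Phi> s (Q (e k)) else 0) - step_vec (n m) (p m) (v k) s))\<^sup>2)) \<partial>lborel) \<le> ennreal \<epsilon>"
    using order_trans[OF less_imp_le[OF m1] ennreal_leI[of "\<epsilon> / 4" \<epsilon>]] \<open>\<epsilon> > 0\<close> by (simp only:)
  have "\<forall>\<^sub>F N in sequentially. (\<integral>\<^sup>+\<omega>. ennreal ((norm (?SI \<omega> - ?G N \<omega>))\<^sup>2) \<partial>M) \<le> ennreal (\<epsilon> / 4)"
    using step_integral_truncation[OF part, of m "\<Psi> m" "\<epsilon> / 4"] \<Psi> \<open>\<epsilon> > 0\<close> by (simp add: v_def[abs_def])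
  then have L: "\<forall>\<^sub>F N in sequentially. (\<integral>\<^sup>+\<omega>. ennreal ((norm (Y \<omega> - ?G N \<omega>))\<^sup>2) \<partial>M) \<le> ennreal \<epsilon>"
  proof eventually_elim
    case (elim N)
    have "(\<integral>\<^sup>+\<omega>. ennreal ((norm (Y \<omega> - ?G N \<omega>))\<^sup>2) \<partial>M) \<le>
        2 * (\<integral>\<^sup>+\<omega>. ennreal ((norm (Y \<omega> - ?SI \<omega>))\<^sup>2) \<partial>M) + 2 * (\<integral>\<^sup>+\<omega>. ennreal ((norm (?SI \<omega> - ?G N \<omega>))\<^sup>2) \<partial>M)"
      using nn_integral_power2_norm_add_le[of "\<lambda>\<omega>. Y \<omega> - ?SI \<omega>" M "\<lambda>\<omega>. ?SI \<omega> - ?G N \<omega>"] by simp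
    also have "\<dots> \<le> 2 * ennreal (\<epsilon> / 4) + 2 * ennreal (\<epsilon> / 4)"
      by (rule add_mono[OF mult_left_mono[OF less_imp_le[OF m2]] mult_left_mono[OF elim]]) auto
    also have "\<dots> = ennreal \<epsilon>"
    proof -
      have "2 * ennreal x = ennreal (2 * x)" if "x \<ge> 0" for x
        using that by (simp add: ennreal_mult)
      then show ?thesis using \<open>\<epsilon> > 0\<close> by (simp flip: ennreal_plus)
    qed
    finally show ?case .
  qed
  have "\<forall>k i. k \<notin> K \<longrightarrow> v k i = 0" by (simp add: v_def)
  then show "\<exists>n p v. partition T n p \<and> (\<forall>k i. k \<notin> K \<longrightarrow> v k i = 0) \<and>
     (\<integral>\<^sup>+s. (\<Sum>k. ennreal ((norm ((if k \<in> K then indicator {0..T} s *\<^sub>R \<Phi> s (Q (e k)) else 0) - step_vec n p (v k) s))\<^sup>2)) \<partial>lborel) \<le> ennreal \<epsilon> \<and>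
     (\<forall>\<^sub>F N in sequentially. (\<integral>\<^sup>+\<omega>. ennreal ((norm (Y \<omega> - step_sum \<beta> (K \<inter> {..<N}) n p v \<omega>))\<^sup>2) \<partial>M) \<le> ennreal \<epsilon>)"
    by (intro exI[of _ "n m"] exI[of _ "p m"] exI[of _ v] conjI part D L)
qed

end
end

section \<open>Observability\<close>

text \<open>The uniform boundedness principle is applied to the functionals
  \<open>x \<mapsto> (x \<bullet> L z) / sqrt (r z)\<close>, indexed by the \<open>z\<close> with
  \<open>r z > 0\<close>; evaluating them at \<open>x = L z\<close> gives the norm bound.\<close>

lemma pointwise_dominated_imp_dominated:
  fixes L :: "'z \<Rightarrow> 'h::{real_inner,banach}"
  assumes r: "\<And>z. 0 \<le> r z" and dom: "\<And>x. \<exists>c. \<forall>z. (x \<bullet> L z)\<^sup>2 \<le> c * r z"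
  shows "\<exists>C>0. \<forall>z. (norm (L z))\<^sup>2 \<le> C * r z"
proof -
  let ?\<F> = "(\<lambda>z x. (x \<bullet> L z) / sqrt (r z)) ` {z. r z > 0}"
  have bl: "bounded_linear f" if "f \<in> ?\<F>" for f
    using that by (auto intro!: bounded_linear_divide bounded_linear_inner_left
        bounded_linear_compose[of "\<lambda>x. x / _"])
  have pw: "\<exists>c. \<forall>f\<in>?\<F>. norm (f x) \<le> c" for x
  proof -
    obtain c where c: "\<And>z. (x \<bullet> L z)\<^sup>2 \<le> c * r z" using dom by blast
    have "norm ((x \<bullet> L z) / sqrt (r z)) \<le> sqrt c" if "r z > 0" for z
    proof (rule real_le_rsqrt)
      show "(norm ((x \<bullet> L z) / sqrt (r z)))\<^sup>2 \<le> c"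
        using c[of z] that by (simp add: power_divide divide_le_eq)
    qed
    then show ?thesis by auto
  qed
  have "\<exists>C. \<forall>f\<in>?\<F>. \<forall>x. norm (f x) \<le> C * norm x"
    by (rule uniform_boundedness[OF bl pw])
  then obtain C where "\<forall>f\<in>?\<F>. \<forall>x. norm (f x) \<le> C * norm x" by (elim exE)
  then have C: "norm ((x \<bullet> L z) / sqrt (r z)) \<le> C * norm x" if "r z > 0" for x z
    using that by (auto dest: ball_imageD)
  have "(norm (L z))\<^sup>2 \<le> (C\<^sup>2 + 1) * r z" for z
  proof (cases "r z = 0")
    \<comment> \<open>No functional belongs to such a \<open>z\<close>; here the pointwise bound at
      \<open>x = L z\<close> forces \<open>L z = 0\<close>.\<close>
    case True
    obtain c where "(L z \<bullet> L z)\<^sup>2 \<le> c * r z" using dom by blast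
    with True show ?thesis by simp
  next
    case False
    then have pos: "r z > 0" using r[of z] by simp
    have "norm ((L z \<bullet> L z) / sqrt (r z)) \<le> C * norm (L z)" by (rule C[OF pos])
    then have "norm (L z) * norm (L z) \<le> norm (L z) * (C * sqrt (r z))"
      using pos by (simp add: dot_square_norm power2_eq_square divide_le_eq ac_simps)
    then have "norm (L z) \<le> \<bar>C\<bar> * sqrt (r z) \<or> norm (L z) = 0"
      using pos by (auto simp: mult_le_cancel_left intro: order_trans mult_right_mono)
    then have "norm (L z) \<le> \<bar>C\<bar> * sqrt (r z)" using pos by auto
    then have "(norm (L z))\<^sup>2 \<le> (\<bar>C\<bar> * sqrt (r z))\<^sup>2" by (intro power_mono) auto
    also have "\<dots> = C\<^sup>2 * r z" using pos by (simp add: power_mult_distrib)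
    also have "\<dots> \<le> (C\<^sup>2 + 1) * r z" using pos by simp
    finally show ?thesis .
  qed
  moreover have "C\<^sup>2 + 1 > 0" by (intro add_nonneg_pos) auto
  ultimately show ?thesis by blast
qed

context semigroup_c0
begin

definition observation :: "('l::real_inner \<Rightarrow> 'h) \<Rightarrow> real \<Rightarrow> 'h \<Rightarrow> real" where
  "observation D T z = (LBINT t:{0..T}. (norm (adjoint D (Sadj (T - t) z)))\<^sup>2)"

context
  fixes D :: "'l::{real_inner,banach} \<Rightarrow> 'h" and T :: real
  assumes D: "bounded_linear D" and T: "T > 0"
begin

lemma continuous_on_observation: "continuous_on {0..T} (\<lambda>t. adjoint D (Sadj (T - t) z))"
proof (rule bounded_linear.continuous_on[OF bounded_linear_adjoint(1)[OF D]])
  show "continuous_on {0..T} (\<lambda>t. Sadj (T - t) z)"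
    by (rule continuous_on_compose2[OF continuous_on_Sadj[of T z]]) (auto intro!: continuous_intros)
qed

lemma set_integrable_observation: "set_integrable lborel {0..T} (\<lambda>t. (norm (adjoint D (Sadj (T - t) z)))\<^sup>2)"
  by (intro borel_integrable_atLeastAtMost' continuous_intros continuous_on_observation)

lemma observation_nonneg: "0 \<le> observation D T z"
  unfolding observation_def set_lebesgue_integral_def by (intro integral_nonneg_AE) auto

text \<open>Together with \<open>observation_bounded\<close> this replaces continuity of the
  quadratic form when estimates are extended from a dense set, at the cost of a factor 2.\<close>

lemma observation_add_le: "observation D T (y + z) \<le> 2 * observation D T y + 2 * observation D T z"
proof -
  have "observation D T (y + z) \<le> (LBINT t:{0..T}. 2 * (norm (adjoint D (Sadj (T - t) y)))\<^sup>2 + 2 * (norm (adjoint D (Sadj (T - t) z)))\<^sup>2)"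
    unfolding observation_def
  proof (rule set_integral_mono)
    fix t assume "t \<in> {0..T}"
    then have "adjoint D (Sadj (T - t) (y + z)) = adjoint D (Sadj (T - t) y) + adjoint D (Sadj (T - t) z)"
      using bounded_linear_adjoint(1)[OF bounded_linear_S, of "T - t"] bounded_linear_adjoint(1)[OF D]
      by (simp add: linear_simps)
    then show "(norm (adjoint D (Sadj (T - t) (y + z))))\<^sup>2 \<le> 2 * (norm (adjoint D (Sadj (T - t) y)))\<^sup>2 + 2 * (norm (adjoint D (Sadj (T - t) z)))\<^sup>2"
      by (simp add: power2_norm_add_le)
  qed (intro set_integrable_observation set_integral_add set_integrable_mult_right)+
  also have "\<dots> = 2 * observation D T y + 2 * observation D T z"
    unfolding observation_def
    by (subst set_integral_add) (simp_all add: set_integrable_observation)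
  finally show ?thesis .
qed

lemma observation_bounded:
  obtains c where "c \<ge> 0" "\<And>z. observation D T z \<le> c * (norm z)\<^sup>2"
proof -
  obtain C where C: "C \<ge> 0" "\<And>t x. 0 \<le> t \<Longrightarrow> t \<le> T \<Longrightarrow> norm (S t x) \<le> C * norm x"
    using locally_bounded by blast
  have "observation D T z \<le> T * (onorm D * C)\<^sup>2 * (norm z)\<^sup>2" for z
  proof -
    have "observation D T z \<le> (LBINT t:{0..T}. (onorm D * (C * norm z))\<^sup>2)"
      unfolding observation_def
    proof (rule set_integral_mono[OF set_integrable_observation])
      fix t assume t: "t \<in> {0..T}"
      have "norm (adjoint D (Sadj (T - t) z)) \<le> onorm D * norm (Sadj (T - t) z)"
        by (rule bounded_linear_adjoint(2)[OF D])
      also have "\<dots> \<le> onorm D * (C * norm z)"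
        using t C by (intro mult_left_mono norm_Sadj_le onorm_pos_le D) auto
      finally show "(norm (adjoint D (Sadj (T - t) z)))\<^sup>2 \<le> (onorm D * (C * norm z))\<^sup>2"
        by (intro power_mono) auto
    qed (intro borel_integrable_atLeastAtMost' continuous_intros)
    also have "\<dots> = T * (onorm D * C)\<^sup>2 * (norm z)\<^sup>2"
      using T by (simp add: set_lebesgue_integral_def power_mult_distrib)
    finally show ?thesis .
  qed
  then show thesis using T that[of "T * (onorm D * C)\<^sup>2"] by simp
qed

text \<open>Observability concerns terminal values in the domain of the adjoint generator, where
  classical solutions exist, while the probabilistic side yields a bound for every \<open>z\<close>.
  Density and boundedness of both sides bridge the gap, with \<open>2 / C\<close> as the new
  constant.\<close>

lemma observability_iff:
  "(\<exists>C>0. \<forall>z\<in>Domain Astar. \<forall>Z. solves_adjoint_system (generator S) T z Z \<longrightarrow>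
      (LBINT t:{0..T}. (norm (adjoint D (Z t)))\<^sup>2) \<ge> C * (norm (Z 0))\<^sup>2) \<longleftrightarrow>
    (\<exists>C>0. \<forall>z. (norm (Sadj T z))\<^sup>2 \<le> C * observation D T z)" (is "?obs \<longleftrightarrow> ?dom")
proof
  assume ?obs
  then obtain C where C: "C > 0" and obs: "\<And>z Z. z \<in> Domain Astar \<Longrightarrow> solves_adjoint_system (generator S) T z Z \<Longrightarrow>
      C * (norm (Z 0))\<^sup>2 \<le> (LBINT t:{0..T}. (norm (adjoint D (Z t)))\<^sup>2)" by blast
  have dense: "C * (norm (Sadj T z))\<^sup>2 \<le> observation D T z" if "z \<in> Domain Astar" for z
  proof -
    obtain w where "(z, w) \<in> Astar" using \<open>z \<in> Domain Astar\<close> by blast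
    from obs[OF that solves_adjoint_system_Sadj[OF this]]
    show ?thesis by (simp add: observation_def)
  qed
  obtain c where c: "c \<ge> 0" "\<And>z. observation D T z \<le> c * (norm z)\<^sup>2" using observation_bounded by blast
  have "(norm (Sadj T z))\<^sup>2 \<le> (2 / C) * observation D T z" for z
  proof -
    have "z \<in> closure (Domain Astar)" by (simp add: Domain_Astar_dense)
    then obtain u where u: "\<And>n. u n \<in> Domain Astar" "u \<longlonglongrightarrow> z" by (auto simp: closure_sequential)
    have le: "C * (norm (Sadj T (u n)))\<^sup>2 \<le> 2 * observation D T z + 2 * (c * (norm (u n - z))\<^sup>2)" for n
    proof -
      have "C * (norm (Sadj T (u n)))\<^sup>2 \<le> observation D T (z + (u n - z))" using dense[OF u(1)] by simp
      also have "\<dots> \<le> 2 * observation D T z + 2 * observation D T (u n - z)" by (rule observation_add_le)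
      also have "\<dots> \<le> 2 * observation D T z + 2 * (c * (norm (u n - z))\<^sup>2)" using c(2) by simp
      finally show ?thesis .
    qed
    have "(\<lambda>n. C * (norm (Sadj T (u n)))\<^sup>2) \<longlonglongrightarrow> C * (norm (Sadj T z))\<^sup>2"
      using T by (intro tendsto_intros bounded_linear.tendsto[OF bounded_linear_adjoint(1)[OF bounded_linear_S]] u(2)) simp
    moreover have "(\<lambda>n. 2 * observation D T z + 2 * (c * (norm (u n - z))\<^sup>2)) \<longlonglongrightarrow> 2 * observation D T z + 2 * (c * (norm (z - z))\<^sup>2)"
      by (intro tendsto_intros u(2))
    ultimately have "C * (norm (Sadj T z))\<^sup>2 \<le> 2 * observation D T z + 2 * (c * (norm (z - z))\<^sup>2)"
      by (rule LIMSEQ_le) (use le in blast)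
    then show ?thesis using C by (simp add: field_simps)
  qed
  then show ?dom using C by (intro exI[of _ "2 / C"]) auto
next
  assume ?dom
  then obtain C where C: "C > 0" and dom: "\<And>z. (norm (Sadj T z))\<^sup>2 \<le> C * observation D T z" by blast
  show ?obs
  proof (intro exI[of _ "1 / C"] conjI ballI allI impI)
    fix z Z assume Z: "solves_adjoint_system (generator S) T z Z"
    have "(LBINT t:{0..T}. (norm (adjoint D (Z t)))\<^sup>2) = observation D T z"
      unfolding observation_def
      by (rule set_lebesgue_integral_cong) (auto simp: solves_adjoint_system_unique[OF Z])
    moreover have "Z 0 = Sadj T z" using solves_adjoint_system_unique[OF Z, of 0] T by simp
    ultimately show "1 / C * (norm (Z 0))\<^sup>2 \<le> (LBINT t:{0..T}. (norm (adjoint D (Z t)))\<^sup>2)"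
      using dom[of z] C by (simp add: field_simps)
  qed (use C in simp)
qed

text \<open>Moving \<open>S (T - s)\<close> and \<open>D\<close> to the other side of the inner
  product turns the sum over modes into the Parseval sum of
  \<open>adjoint D (Sadj (T - s) z)\<close>. This links the variance of the convolution to
  observability.\<close>

lemma observation_eq_suminf:
  fixes e :: "nat \<Rightarrow> 'l"
  assumes e: "orthonormal_basis K e"
  shows "(\<integral>\<^sup>+s. (\<Sum>k. ennreal (((if k \<in> K then indicator {0..T} s *\<^sub>R S (T - s) (D (e k)) else 0) \<bullet> z)\<^sup>2)) \<partial>lborel)
    = ennreal (observation D T z)"
proof -
  have "(\<Sum>k. ennreal (((if k \<in> K then indicator {0..T} s *\<^sub>R S (T - s) (D (e k)) else 0) \<bullet> z)\<^sup>2))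
      = ennreal (indicator {0..T} s *\<^sub>R (norm (adjoint D (Sadj (T - s) z)))\<^sup>2)" for s
  proof (cases "s \<in> {0..T}")
    case True
    have "S (T - s) (D x) \<bullet> z = adjoint D (Sadj (T - s) z) \<bullet> x" for x
    proof -
      have "S (T - s) (D x) \<bullet> z = D x \<bullet> Sadj (T - s) z" using True by (intro Sadj[symmetric]) simp
      also have "\<dots> = x \<bullet> adjoint D (Sadj (T - s) z)" by (rule adjoint_inner[OF D])
      finally show ?thesis by (simp only: inner_commute)
    qed
    then have "(\<Sum>k. ennreal (((if k \<in> K then indicator {0..T} s *\<^sub>R S (T - s) (D (e k)) else 0) \<bullet> z)\<^sup>2))
        = (\<Sum>k. if k \<in> K then ennreal ((adjoint D (Sadj (T - s) z) \<bullet> e k)\<^sup>2) else 0)"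
      using True by (intro suminf_cong) simp
    then show ?thesis using True parseval[OF e] by simp
  next
    case False
    then have ind: "indicator {0..T} s = (0 :: real)" by (simp add: indicator_def)
    have "((if k \<in> K then indicator {0..T} s *\<^sub>R S (T - s) (D (e k)) else 0) \<bullet> z)\<^sup>2 = 0" for k
      unfolding ind by simp
    then show ?thesis unfolding ind by simp
  qed
  then have "(\<integral>\<^sup>+s. (\<Sum>k. ennreal (((if k \<in> K then indicator {0..T} s *\<^sub>R S (T - s) (D (e k)) else 0) \<bullet> z)\<^sup>2)) \<partial>lborel)
      = (\<integral>\<^sup>+s. ennreal (indicator {0..T} s *\<^sub>R (norm (adjoint D (Sadj (T - s) z)))\<^sup>2) \<partial>lborel)" by simp
  also have "\<dots> = ennreal (observation D T z)"
    unfolding observation_def set_lebesgue_integral_def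
    using set_integrable_observation by (intro nn_integral_eq_integral) (auto simp: set_integrable_def)
  finally show ?thesis .
qed

lemma convolution_measurable: "(\<lambda>s. indicator {0..T} s *\<^sub>R S (T - s) x) \<in> borel_measurable borel"
proof (rule borel_measurable_continuous_on_indicator)
  show "continuous_on {0..T} (\<lambda>s. S (T - s) x)"
    by (rule continuous_on_compose2[OF continuous_on_S[of x]]) (auto intro!: continuous_intros)
qed simp

end
end

theorem theorem1:
  fixes S :: "real \<Rightarrow> 'h \<Rightarrow> 'h::{real_inner,banach,second_countable_topology}"
    and A :: "('h \<times> 'h) set"
    and B :: "'l::{real_inner,banach,second_countable_topology} \<Rightarrow> 'h"
    and Q :: "'l \<Rightarrow> 'l" and K :: "nat set" and e :: "nat \<Rightarrow> 'l" and \<gamma> :: "nat \<Rightarrow> real"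
    and M :: "'w measure" and F :: "real \<Rightarrow> 'w measure"
    and \<beta> :: "nat \<Rightarrow> real \<Rightarrow> 'w \<Rightarrow> real" and W :: "real \<Rightarrow> 'w \<Rightarrow> 'l"
    and X :: "real \<Rightarrow> 'h \<Rightarrow> 'w \<Rightarrow> 'h" and T :: real
  assumes "c0_semigroup S" and "A = generator S"
    and "bounded_linear B"
    and "\<And>t. t > 0 \<Longrightarrow> trace_class (Qt S B t)"
    and "noise_covariance Q K e \<gamma>"
    and "prob_space M" and "time_filtration M F"
    and "wiener_process M F K e \<gamma> \<beta> W"
    and "mild_solution M F K e Q W S B X"
    and "T > 0"
  shows "regular_at (transition M X) T \<longleftrightarrow>
    (\<exists>C>0. \<forall>z \<in> Domain (adjoint_graph A). \<forall>Z. solves_adjoint_system A T z Z \<longrightarrow>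
       (LBINT t:{0..T}. (norm (adjoint (B \<circ> Q) (Z t)))\<^sup>2) \<ge> C * (norm (Z 0))\<^sup>2)"
proof -
  interpret semigroup_c0 S by standard fact
  interpret prob_space M by fact
  interpret brownian_noise M F K \<beta>
    by standard (use assms(7,8) in \<open>auto simp: wiener_process_def\<close>)
  have e: "orthonormal_basis K e" using assms(5) by (simp add: noise_covariance_def)
  have D: "bounded_linear (B \<circ> Q)"
    using bounded_linear_compose[OF assms(3)] assms(5) by (auto simp: noise_covariance_def o_def)
  note obs_iff = observability_iff[OF D \<open>T > 0\<close>]
  let ?obs = "observation (B \<circ> Q) T"
  define \<phi> where "\<phi> k s = (if k \<in> K then indicator {0..T} s *\<^sub>R S (T - s) ((B \<circ> Q) (e k)) else 0)" for k s
  have \<phi>: "\<phi> k \<in> borel_measurable borel" for k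
    unfolding \<phi>_def by (cases "k \<in> K") (simp_all add: convolution_measurable[OF D \<open>T > 0\<close>, simplified])
  have I: "(\<integral>\<^sup>+s. (\<Sum>k. ennreal ((\<phi> k s \<bullet> z)\<^sup>2)) \<partial>lborel) = ennreal (?obs z)" for z
    unfolding \<phi>_def by (rule observation_eq_suminf[OF D \<open>T > 0\<close> e])
  have mild: "X T x \<in> borel_measurable M \<and> (\<exists>Y. step_approximable T \<phi> Y \<and> (AE \<omega> in M. X T x \<omega> = S T x + Y \<omega>))" for x
  proof -
    from assms(9) \<open>T > 0\<close> obtain Y where X: "X T x \<in> borel_measurable (F T)"
      and Y: "stochastic_integral M K e Q W T (\<lambda>s u. S (T - s) (B u)) Y" "AE \<omega> in M. X T x \<omega> = S T x + Y \<omega>"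
      unfolding mild_solution_def by (meson less_imp_le)
    have "step_approximable T \<phi> Y"
      using stochastic_integral_step_approximable[OF assms(8,5) Y(1)] by (simp add: \<phi>_def[abs_def] cong: if_cong)
    then show ?thesis using Y(2) measurable_from_subalg[OF F_subalgebra X] \<open>T > 0\<close> by auto
  qed
  \<comment> \<open>The version belonging to some initial state is fixed; by uniqueness it also
    represents the solution for every other state.\<close>
  then obtain Y where Y: "step_approximable T \<phi> Y" by blast
  have [measurable]: "Y \<in> borel_measurable M" using Y by (rule step_approximable_measurable)
  have transition_eq: "transition M X T x = distr M borel (\<lambda>\<omega>. S T x + Y \<omega>)" for x
  proof -
    obtain Y' where Y': "step_approximable T \<phi> Y'" "AE \<omega> in M. X T x \<omega> = S T x + Y' \<omega>"
      and [measurable]: "X T x \<in> borel_measurable M" using mild by blast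
    have "AE \<omega> in M. X T x \<omega> = S T x + Y \<omega>"
      using Y'(2) step_approximable_unique[OF Y'(1) Y \<phi>] by eventually_elim simp
    then show ?thesis unfolding transition_def by (intro distr_cong_AE) auto
  qed
  have S_inner: "S T x \<bullet> z = x \<bullet> Sadj T z" for x z using Sadj[of T x z] \<open>T > 0\<close> by simp
  have "regular_at (transition M X) T \<longleftrightarrow> (\<exists>C>0. \<forall>z. (norm (Sadj T z))\<^sup>2 \<le> C * ?obs z)"
  proof
    assume reg: "regular_at (transition M X) T"
    have dom: "\<exists>c. \<forall>z. (x \<bullet> Sadj T z)\<^sup>2 \<le> c * ?obs z" for x
    proof -
      \<comment> \<open>From the initial state 0 the transition law is the law of \<open>Y\<close>
        itself, so regularity compares it with its shift by \<open>S T x\<close>.\<close>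
      have "S T 0 = 0" using bounded_linear_S[of T] \<open>T > 0\<close> by (simp add: linear_simps)
      then have "absolutely_continuous (distr M borel Y) (distr M borel (\<lambda>\<omega>. S T x + Y \<omega>))"
        using reg[unfolded regular_at_def, rule_format, of 0 x] by (simp add: transition_eq)
      then obtain c where c: "c \<ge> 0" "\<And>z. ennreal ((S T x \<bullet> z)\<^sup>2) \<le> ennreal c * (\<integral>\<^sup>+\<omega>. ennreal ((Y \<omega> \<bullet> z)\<^sup>2) \<partial>M)"
        using shift_absolutely_continuous_imp_dominated[OF prob_space_axioms] by (metis \<open>Y \<in> borel_measurable M\<close>)
      have "(x \<bullet> Sadj T z)\<^sup>2 \<le> (c * 4) * ?obs z" for z
      proof -
        have "ennreal ((x \<bullet> Sadj T z)\<^sup>2) \<le> ennreal c * (4 * ennreal (?obs z))"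
          unfolding S_inner[symmetric] I[symmetric]
          by (rule order_trans[OF c(2) mult_left_mono[OF step_approximable_second_moment(1)[OF Y \<phi>]]]) simp
        also have "\<dots> = ennreal (c * 4 * ?obs z)"
          using c(1) observation_nonneg[OF D \<open>T > 0\<close>] by (simp add: ennreal_mult mult.assoc)
        finally show ?thesis
          using c(1) observation_nonneg[OF D \<open>T > 0\<close>] by (subst (asm) ennreal_le_iff) auto
      qed
      then show ?thesis by blast
    qed
    show "\<exists>C>0. \<forall>z. (norm (Sadj T z))\<^sup>2 \<le> C * ?obs z"
      by (rule pointwise_dominated_imp_dominated[OF observation_nonneg[OF D \<open>T > 0\<close>] dom])
  next
    assume "\<exists>C>0. \<forall>z. (norm (Sadj T z))\<^sup>2 \<le> C * ?obs z"
    then obtain C where C: "C > 0" "\<And>z. (norm (Sadj T z))\<^sup>2 \<le> C * ?obs z" by blast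
    show "regular_at (transition M X) T"
      unfolding regular_at_def
    proof (intro allI)
      fix x y
      \<comment> \<open>Both laws are translates of the law of \<open>Y\<close>, and
        \<open>?h\<close> is the difference of the translations. Cauchy-Schwarz on
        \<open>(y - x) \<bullet> Sadj T z\<close> yields the constant
        \<open>(norm (y - x))^2 * C\<close>.\<close>
      let ?h = "S T (y - x)"
      have "ennreal ((?h \<bullet> z)\<^sup>2) \<le> ennreal ((norm (y - x))\<^sup>2 * C) * ennreal (?obs z)" for z
      proof -
        have "(?h \<bullet> z)\<^sup>2 \<le> (norm (y - x) * norm (Sadj T z))\<^sup>2"
          unfolding S_inner using Cauchy_Schwarz_ineq2 by (metis abs_ge_zero power2_abs power_mono)
        also have "\<dots> \<le> (norm (y - x))\<^sup>2 * (C * ?obs z)"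
          unfolding power_mult_distrib by (intro mult_left_mono C(2)) simp
        finally have "ennreal ((?h \<bullet> z)\<^sup>2) \<le> ennreal ((norm (y - x))\<^sup>2 * C * ?obs z)"
          by (simp add: mult.assoc ennreal_leI)
        then show ?thesis
          using C(1) observation_nonneg[OF D \<open>T > 0\<close>] by (simp add: ennreal_mult)
      qed
      then have "absolutely_continuous (distr M borel (\<lambda>\<omega>. S T x + Y \<omega>)) (distr M borel (\<lambda>\<omega>. S T x + ?h + Y \<omega>))"
        unfolding I[symmetric]
        by (intro step_approximable_shift_absolutely_continuous[OF Y \<phi>, where c = "(norm (y - x))\<^sup>2 * C"]) (use C in auto)
      moreover have "S T x + ?h = S T y" using \<open>T > 0\<close> by (simp add: S_diff)
      ultimately show "absolutely_continuous (transition M X T x) (transition M X T y)"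
        by (simp add: transition_eq)
    qed
  qed
  then show ?thesis unfolding \<open>A = generator S\<close> obs_iff .
qed

end
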